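(* Let $B$ be a Hopf algebra with bijective antipode over a field $k$. Then the Heisenberg double $\mathscr{H}(B^* )$, endowed with the left $\mathscr{D}(B)$-action $$(\mu\otimes m)\triangleright(\alpha\# a)=\mu'''(m'\rightharpoonup\alpha)\,{S^*}^{-1}(\mu'')\,\#\,\bigl((m''aS(m'''))\leftharpoonup {S^*}^{-1}(\mu')\bigr)$$ and the left $\mathscr{D}(B)$-coaction $$\delta(\beta\# b)=(\beta''\otimes b')\otimes(\beta'\# b''),$$ where $\mu,\alpha,\beta\in B^*$ and $m,a,b\in B$, is a left--left Yetter--Drinfeld module algebra over the Drinfeld double $\mathscr{D}(B)$.
   Context: Notation. $B$ is a Hopf algebra with bijective antipode $S$ over a field $k$; $B^*$ is the dual Hopf algebra (the finite dual of $B$, which is the full linear dual when $\dim B<\infty$), with evaluation pairing $\langle\ ,\ \rangle$, product $\langle\alpha\beta,b\rangle=\langle\alpha,b'\rangle\langle\beta,b''\rangle$, coproduct determined by $\langle\beta,ab\rangle=\langle\beta',a\rangle\langle\beta'',b\rangle$, unit $\varepsilon$ (the counit of $B$), and antipode $S^*$ with inverse ${S^*}^{-1}$. Primes denote Sweedler components: $\Delta(x)=x'\otimes x''$, $(\Delta\otimes\mathrm{id})\Delta(x)=x'\otimes x''\otimes x'''$ (coproducts in $B$, in $B^*$, or in $\mathscr{D}(B)$ as appropriate). Regular actions: $b\rightharpoonup\beta=\langle\beta'',b\rangle\beta'$ and $\beta\leftharpoonup b=\langle\beta',b\rangle\beta''$ (left and right actions of $B$ on $B^*$); $\beta\rightharpoonup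 b=\langle\beta,b''\rangle b'$ and $b\leftharpoonup\beta=\langle\beta,b'\rangle b''$ (left and right actions of $B^*$ on $B$). Heisenberg double: $\mathscr{H}(B^* )=B^*\# B$ is the smash product, i.e. the vector space $B^*\otimes B$ (elements written $\alpha\# a$) with product $(\alpha\# a)(\beta\# b)=\alpha(a'\rightharpoonup\beta)\# a''b$. Drinfeld double: $\mathscr{D}(B)$ is the vector space $B^*\otimes B$ with product $(\mu\otimes m)(\nu\otimes n)=\mu(m'\rightharpoonup\nu\leftharpoonup S^{-1}(m'''))\otimes m''n$, with the coalgebra structure of $B^{*\mathrm{cop}}\otimes B$, i.e. $\Delta(\mu\otimes m)=(\mu''\otimes m')\otimes(\mu'\otimes m'')$, and with antipode $S_{\mathscr{D}}(\mu\otimes m)=(\varepsilon\otimes S(m))({S^*}^{-1}(\mu)\otimes 1)$. For a Hopf algebra $H$, write a left coaction as $\delta(u)=u_{(-1)}\otimes u_{(0)}$. A left--left Yetter--Drinfeld $H$-module algebra is an algebra $X$ that is a left $H$-module algebra ($h\triangleright(xy)=(h'\triangleright x)(h''\triangleright y)$, $h\triangleright 1=\varepsilon(h)1$) and a left $H$-comodule algebra ($\delta$ is an algebra morphism $X\to H\otimes X$) such that for all $h\in H$, $x\in X$ $$(h'\triangleright x)_{(-1)}h''\otimes(h'\triangleright x)_{(0)}=h'x_{(-1)}\otimes(h''\triangleright x_{(0)}).$$ *)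

theory Defs
  imports Complex_Main "HOL-Library.Function_Algebras"
begin

section \<open>Vector spaces with carriers\<close>

text \<open>
  A vector space is a linear subspace \<open>carr V\<close> of an ambient \<open>k\<close>-vector space that occupies a
  whole type.  Carriers are needed because the finite dual, tensor products and the two doubles are
  proper subsets of their types.
\<close>

record ('k, 'v) vsp =
  carr :: "'v set"
  scl :: "'k \<Rightarrow> 'v \<Rightarrow> 'v"

definition is_vspace :: "('k::field, 'v::ab_group_add, 'z) vsp_scheme \<Rightarrow> bool" where
  "is_vspace V \<longleftrightarrow> vector_space (scl V) \<and> module.subspace (scl V) (carr V)"

definition scalars :: "('k::field, 'k) vsp" where
  "scalars = \<lparr>carr = UNIV, scl = (*)\<rparr>"

definition fscale :: "'k::field \<Rightarrow> ('x \<Rightarrow> 'k) \<Rightarrow> ('x \<Rightarrow> 'k)" where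
  "fscale c f = (\<lambda>x. c * f x)"

definition linear_map ::
  "('k::field, 'v::ab_group_add, 'z) vsp_scheme \<Rightarrow> ('k, 'w::ab_group_add, 'y) vsp_scheme
    \<Rightarrow> ('v \<Rightarrow> 'w) \<Rightarrow> bool" where
  "linear_map V W f \<longleftrightarrow>
     (\<forall>x\<in>carr V. f x \<in> carr W) \<and>
     (\<forall>x\<in>carr V. \<forall>y\<in>carr V. f (x + y) = f x + f y) \<and>
     (\<forall>c. \<forall>x\<in>carr V. f (scl V c x) = scl W c (f x))"

definition bilinear_map ::
  "('k::field, 'v::ab_group_add, 'z) vsp_scheme \<Rightarrow> ('k, 'w::ab_group_add, 'y) vsp_scheme
    \<Rightarrow> ('k, 'u::ab_group_add, 'x) vsp_scheme \<Rightarrow> ('v \<Rightarrow> 'w \<Rightarrow> 'u) \<Rightarrow> bool" where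
  "bilinear_map V W U f \<longleftrightarrow>
     (\<forall>v\<in>carr V. linear_map W U (f v)) \<and> (\<forall>w\<in>carr W. linear_map V U (\<lambda>v. f v w))"


section \<open>Tensor products\<close>

text \<open>
  \<open>V \<otimes> W\<close> is realised inside the dual of the space of bilinear forms on \<open>V \<times> W\<close>: the pure
  tensor of \<open>v\<close> and \<open>w\<close> is evaluation at \<open>(v, w)\<close>, and \<open>V \<otimes> W\<close> is the span of the pure
  tensors.  Over a field this is a tensor product in any dimension; the lemmas \<open>ptens_bilinear\<close>,
  \<open>tlift_ptens\<close>, \<open>tlift_linear\<close> and \<open>tlift_unique\<close> below are its universal property.
\<close>

type_synonym ('k, 'v, 'w) tensor = "('v \<Rightarrow> 'w \<Rightarrow> 'k) \<Rightarrow> 'k"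

definition ptens ::
  "('k::field, 'v::ab_group_add, 'z) vsp_scheme \<Rightarrow> ('k, 'w::ab_group_add, 'y) vsp_scheme
    \<Rightarrow> 'v \<Rightarrow> 'w \<Rightarrow> ('k, 'v, 'w) tensor" where
  "ptens V W v w = (\<lambda>\<beta>. if bilinear_map V W scalars \<beta> then \<beta> v w else 0)"

definition tens ::
  "('k::field, 'v::ab_group_add, 'z) vsp_scheme \<Rightarrow> ('k, 'w::ab_group_add, 'y) vsp_scheme
    \<Rightarrow> ('k, ('k, 'v, 'w) tensor) vsp" where
  "tens V W = \<lparr>carr = module.span fscale {ptens V W v w | v w. v \<in> carr V \<and> w \<in> carr W},
               scl = fscale\<rparr>"

text \<open>
  \<open>tlift V W f\<close> is the linear map on \<open>V \<otimes> W\<close> induced by a bilinear \<open>f\<close>: write the tensor as a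
  finite sum of pure tensors and sum the values of \<open>f\<close>.  A Sweedler expression such as
  \<open>f(x', x'')\<close> is \<open>f\<close> lifted and applied to the coproduct of \<open>x\<close>.  The value is meaningful
  only when \<open>f\<close> is bilinear on the carriers.
\<close>

definition tlift ::
  "('k::field, 'v::ab_group_add, 'z) vsp_scheme \<Rightarrow> ('k, 'w::ab_group_add, 'y) vsp_scheme
    \<Rightarrow> ('v \<Rightarrow> 'w \<Rightarrow> 'u::ab_group_add) \<Rightarrow> ('k, 'v, 'w) tensor \<Rightarrow> 'u" where
  "tlift V W f t =
     (\<Sum>(v, w)\<leftarrow>(SOME xs. set xs \<subseteq> carr V \<times> carr W \<and> t = (\<Sum>(v, w)\<leftarrow>xs. ptens V W v w)). f v w)"

definition tmap ::
  "('k::field, 'v::ab_group_add, 'z) vsp_scheme \<Rightarrow> ('k, 'w::ab_group_add, 'y) vsp_scheme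
    \<Rightarrow> ('k, 'v2::ab_group_add, 'z2) vsp_scheme \<Rightarrow> ('k, 'w2::ab_group_add, 'y2) vsp_scheme
    \<Rightarrow> ('v \<Rightarrow> 'v2) \<Rightarrow> ('w \<Rightarrow> 'w2) \<Rightarrow> ('k, 'v, 'w) tensor \<Rightarrow> ('k, 'v2, 'w2) tensor" where
  "tmap V W V' W' f g = tlift V W (\<lambda>v w. ptens V' W' (f v) (g w))"

definition tassoc ::
  "('k::field, 'u::ab_group_add, 'z) vsp_scheme \<Rightarrow> ('k, 'v::ab_group_add, 'y) vsp_scheme
    \<Rightarrow> ('k, 'w::ab_group_add, 'x) vsp_scheme
    \<Rightarrow> ('k, ('k, 'u, 'v) tensor, 'w) tensor \<Rightarrow> ('k, 'u, ('k, 'v, 'w) tensor) tensor" where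
  "tassoc U V W =
     tlift (tens U V) W (\<lambda>t w. tlift U V (\<lambda>u v. ptens U (tens V W) u (ptens V W v w)) t)"


section \<open>Hopf algebras\<close>

record ('k, 'v) alg = "('k, 'v) vsp" +
  mul :: "'v \<Rightarrow> 'v \<Rightarrow> 'v"
  unit :: 'v

record ('k, 'v) hopf = "('k, 'v) alg" +
  cop :: "'v \<Rightarrow> ('k, 'v, 'v) tensor"
  coun :: "'v \<Rightarrow> 'k"
  antip :: "'v \<Rightarrow> 'v"

definition algebra :: "('k::field, 'v::ab_group_add, 'z) alg_scheme \<Rightarrow> bool" where
  "algebra A \<longleftrightarrow>
     is_vspace A \<and> bilinear_map A A A (mul A) \<and> unit A \<in> carr A \<and>
     (\<forall>x\<in>carr A. \<forall>y\<in>carr A. \<forall>z\<in>carr A. mul A (mul A x y) z = mul A x (mul A y z)) \<and>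
     (\<forall>x\<in>carr A. mul A (unit A) x = x \<and> mul A x (unit A) = x)"

definition alg_hom ::
  "('k::field, 'v::ab_group_add, 'z) alg_scheme \<Rightarrow> ('k, 'w::ab_group_add, 'y) alg_scheme
    \<Rightarrow> ('v \<Rightarrow> 'w) \<Rightarrow> bool" where
  "alg_hom A A' f \<longleftrightarrow>
     linear_map A A' f \<and> f (unit A) = unit A' \<and>
     (\<forall>x\<in>carr A. \<forall>y\<in>carr A. f (mul A x y) = mul A' (f x) (f y))"

definition scalar_alg :: "('k::field, 'k) alg" where
  "scalar_alg = \<lparr>carr = UNIV, scl = (*), mul = (*), unit = 1\<rparr>"

definition talg ::
  "('k::field, 'v::ab_group_add, 'z) alg_scheme \<Rightarrow> ('k, 'w::ab_group_add, 'y) alg_scheme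
    \<Rightarrow> ('k, ('k, 'v, 'w) tensor) alg" where
  "talg A X = \<lparr>carr = carr (tens A X), scl = scl (tens A X),
     mul = (\<lambda>s t. tlift A X (\<lambda>a x. tlift A X (\<lambda>b y. ptens A X (mul A a b) (mul X x y)) t) s),
     unit = ptens A X (unit A) (unit X)\<rparr>"

definition coalgebra :: "('k::field, 'v::ab_group_add, 'z) hopf_scheme \<Rightarrow> bool" where
  "coalgebra C \<longleftrightarrow>
     is_vspace C \<and> linear_map C (tens C C) (cop C) \<and> linear_map C scalars (coun C) \<and>
     (\<forall>c\<in>carr C. tassoc C C C (tmap C C (tens C C) C (cop C) id (cop C c)) =
                 tmap C C C (tens C C) id (cop C) (cop C c)) \<and>
     (\<forall>c\<in>carr C. tlift C C (\<lambda>x y. scl C (coun C x) y) (cop C c) = c \<and>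
                 tlift C C (\<lambda>x y. scl C (coun C y) x) (cop C c) = c)"

definition bialgebra :: "('k::field, 'v::ab_group_add, 'z) hopf_scheme \<Rightarrow> bool" where
  "bialgebra H \<longleftrightarrow>
     algebra H \<and> coalgebra H \<and> alg_hom H (talg H H) (cop H) \<and> alg_hom H scalar_alg (coun H)"

definition hopf_algebra :: "('k::field, 'v::ab_group_add, 'z) hopf_scheme \<Rightarrow> bool" where
  "hopf_algebra H \<longleftrightarrow>
     bialgebra H \<and> linear_map H H (antip H) \<and>
     (\<forall>h\<in>carr H.
        tlift H H (\<lambda>x y. mul H (antip H x) y) (cop H h) = scl H (coun H h) (unit H) \<and>
        tlift H H (\<lambda>x y. mul H x (antip H y)) (cop H h) = scl H (coun H h) (unit H))"

text \<open>\<open>f(x', x'')\<close>, and \<open>f(x', x'', x''')\<close> with respect to \<open>(\<Delta> \<otimes> id) \<Delta>\<close>.\<close>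

definition sw2 ::
  "('k::field, 'v::ab_group_add, 'z) hopf_scheme \<Rightarrow> ('v \<Rightarrow> 'v \<Rightarrow> 'u::ab_group_add) \<Rightarrow> 'v \<Rightarrow> 'u" where
  "sw2 H f x = tlift H H f (cop H x)"

definition sw3 ::
  "('k::field, 'v::ab_group_add, 'z) hopf_scheme \<Rightarrow> ('v \<Rightarrow> 'v \<Rightarrow> 'v \<Rightarrow> 'u::ab_group_add) \<Rightarrow> 'v \<Rightarrow> 'u" where
  "sw3 H f x = sw2 H (\<lambda>y x3. sw2 H (\<lambda>x1 x2. f x1 x2 x3) y) x"


section \<open>Yetter--Drinfeld module algebras\<close>

definition left_module ::
  "('k::field, 'h::ab_group_add, 'z) alg_scheme \<Rightarrow> ('k, 'x::ab_group_add, 'y) vsp_scheme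
    \<Rightarrow> ('h \<Rightarrow> 'x \<Rightarrow> 'x) \<Rightarrow> bool" where
  "left_module H X act \<longleftrightarrow>
     is_vspace X \<and> bilinear_map H X X act \<and>
     (\<forall>g\<in>carr H. \<forall>h\<in>carr H. \<forall>x\<in>carr X. act (mul H g h) x = act g (act h x)) \<and>
     (\<forall>x\<in>carr X. act (unit H) x = x)"

definition left_module_algebra ::
  "('k::field, 'h::ab_group_add, 'z) hopf_scheme \<Rightarrow> ('k, 'x::ab_group_add, 'y) alg_scheme
    \<Rightarrow> ('h \<Rightarrow> 'x \<Rightarrow> 'x) \<Rightarrow> bool" where
  "left_module_algebra H X act \<longleftrightarrow>
     algebra X \<and> left_module H X act \<and>
     (\<forall>h\<in>carr H. \<forall>x\<in>carr X. \<forall>y\<in>carr X.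
        act h (mul X x y) = sw2 H (\<lambda>h1 h2. mul X (act h1 x) (act h2 y)) h) \<and>
     (\<forall>h\<in>carr H. act h (unit X) = scl X (coun H h) (unit X))"

definition left_comodule ::
  "('k::field, 'h::ab_group_add, 'z) hopf_scheme \<Rightarrow> ('k, 'x::ab_group_add, 'y) vsp_scheme
    \<Rightarrow> ('x \<Rightarrow> ('k, 'h, 'x) tensor) \<Rightarrow> bool" where
  "left_comodule H X \<delta> \<longleftrightarrow>
     is_vspace X \<and> linear_map X (tens H X) \<delta> \<and>
     (\<forall>x\<in>carr X. tassoc H H X (tmap H X (tens H H) X (cop H) id (\<delta> x)) =
                 tmap H X H (tens H X) id \<delta> (\<delta> x)) \<and>
     (\<forall>x\<in>carr X. tlift H X (\<lambda>h y. scl X (coun H h) y) (\<delta> x) = x)"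

definition left_comodule_algebra ::
  "('k::field, 'h::ab_group_add, 'z) hopf_scheme \<Rightarrow> ('k, 'x::ab_group_add, 'y) alg_scheme
    \<Rightarrow> ('x \<Rightarrow> ('k, 'h, 'x) tensor) \<Rightarrow> bool" where
  "left_comodule_algebra H X \<delta> \<longleftrightarrow>
     algebra X \<and> left_comodule H X \<delta> \<and> alg_hom X (talg H X) \<delta>"

definition yd_module_algebra ::
  "('k::field, 'h::ab_group_add, 'z) hopf_scheme \<Rightarrow> ('k, 'x::ab_group_add, 'y) alg_scheme
    \<Rightarrow> ('h \<Rightarrow> 'x \<Rightarrow> 'x) \<Rightarrow> ('x \<Rightarrow> ('k, 'h, 'x) tensor) \<Rightarrow> bool" where
  "yd_module_algebra H X act \<delta> \<longleftrightarrow>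
     hopf_algebra H \<and> left_module_algebra H X act \<and> left_comodule_algebra H X \<delta> \<and>
     (\<forall>h\<in>carr H. \<forall>x\<in>carr X.
        sw2 H (\<lambda>h1 h2. tlift H X (\<lambda>u y. ptens H X (mul H u h2) y) (\<delta> (act h1 x))) h =
        sw2 H (\<lambda>h1 h2. tlift H X (\<lambda>u y. ptens H X (mul H h1 u) (act h2 y)) (\<delta> x)) h)"


section \<open>The finite dual\<close>

definition two_sided_ideal :: "('k::field, 'v::ab_group_add, 'z) alg_scheme \<Rightarrow> 'v set \<Rightarrow> bool" where
  "two_sided_ideal A I \<longleftrightarrow>
     I \<subseteq> carr A \<and> module.subspace (scl A) I \<and>
     (\<forall>a\<in>carr A. \<forall>x\<in>I. mul A a x \<in> I \<and> mul A x a \<in> I)"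

definition finite_codim :: "('k::field, 'v::ab_group_add, 'z) vsp_scheme \<Rightarrow> 'v set \<Rightarrow> bool" where
  "finite_codim V I \<longleftrightarrow>
     (\<exists>F. finite F \<and> F \<subseteq> carr V \<and> carr V \<subseteq> module.span (scl V) (I \<union> F))"

text \<open>Functionals are normalised to vanish off the carrier, so that equality is equality on \<open>B\<close>.\<close>

definition extend0 :: "'v set \<Rightarrow> ('v \<Rightarrow> 'k::field) \<Rightarrow> ('v \<Rightarrow> 'k)" where
  "extend0 C f = (\<lambda>x. if x \<in> C then f x else 0)"

definition fin_dual :: "('k::field, 'v::ab_group_add, 'z) alg_scheme \<Rightarrow> ('k, 'v \<Rightarrow> 'k) vsp" where
  "fin_dual A =
     \<lparr>carr = {f. linear_map A scalars f \<and> (\<forall>x. x \<notin> carr A \<longrightarrow> f x = 0) \<and>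
                 (\<exists>I. two_sided_ideal A I \<and> finite_codim A I \<and> (\<forall>x\<in>I. f x = 0))},
      scl = fscale\<rparr>"

definition dual :: "('k::field, 'b::ab_group_add, 'z) hopf_scheme \<Rightarrow> ('k, 'b \<Rightarrow> 'k) hopf" where
  "dual B =
     \<lparr>carr = carr (fin_dual B), scl = scl (fin_dual B),
      mul = (\<lambda>\<alpha> \<beta>. extend0 (carr B) (sw2 B (\<lambda>b1 b2. \<alpha> b1 * \<beta> b2))),
      unit = extend0 (carr B) (coun B),
      cop = (\<lambda>\<beta>. THE t. t \<in> carr (tens (fin_dual B) (fin_dual B)) \<and>
               (\<forall>a\<in>carr B. \<forall>b\<in>carr B.
                  \<beta> (mul B a b) = tlift (fin_dual B) (fin_dual B) (\<lambda>\<beta>1 \<beta>2. \<beta>1 a * \<beta>2 b) t)),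
      coun = (\<lambda>\<beta>. \<beta> (unit B)),
      antip = (\<lambda>\<beta>. extend0 (carr B) (\<beta> \<circ> antip B))\<rparr>"

definition antip_inv :: "('k::field, 'v::ab_group_add, 'z) hopf_scheme \<Rightarrow> 'v \<Rightarrow> 'v" where
  "antip_inv H = inv_into (carr H) (antip H)"

text \<open>
  The regular actions \<open>b \<rightharpoonup> \<beta>\<close> and \<open>\<beta> \<leftharpoonup> b\<close> of \<open>B\<close> on its dual, and the right regular
  action \<open>b \<leftharpoonup> \<beta>\<close> of the dual on \<open>B\<close>.
\<close>

definition lreg :: "('k::field, 'b::ab_group_add, 'z) hopf_scheme \<Rightarrow> 'b \<Rightarrow> ('b \<Rightarrow> 'k) \<Rightarrow> ('b \<Rightarrow> 'k)" where
  "lreg B b \<beta> = sw2 (dual B) (\<lambda>\<beta>1 \<beta>2. fscale (\<beta>2 b) \<beta>1) \<beta>"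

definition rreg :: "('k::field, 'b::ab_group_add, 'z) hopf_scheme \<Rightarrow> ('b \<Rightarrow> 'k) \<Rightarrow> 'b \<Rightarrow> ('b \<Rightarrow> 'k)" where
  "rreg B \<beta> b = sw2 (dual B) (\<lambda>\<beta>1 \<beta>2. fscale (\<beta>1 b) \<beta>2) \<beta>"

definition rreg_dual :: "('k::field, 'b::ab_group_add, 'z) hopf_scheme \<Rightarrow> 'b \<Rightarrow> ('b \<Rightarrow> 'k) \<Rightarrow> 'b" where
  "rreg_dual B b \<beta> = sw2 B (\<lambda>b1 b2. scl B (\<beta> b1) b2) b"


section \<open>The Heisenberg and Drinfeld doubles\<close>

type_synonym ('k, 'b) dbl = "('k, 'b \<Rightarrow> 'k, 'b) tensor"

text \<open>
  \<open>dtens B \<alpha> a\<close> is \<open>\<alpha> # a\<close> in the Heisenberg double and \<open>\<alpha> \<otimes> a\<close> in the Drinfeld double; both have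
  the same underlying space.  All operations are the linear extensions of their formulas on such
  elements, with \<open>\<mu>1 \<mu>2 \<mu>3\<close> and \<open>m1 m2 m3\<close> for the Sweedler components.
\<close>

abbreviation dtens ::
  "('k::field, 'b::ab_group_add, 'z) hopf_scheme \<Rightarrow> ('b \<Rightarrow> 'k) \<Rightarrow> 'b \<Rightarrow> ('k, 'b) dbl" where
  "dtens B \<equiv> ptens (dual B) B"

abbreviation dlift ::
  "('k::field, 'b::ab_group_add, 'z) hopf_scheme
    \<Rightarrow> (('b \<Rightarrow> 'k) \<Rightarrow> 'b \<Rightarrow> 'u::ab_group_add) \<Rightarrow> ('k, 'b) dbl \<Rightarrow> 'u" where
  "dlift B \<equiv> tlift (dual B) B"

definition heisenberg_double ::
  "('k::field, 'b::ab_group_add, 'z) hopf_scheme \<Rightarrow> ('k, ('k, 'b) dbl) alg" where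
  "heisenberg_double B =
     \<lparr>carr = carr (tens (dual B) B), scl = scl (tens (dual B) B),
      mul = (\<lambda>s t. dlift B (\<lambda>\<alpha> a. dlift B (\<lambda>\<beta> b.
               sw2 B (\<lambda>a1 a2. dtens B (mul (dual B) \<alpha> (lreg B a1 \<beta>)) (mul B a2 b)) a) t) s),
      unit = dtens B (unit (dual B)) (unit B)\<rparr>"

definition drinfeld_mul ::
  "('k::field, 'b::ab_group_add, 'z) hopf_scheme
    \<Rightarrow> ('k, 'b) dbl \<Rightarrow> ('k, 'b) dbl \<Rightarrow> ('k, 'b) dbl" where
  "drinfeld_mul B s t = dlift B (\<lambda>\<mu> m. dlift B (\<lambda>\<nu> n.
     sw3 B (\<lambda>m1 m2 m3.
       dtens B (mul (dual B) \<mu> (rreg B (lreg B m1 \<nu>) (antip_inv B m3))) (mul B m2 n)) m) t) s"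

definition drinfeld_double ::
  "('k::field, 'b::ab_group_add, 'z) hopf_scheme \<Rightarrow> ('k, ('k, 'b) dbl) hopf" where
  "drinfeld_double B =
     \<lparr>carr = carr (tens (dual B) B), scl = scl (tens (dual B) B),
      mul = drinfeld_mul B,
      unit = dtens B (unit (dual B)) (unit B),
      cop = dlift B (\<lambda>\<mu> m. sw2 (dual B) (\<lambda>\<mu>1 \<mu>2. sw2 B (\<lambda>m1 m2.
              ptens (tens (dual B) B) (tens (dual B) B) (dtens B \<mu>2 m1) (dtens B \<mu>1 m2)) m) \<mu>),
      coun = dlift B (\<lambda>\<mu> m. coun (dual B) \<mu> * coun B m),
      antip = dlift B (\<lambda>\<mu> m.
                drinfeld_mul B (dtens B (unit (dual B)) (antip B m))
                               (dtens B (antip_inv (dual B) \<mu>) (unit B)))\<rparr>"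

definition dd_action ::
  "('k::field, 'b::ab_group_add, 'z) hopf_scheme
    \<Rightarrow> ('k, 'b) dbl \<Rightarrow> ('k, 'b) dbl \<Rightarrow> ('k, 'b) dbl" where
  "dd_action B h x = dlift B (\<lambda>\<mu> m. dlift B (\<lambda>\<alpha> a.
     sw3 (dual B) (\<lambda>\<mu>1 \<mu>2 \<mu>3. sw3 B (\<lambda>m1 m2 m3.
       dtens B
         (mul (dual B) (mul (dual B) \<mu>3 (lreg B m1 \<alpha>)) (antip_inv (dual B) \<mu>2))
         (rreg_dual B (mul B (mul B m2 a) (antip B m3)) (antip_inv (dual B) \<mu>1))) m) \<mu>) x) h"

definition dd_coaction ::
  "('k::field, 'b::ab_group_add, 'z) hopf_scheme
    \<Rightarrow> ('k, 'b) dbl \<Rightarrow> ('k, ('k, 'b) dbl, ('k, 'b) dbl) tensor" where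
  "dd_coaction B = dlift B (\<lambda>\<beta> b. sw2 (dual B) (\<lambda>\<beta>1 \<beta>2. sw2 B (\<lambda>b1 b2.
     ptens (drinfeld_double B) (heisenberg_double B) (dtens B \<beta>2 b1) (dtens B \<beta>1 b2)) b) \<beta>)"


section \<open>Universal property of the tensor product\<close>

lemma vector_space_fscale: "vector_space (fscale :: 'k::field \<Rightarrow> ('x \<Rightarrow> 'k) \<Rightarrow> ('x \<Rightarrow> 'k))"
  by unfold_locales (auto simp: fscale_def fun_eq_iff algebra_simps)

lemma module_fscale: "module (fscale :: 'k::field \<Rightarrow> ('x \<Rightarrow> 'k) \<Rightarrow> ('x \<Rightarrow> 'k))"
  using vector_space_fscale by (simp add: module_iff_vector_space)

lemma is_vspace_tens: "is_vspace (tens V W)"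
  by (simp add: is_vspace_def tens_def vector_space_fscale module.subspace_span[OF module_fscale])

lemma is_vspaceD:
  assumes "is_vspace V"
  shows "0 \<in> carr V" "x \<in> carr V \<Longrightarrow> y \<in> carr V \<Longrightarrow> x + y \<in> carr V"
    "x \<in> carr V \<Longrightarrow> scl V c x \<in> carr V" "scl V c 0 = 0"
    "scl V c (x + y) = scl V c x + scl V c y"
proof -
  have m: "module (scl V)" and s: "module.subspace (scl V) (carr V)"
    using assms by (auto simp: is_vspace_def module_iff_vector_space)
  show "0 \<in> carr V" "x \<in> carr V \<Longrightarrow> y \<in> carr V \<Longrightarrow> x + y \<in> carr V"
    "x \<in> carr V \<Longrightarrow> scl V c x \<in> carr V"
    using s by (auto simp: module.subspace_def[OF m])
  show "scl V c 0 = 0" "scl V c (x + y) = scl V c x + scl V c y"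
    using m by (auto simp: module.scale_zero_right module.scale_right_distrib)
qed

lemma ptens_in_tens: "v \<in> carr V \<Longrightarrow> w \<in> carr W \<Longrightarrow> ptens V W v w \<in> carr (tens V W)"
  unfolding tens_def by (auto intro!: module.span_base[OF module_fscale])

lemma ptens_bilinear: "bilinear_map V W (tens V W) (ptens V W)"
proof -
  have "scl (tens V W) = fscale" by (simp add: tens_def)
  then show ?thesis
    by (auto simp: bilinear_map_def linear_map_def ptens_in_tens)
       (auto simp: ptens_def fscale_def fun_eq_iff bilinear_map_def linear_map_def scalars_def)
qed

lemma tens_repr:
  assumes V: "is_vspace V" and t: "t \<in> carr (tens V W)"
  obtains xs where "set xs \<subseteq> carr V \<times> carr W" "t = (\<Sum>(v, w)\<leftarrow>xs. ptens V W v w)"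
proof -
  let ?S = "{ptens V W v w | v w. v \<in> carr V \<and> w \<in> carr W}"
  let ?P = "\<lambda>t. \<exists>xs. set xs \<subseteq> carr V \<times> carr W \<and> t = (\<Sum>(v, w)\<leftarrow>xs. ptens V W v w)"
  have sc: "fscale c (ptens V W v w) = ptens V W (scl V c v) w"
    if "v \<in> carr V" "w \<in> carr W" for c v w
    using that ptens_bilinear[of V W] by (auto simp: bilinear_map_def linear_map_def tens_def)
  have "t \<in> module.span fscale ?S" using t by (simp add: tens_def)
  then have "?P t"
  proof (rule module.span_induct_alt[OF module_fscale, consumes 1])
    show "?P 0" by (rule exI[of _ "[]"]) simp
  next
    fix c x y assume "x \<in> ?S" "?P y"
    then obtain v w xs where x: "x = ptens V W v w" "v \<in> carr V" "w \<in> carr W"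
      and xs: "set xs \<subseteq> carr V \<times> carr W" "y = (\<Sum>(v, w)\<leftarrow>xs. ptens V W v w)" by blast
    show "?P (fscale c x + y)"
      using x xs is_vspaceD(3)[OF V] by (intro exI[of _ "(scl V c v, w) # xs"]) (auto simp: sc)
  qed
  then show thesis using that by blast
qed

lemma functionals_separate:
  assumes "vector_space s" and "x \<noteq> (0::'v::ab_group_add)"
  obtains \<phi> where "\<And>y z. \<phi> (y + z) = \<phi> y + \<phi> z" "\<And>c y. \<phi> (s c y) = c * \<phi> y" "\<phi> x = (1::'k::field)"
proof -
  interpret vector_space s by fact
  have ind: "independent {x}" using assms(2) by (simp add: dependent_single)
  let ?B = "extend_basis {x}"
  have B: "independent ?B" "x \<in> ?B" "\<And>v. v \<in> span ?B"
    using independent_extend_basis[OF ind] span_extend_basis[OF ind]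
      extend_basis_superset[OF ind] by auto
  show thesis
    by (rule that[of "\<lambda>v. representation ?B v x"])
       (use B in \<open>auto simp: representation_add representation_scale representation_basis\<close>)
qed

lemma tsum_welldef:
  assumes U: "is_vspace U" and f: "bilinear_map V W U f"
    and xs: "set xs \<subseteq> carr V \<times> carr W" and ys: "set ys \<subseteq> carr V \<times> carr W"
    and eq: "(\<Sum>(v, w)\<leftarrow>xs. ptens V W v w) = (\<Sum>(v, w)\<leftarrow>ys. ptens V W v w)"
  shows "(\<Sum>(v, w)\<leftarrow>xs. f v w) = (\<Sum>(v, w)\<leftarrow>ys. f v w)"
proof (rule ccontr)
  let ?x = "(\<Sum>(v, w)\<leftarrow>xs. f v w)" and ?y = "(\<Sum>(v, w)\<leftarrow>ys. f v w)"
  assume "?x \<noteq> ?y"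
  then have "?x - ?y \<noteq> 0" by simp
  moreover have "vector_space (scl U)" using U by (simp add: is_vspace_def)
  ultimately obtain \<phi> where \<phi>: "\<And>y z. \<phi> (y + z) = \<phi> y + \<phi> z" "\<And>c y. \<phi> (scl U c y) = c * \<phi> y"
    "\<phi> (?x - ?y) = 1" using functionals_separate[of "scl U" "?x - ?y"] by blast
  have z: "\<phi> 0 = 0" using \<phi>(1)[of 0 0] by (metis add_0 add_cancel_right_right)
  have d: "\<phi> (y - z) = \<phi> y - \<phi> z" for y z using \<phi>(1)[of "y - z" z] by simp
  have b: "bilinear_map V W scalars (\<lambda>v w. \<phi> (f v w))"
    using f by (auto simp: bilinear_map_def linear_map_def scalars_def \<phi>)
  have e: "(\<Sum>(v, w)\<leftarrow>zs. ptens V W v w) (\<lambda>v w. \<phi> (f v w)) = \<phi> (\<Sum>(v, w)\<leftarrow>zs. f v w)" for zs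
    by (induction zs) (auto simp: z \<phi> ptens_def b)
  have "\<phi> ?x = \<phi> ?y" using e[of xs] e[of ys] eq by simp
  then show False using \<phi>(3) d by simp
qed

lemma tlift_repr:
  assumes U: "is_vspace U" and f: "bilinear_map V W U f"
    and xs: "set xs \<subseteq> carr V \<times> carr W"
  shows "tlift V W f (\<Sum>(v, w)\<leftarrow>xs. ptens V W v w) = (\<Sum>(v, w)\<leftarrow>xs. f v w)"
proof -
  let ?Q = "\<lambda>ys. set ys \<subseteq> carr V \<times> carr W \<and>
    (\<Sum>(v, w)\<leftarrow>xs. ptens V W v w) = (\<Sum>(v, w)\<leftarrow>ys. ptens V W v w)"
  have "?Q (SOME ys. ?Q ys)" by (rule someI[of ?Q xs]) (use xs in simp)
  then show ?thesis unfolding tlift_def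
    by (intro tsum_welldef[OF U f]) (use xs in auto)
qed

lemma tlift_ptens:
  assumes "is_vspace U" "bilinear_map V W U f" "v \<in> carr V" "w \<in> carr W"
  shows "tlift V W f (ptens V W v w) = f v w"
  using tlift_repr[OF assms(1,2), of "[(v, w)]"] assms(3,4) by simp

lemma tlift_linear:
  assumes V: "is_vspace V" and U: "is_vspace U" and f: "bilinear_map V W U f"
  shows "linear_map (tens V W) U (tlift V W f)"
proof -
  have sp: "fscale c (ptens V W v w) = ptens V W (scl V c v) w"
      "f (scl V c v) w = scl U c (f v w)" "f v w \<in> carr U"
    if "v \<in> carr V" "w \<in> carr W" for c v w
    using that f ptens_bilinear[of V W] by (auto simp: bilinear_map_def linear_map_def tens_def)
  have sums: "(\<Sum>(v, w)\<leftarrow>xs. f v w) \<in> carr U" if "set xs \<subseteq> carr V \<times> carr W" for xs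
    using that by (induction xs) (auto simp: sp is_vspaceD[OF U])
  have sc: "fscale c (\<Sum>(v, w)\<leftarrow>xs. ptens V W v w) = (\<Sum>(v, w)\<leftarrow>map (\<lambda>(v, w). (scl V c v, w)) xs. ptens V W v w)
      \<and> (\<Sum>(v, w)\<leftarrow>map (\<lambda>(v, w). (scl V c v, w)) xs. f v w) = scl U c (\<Sum>(v, w)\<leftarrow>xs. f v w)"
    if "set xs \<subseteq> carr V \<times> carr W" for c xs
    using that
    by (induction xs) (auto simp: sp is_vspaceD[OF U] module.scale_zero_right[OF module_fscale]
        module.scale_right_distrib[OF module_fscale])
  have tl: "scl (tens V W) = fscale" by (simp add: tens_def)
  show ?thesis unfolding linear_map_def tl
  proof (intro conjI ballI allI)
    fix s t assume "s \<in> carr (tens V W)" "t \<in> carr (tens V W)"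
    then obtain xs ys where xs: "set xs \<subseteq> carr V \<times> carr W" "s = (\<Sum>(v, w)\<leftarrow>xs. ptens V W v w)"
      and ys: "set ys \<subseteq> carr V \<times> carr W" "t = (\<Sum>(v, w)\<leftarrow>ys. ptens V W v w)"
      by (metis tens_repr[OF V])
    show "tlift V W f (s + t) = tlift V W f s + tlift V W f t"
      using tlift_repr[OF U f xs(1)] tlift_repr[OF U f ys(1)] tlift_repr[OF U f, of "xs @ ys"] xs ys
      by simp
  next
    fix s assume "s \<in> carr (tens V W)"
    then obtain xs where xs: "set xs \<subseteq> carr V \<times> carr W" "s = (\<Sum>(v, w)\<leftarrow>xs. ptens V W v w)"
      by (metis tens_repr[OF V])
    show "tlift V W f s \<in> carr U"
      using tlift_repr[OF U f xs(1)] xs sums by simp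
    fix c
    have "set (map (\<lambda>(v, w). (scl V c v, w)) xs) \<subseteq> carr V \<times> carr W"
      using xs(1) is_vspaceD(3)[OF V] by auto
    from tlift_repr[OF U f this] show "tlift V W f (fscale c s) = scl U c (tlift V W f s)"
      using tlift_repr[OF U f xs(1)] sc[OF xs(1), of c] xs(2) by simp
  qed
qed

lemma tlift_unique:
  assumes V: "is_vspace V" and U: "is_vspace U" and f: "bilinear_map V W U f"
    and g: "linear_map (tens V W) U g"
    and eq: "\<And>v w. v \<in> carr V \<Longrightarrow> w \<in> carr W \<Longrightarrow> g (ptens V W v w) = f v w"
    and t: "t \<in> carr (tens V W)"
  shows "g t = tlift V W f t"
proof -
  have g0: "g 0 = 0"
    using g is_vspaceD(1)[OF is_vspace_tens[of V W]] unfolding linear_map_def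
    by (metis add_cancel_right_right)
  obtain xs where xs: "set xs \<subseteq> carr V \<times> carr W" "t = (\<Sum>(v, w)\<leftarrow>xs. ptens V W v w)"
    using tens_repr[OF V t] by blast
  have "(\<Sum>(v, w)\<leftarrow>xs. ptens V W v w) \<in> carr (tens V W) \<and>
        g (\<Sum>(v, w)\<leftarrow>xs. ptens V W v w) = (\<Sum>(v, w)\<leftarrow>xs. f v w)"
    using xs(1)
  proof (induction xs)
    case Nil
    then show ?case using g0 is_vspaceD(1)[OF is_vspace_tens[of V W]]
      by (simp flip: zero_fun_def)
  next
    case (Cons a xs)
    obtain v w where a: "a = (v, w)" "v \<in> carr V" "w \<in> carr W" using Cons.prems by auto
    let ?r = "\<Sum>(v, w)\<leftarrow>xs. ptens V W v w"
    have r: "?r \<in> carr (tens V W)" "g ?r = (\<Sum>(v, w)\<leftarrow>xs. f v w)" using Cons by auto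
    have p: "ptens V W v w \<in> carr (tens V W)" using a by (simp add: ptens_in_tens)
    have "g (ptens V W v w + ?r) = f v w + g ?r"
      using g p r(1) a eq by (simp only: linear_map_def)
    then show ?case
      unfolding a(1) list.map sum_list.Cons prod.case r(2)
      using is_vspaceD(2)[OF is_vspace_tens p r(1)] by (rule conjI[rotated])
  qed
  then show ?thesis using tlift_repr[OF U f xs(1)] xs(2) by simp
qed

end

theory Submission
  imports Defs
begin

text \<open>
  The Heisenberg double is a right cocycle twist of the Drinfeld double: with \<open>\<star>\<close> and \<open>\<cdot>\<close> for the
  products of \<open>\<D>(B)\<close> and \<open>\<H>(B\<^sup>*)\<close>, which share the space \<open>B\<^sup>* \<otimes> B\<close>, the coproduct of \<open>\<D>(B)\<close>
  satisfies \<open>\<Delta>(x \<cdot> y) = x' \<star> y' \<otimes> x'' \<cdot> y''\<close>.  The identity \<open>\<D>(B) \<rightarrow> \<H>(B\<^sup>*)\<close> is convolution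
  invertible, with inverse \<open>\<psi>(\<mu> \<otimes> m) = (\<epsilon> # S m)(S\<^sup>*\<^sup>-\<^sup>1 \<mu> # 1)\<close>, so \<open>\<H>(B\<^sup>*)\<close> is a cleft Galois
  object over \<open>\<D>(B)\<close> with trivial coinvariants.  The coaction of the theorem is \<open>\<Delta>\<close>, and the action is
  \<open>h \<triangleright> x = h' \<cdot> x \<cdot> \<psi>(h'')\<close>, the Miyashita--Ulbrich action, which is always Yetter--Drinfeld.  The
  bialgebra axioms of \<open>\<D>(B)\<close> follow from the same data, because \<open>\<star>\<close> can be recovered from \<open>\<cdot>\<close>,
  \<open>\<Delta>\<close> and \<open>\<psi>\<close>.
\<close>


section \<open>Multilinear maps\<close>

text \<open>Two obstacles shape the proof. The finite dual need not separate the points of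
  \<open>B\<close>, so an identity in the tensor product of \<open>B\<^sup>*\<close> and
  \<open>B\<close> cannot be checked by pairing both legs: only the leg in \<open>B\<^sup>*\<close>
  may be evaluated, at elements of \<open>B\<close>. And a direct check of the axioms of
  \<open>\<D>(B)\<close> would juggle threefold coproducts of three elements at once. Associativity
  is therefore computed only for \<open>\<cdot>\<close>. It passes to \<open>\<star>\<close> because
  \<open>u \<star> v\<close> is a bilinear expression in \<open>u' \<cdot> v'\<close> and
  \<open>psi v'' \<cdot> psi u''\<close>.

  The one long computation with both products is the mixed coproduct identity. In it the inverse
  antipode of \<open>\<star>\<close> and the leg of \<open>m\<close> that acts on
  \<open>\<nu>\<close> in \<open>\<cdot>\<close> can be gathered on a single leg of
  \<open>\<nu>\<close>, in exactly the order in which an inverse antipode cancels.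

  The Yetter--Drinfeld condition comes down to \<open>psi(h')' \<star> h'' \<otimes> psi(h')'' = 1
  \<otimes> psi(h)\<close>, a form of colinearity of \<open>psi\<close> that does not mention the
  antipode of \<open>\<D>(B)\<close>. That antipode and \<open>psi\<close> are given by one formula
  read in the two products, so a single lemma yields both convolution inverses.\<close>

named_theorems lin

definition trilinear_map ::
  "('k::field, 'v::ab_group_add, 'z) vsp_scheme \<Rightarrow> ('k, 'w::ab_group_add, 'y) vsp_scheme
    \<Rightarrow> ('k, 'x::ab_group_add, 'x') vsp_scheme
    \<Rightarrow> ('k, 'u::ab_group_add, 'u') vsp_scheme \<Rightarrow> ('v \<Rightarrow> 'w \<Rightarrow> 'x \<Rightarrow> 'u) \<Rightarrow> bool" where
  "trilinear_map V W X U f \<longleftrightarrow>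
     (\<forall>w\<in>carr W. \<forall>x\<in>carr X. linear_map V U (\<lambda>v. f v w x)) \<and>
     (\<forall>v\<in>carr V. \<forall>x\<in>carr X. linear_map W U (\<lambda>w. f v w x)) \<and>
     (\<forall>v\<in>carr V. \<forall>w\<in>carr W. linear_map X U (\<lambda>x. f v w x))"

lemma linear_mapD:
  assumes "linear_map V W f"
  shows "x \<in> carr V \<Longrightarrow> f x \<in> carr W"
    "x \<in> carr V \<Longrightarrow> y \<in> carr V \<Longrightarrow> f (x + y) = f x + f y"
    "x \<in> carr V \<Longrightarrow> f (scl V c x) = scl W c (f x)"
  using assms by (auto simp: linear_map_def)

lemma linear_map_zero:
  assumes "is_vspace V" "linear_map V W f"
  shows "f 0 = 0"
  using linear_mapD(2)[OF assms(2), of 0 0] is_vspaceD(1)[OF assms(1)] by simp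

lemma linear_map_compose:
  "linear_map V W f \<Longrightarrow> linear_map X V g \<Longrightarrow> linear_map X W (\<lambda>x. f (g x))"
  by (auto simp: linear_map_def)

lemma bilinear_mapI [lin]:
  "(\<And>w. w \<in> carr W \<Longrightarrow> linear_map V U (\<lambda>v. f v w)) \<Longrightarrow>
   (\<And>v. v \<in> carr V \<Longrightarrow> linear_map W U (\<lambda>w. f v w)) \<Longrightarrow> bilinear_map V W U f"
  by (auto simp: bilinear_map_def)

text \<open>Each linearity clause already composes with an inner linear map. Rules of this shape in
  \<open>lin\<close> peel a nested Sweedler expression from the outside in, one variable at a time,
  until only the identity remains.\<close>

lemma bilinear_mapD:
  assumes "bilinear_map V W U f"
  shows "linear_map X V g \<Longrightarrow> w \<in> carr W \<Longrightarrow> linear_map X U (\<lambda>x. f (g x) w)"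
    and "linear_map X W h \<Longrightarrow> v \<in> carr V \<Longrightarrow> linear_map X U (\<lambda>x. f v (h x))"
    and "v \<in> carr V \<Longrightarrow> w \<in> carr W \<Longrightarrow> f v w \<in> carr U"
  using assms by (auto simp: bilinear_map_def linear_map_def)

lemma trilinear_mapI [lin]:
  "(\<And>w x. w \<in> carr W \<Longrightarrow> x \<in> carr X \<Longrightarrow> linear_map V U (\<lambda>v. f v w x)) \<Longrightarrow>
   (\<And>v x. v \<in> carr V \<Longrightarrow> x \<in> carr X \<Longrightarrow> linear_map W U (\<lambda>w. f v w x)) \<Longrightarrow>
   (\<And>v w. v \<in> carr V \<Longrightarrow> w \<in> carr W \<Longrightarrow> linear_map X U (\<lambda>x. f v w x)) \<Longrightarrow>
   trilinear_map V W X U f"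
  by (auto simp: trilinear_map_def)

lemma trilinear_mapD:
  assumes "trilinear_map V W X U f"
  shows "linear_map Z V g \<Longrightarrow> w \<in> carr W \<Longrightarrow> x \<in> carr X \<Longrightarrow> linear_map Z U (\<lambda>z. f (g z) w x)"
    and "v \<in> carr V \<Longrightarrow> linear_map Z W h \<Longrightarrow> x \<in> carr X \<Longrightarrow> linear_map Z U (\<lambda>z. f v (h z) x)"
    and "v \<in> carr V \<Longrightarrow> w \<in> carr W \<Longrightarrow> linear_map Z X i \<Longrightarrow> linear_map Z U (\<lambda>z. f v w (i z))"
    and "v \<in> carr V \<Longrightarrow> w \<in> carr W \<Longrightarrow> x \<in> carr X \<Longrightarrow> f v w x \<in> carr U"
  using assms by (auto simp: trilinear_map_def linear_map_def)

lemma scalars_simps [simp]: "carr scalars = UNIV" "scl scalars = (*)"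
  by (auto simp: scalars_def)

lemma is_vspace_scalars [lin]: "is_vspace scalars"
  unfolding is_vspace_def
proof
  show v: "vector_space (scl scalars :: 'a \<Rightarrow> 'a \<Rightarrow> 'a)"
    by unfold_locales (auto simp: algebra_simps)
  show "module.subspace (scl scalars) (carr scalars :: 'a set)"
    using v by (simp add: module.subspace_def module_iff_vector_space)
qed

lemma is_vspaceD':
  assumes "is_vspace V"
  shows "scl V (c + d) x = scl V c x + scl V d x" "scl V (c * d) x = scl V c (scl V d x)"
    "scl V 1 x = x" "scl V 0 x = 0"
proof -
  interpret vector_space "scl V" using assms by (simp add: is_vspace_def)
  show "scl V (c + d) x = scl V c x + scl V d x" "scl V (c * d) x = scl V c (scl V d x)"
    "scl V 1 x = x" "scl V 0 x = 0"
    by (auto simp: scale_left_distrib)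
qed

lemma lin_id [lin]: "linear_map V V (\<lambda>x. x)"
  by (auto simp: linear_map_def)

lemma lin_scl_left [lin]:
  "is_vspace U \<Longrightarrow> linear_map X scalars \<phi> \<Longrightarrow> u \<in> carr U \<Longrightarrow> linear_map X U (\<lambda>x. scl U (\<phi> x) u)"
  by (auto simp: linear_map_def is_vspaceD is_vspaceD')

lemma lin_scl_right [lin]:
  "is_vspace U \<Longrightarrow> linear_map X U f \<Longrightarrow> linear_map X U (\<lambda>x. scl U c (f x))"
  unfolding linear_map_def by (metis is_vspaceD(3,5) is_vspaceD'(2) mult.commute)

lemma scl_mem [lin]: "is_vspace U \<Longrightarrow> u \<in> carr U \<Longrightarrow> scl U c u \<in> carr U"
  by (simp add: is_vspaceD)

lemma lin_mult_left [lin]: "linear_map X scalars f \<Longrightarrow> linear_map X scalars (\<lambda>x. f x * c)"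
  by (auto simp: linear_map_def algebra_simps)

lemma lin_mult_right [lin]: "linear_map X scalars f \<Longrightarrow> linear_map X scalars (\<lambda>x. c * f x)"
  by (auto simp: linear_map_def algebra_simps)

lemma scalars_mem [lin]: "c \<in> carr scalars"
  by simp

lemmas lin_ptens [lin] = bilinear_mapD[OF ptens_bilinear]

lemma fscale_fscale: "fscale (a * b) x = fscale a (fscale b x)"
  by (simp add: fscale_def mult.assoc)

lemma tens_simps [simp]: "scl (tens V W) = fscale"
  by (simp add: tens_def)

lemmas [lin] = is_vspace_tens


section \<open>Linear maps out of a tensor product\<close>

text \<open>The two doubles, and likewise \<open>dual B\<close> and \<open>fin_dual B\<close>, are
  different records over one space. A tensor product sees only the carrier and the scalar action, so
  all of them give literally the same tensors.\<close>

lemma tens_cong: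
  assumes "carr V = carr V'" "scl V = scl V'" "carr W = carr W'" "scl W = scl W'"
  shows "ptens V W = ptens V' W'" "carr (tens V W) = carr (tens V' W')"
    "tens V W = tens V' W'" "tlift V W = tlift V' W'"
proof -
  have b: "bilinear_map V W scalars = bilinear_map V' W' scalars"
    by (simp add: bilinear_map_def linear_map_def fun_eq_iff assms)
  show p: "ptens V W = ptens V' W'"
    by (simp add: ptens_def b fun_eq_iff)
  show "carr (tens V W) = carr (tens V' W')" "tens V W = tens V' W'"
    by (simp_all add: tens_def p assms)
  show "tlift V W = tlift V' W'"
    by (simp add: tlift_def p assms fun_eq_iff)
qed

lemma linear_map_sum:
  assumes U: "is_vspace U" and g: "linear_map U X g" and "\<And>i. i \<in> I \<Longrightarrow> f i \<in> carr U"
  shows "g (\<Sum>i\<in>I. f i) = (\<Sum>i\<in>I. g (f i)) \<and> (\<Sum>i\<in>I. f i) \<in> carr U"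
  using assms(3)
  by (induction I rule: infinite_finite_induct)
    (auto simp: linear_map_zero[OF U g] is_vspaceD[OF U] linear_mapD(2)[OF g])

text \<open>
  The list behind \<open>tlift\<close> does not depend on the map that is lifted, so nested Sweedler sums can be
  interchanged without any linearity hypothesis.
\<close>

definition trep ::
  "('k::field, 'v::ab_group_add, 'z) vsp_scheme \<Rightarrow> ('k, 'w::ab_group_add, 'y) vsp_scheme
    \<Rightarrow> ('k, 'v, 'w) tensor \<Rightarrow> ('v \<times> 'w) list" where
  "trep V W t = (SOME xs. set xs \<subseteq> carr V \<times> carr W \<and> t = (\<Sum>(v, w)\<leftarrow>xs. ptens V W v w))"

lemma tlift_trep: "tlift V W f t = (\<Sum>(v, w)\<leftarrow>trep V W t. f v w)"
  by (simp add: tlift_def trep_def)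

lemma trep:
  assumes "is_vspace V" "t \<in> carr (tens V W)"
  shows "set (trep V W t) \<subseteq> carr V \<times> carr W" "(\<Sum>(v, w)\<leftarrow>trep V W t. ptens V W v w) = t"
proof -
  have "\<exists>xs. set xs \<subseteq> carr V \<times> carr W \<and> t = (\<Sum>(v, w)\<leftarrow>xs. ptens V W v w)"
    using tens_repr[OF assms] by blast
  from someI_ex[OF this]
  show "set (trep V W t) \<subseteq> carr V \<times> carr W" "(\<Sum>(v, w)\<leftarrow>trep V W t. ptens V W v w) = t"
    by (auto simp: trep_def)
qed

lemma sum_list_mem:
  assumes "is_vspace U" "\<And>x. x \<in> set xs \<Longrightarrow> f x \<in> carr U"
  shows "(\<Sum>x\<leftarrow>xs. f x) \<in> carr U"
  using assms(2) by (induction xs) (auto simp: is_vspaceD[OF assms(1)])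

lemma linear_map_sum_list:
  assumes "is_vspace U" "linear_map U X g" "\<And>x. x \<in> set xs \<Longrightarrow> f x \<in> carr U"
  shows "g (\<Sum>x\<leftarrow>xs. f x) = (\<Sum>x\<leftarrow>xs. g (f x))"
  using assms(3)
  by (induction xs) (auto simp: linear_map_zero[OF assms(1,2)] linear_mapD(2)[OF assms(2)]
      sum_list_mem[OF assms(1)])

lemma tlift_cong:
  assumes "is_vspace V" "t \<in> carr (tens V W)"
    and "\<And>v w. v \<in> carr V \<Longrightarrow> w \<in> carr W \<Longrightarrow> f v w = g v w"
  shows "tlift V W f t = tlift V W g t"
proof -
  have "map (\<lambda>(v, w). f v w) (trep V W t) = map (\<lambda>(v, w). g v w) (trep V W t)"
    using trep(1)[OF assms(1,2)] assms(3) by (intro map_cong) auto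
  then show ?thesis by (simp only: tlift_trep)
qed

lemma tlift_mem [lin]:
  assumes "is_vspace V" "is_vspace U" "t \<in> carr (tens V W)"
    and "\<And>v w. v \<in> carr V \<Longrightarrow> w \<in> carr W \<Longrightarrow> f v w \<in> carr U"
  shows "tlift V W f t \<in> carr U"
  unfolding tlift_trep using trep(1)[OF assms(1,3)] assms(2,4)
  by (intro sum_list_mem) auto

lemma tlift_hom:
  assumes "is_vspace V" "is_vspace U" "linear_map U X g" "t \<in> carr (tens V W)"
    and "\<And>v w. v \<in> carr V \<Longrightarrow> w \<in> carr W \<Longrightarrow> f v w \<in> carr U"
  shows "g (tlift V W f t) = tlift V W (\<lambda>v w. g (f v w)) t"
  unfolding tlift_trep using trep(1)[OF assms(1,4)] assms(5)
  by (subst linear_map_sum_list[OF assms(2,3)]) (auto simp: case_prod_unfold)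

lemma sum_list_swap:
  "(\<Sum>a\<leftarrow>xs. \<Sum>b\<leftarrow>ys. F a b :: 'z::ab_group_add) = (\<Sum>b\<leftarrow>ys. \<Sum>a\<leftarrow>xs. F a b)"
  by (induction xs) (auto simp: sum_list_addf)

lemma sum_list_product:
  "(\<Sum>p\<leftarrow>List.product xs ys. f (fst p) (snd p)) = (\<Sum>x\<leftarrow>xs. \<Sum>y\<leftarrow>ys. f x y)"
  by (induction xs) (auto simp: comp_def)

lemma tlift_swap:
  "tlift V W (\<lambda>v w. tlift X Y (\<lambda>x y. f v w x y) s) t =
   tlift X Y (\<lambda>x y. tlift V W (\<lambda>v w. f v w x y) t) s"
  unfolding tlift_trep case_prod_unfold by (rule sum_list_swap)

lemma lin_tlift_arg [lin]:
  "is_vspace V \<Longrightarrow> is_vspace U \<Longrightarrow> bilinear_map V W U f \<Longrightarrow> linear_map X (tens V W) t \<Longrightarrow>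
   linear_map X U (\<lambda>x. tlift V W f (t x))"
  by (rule linear_map_compose[OF tlift_linear])

lemma lin_tlift_fun [lin]:
  assumes "is_vspace V" "is_vspace U" "t \<in> carr (tens V W)"
    and f: "\<And>v w. v \<in> carr V \<Longrightarrow> w \<in> carr W \<Longrightarrow> linear_map X U (\<lambda>x. f x v w)"
  shows "linear_map X U (\<lambda>x. tlift V W (f x) t)"
proof -
  have "linear_map X U (\<lambda>x. \<Sum>(v, w)\<leftarrow>xs. f x v w)" if "set xs \<subseteq> carr V \<times> carr W" for xs
    using that
  proof (induction xs)
    case Nil
    then show ?case using assms(2) by (auto simp: linear_map_def is_vspaceD)
  next
    case (Cons a xs)
    then show ?case using assms(2) f[of "fst a" "snd a"]
      by (auto simp: linear_map_def is_vspaceD case_prod_unfold)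
  qed
  then show ?thesis unfolding tlift_trep using trep(1)[OF assms(1,3)] by blast
qed

lemma tens_eqI:
  assumes "is_vspace V" "is_vspace U" "linear_map (tens V W) U f" "linear_map (tens V W) U g"
    and "\<And>v w. v \<in> carr V \<Longrightarrow> w \<in> carr W \<Longrightarrow> f (ptens V W v w) = g (ptens V W v w)"
    and "t \<in> carr (tens V W)"
  shows "f t = g t"
proof -
  have b: "bilinear_map V W U (\<lambda>v w. g (ptens V W v w))"
    by (intro lin linear_map_compose[OF assms(4)])
  show ?thesis
    using tlift_unique[OF assms(1,2) b assms(3) assms(5) assms(6)]
      tlift_unique[OF assms(1,2) b assms(4) refl assms(6)] by simp
qed

lemma tlift_ptens_id:
  assumes "is_vspace V" "t \<in> carr (tens V W)"
  shows "tlift V W (ptens V W) t = t"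
  using trep(2)[OF assms] by (simp add: tlift_trep)

lemma bilinear_eqI:
  assumes "is_vspace V" "is_vspace X" "is_vspace U"
    and "bilinear_map (tens V W) (tens X Y) U f" "bilinear_map (tens V W) (tens X Y) U g"
    and "\<And>v w x y. v \<in> carr V \<Longrightarrow> w \<in> carr W \<Longrightarrow> x \<in> carr X \<Longrightarrow> y \<in> carr Y \<Longrightarrow>
      f (ptens V W v w) (ptens X Y x y) = g (ptens V W v w) (ptens X Y x y)"
    and "s \<in> carr (tens V W)" "t \<in> carr (tens X Y)"
  shows "f s t = g s t"
proof (rule tens_eqI[where f = "\<lambda>s. f s t" and g = "\<lambda>s. g s t", OF assms(1,3)])
  show "linear_map (tens V W) U (\<lambda>s. f s t)" "linear_map (tens V W) U (\<lambda>s. g s t)"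
    using assms by (auto simp: bilinear_map_def)
  fix v w assume vw: "v \<in> carr V" "w \<in> carr W"
  show "f (ptens V W v w) t = g (ptens V W v w) t"
    using assms vw
    by - (rule tens_eqI[where f = "f (ptens V W v w)" and g = "g (ptens V W v w)", OF assms(2,3)],
        auto simp: bilinear_map_def ptens_in_tens)
qed (fact assms)


section \<open>Sweedler calculus\<close>

lemma coalgebraD:
  assumes "coalgebra C"
  shows "is_vspace C" "linear_map C (tens C C) (cop C)" "linear_map C scalars (coun C)"
    "c \<in> carr C \<Longrightarrow> cop C c \<in> carr (tens C C)"
  using assms by (auto simp: coalgebra_def linear_map_def)

lemma sw2_cong:
  assumes "coalgebra C" "c \<in> carr C" "\<And>x y. x \<in> carr C \<Longrightarrow> y \<in> carr C \<Longrightarrow> f x y = g x y"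
  shows "sw2 C f c = sw2 C g c"
  unfolding sw2_def using assms coalgebraD[OF assms(1)] by (intro tlift_cong) auto

lemma sw2_mem [lin]:
  assumes "coalgebra C" "is_vspace U" "c \<in> carr C"
    "\<And>x y. x \<in> carr C \<Longrightarrow> y \<in> carr C \<Longrightarrow> f x y \<in> carr U"
  shows "sw2 C f c \<in> carr U"
  unfolding sw2_def using assms coalgebraD[OF assms(1)] by (intro tlift_mem) auto

lemma sw2_hom:
  assumes "coalgebra C" "is_vspace U" "linear_map U X g" "c \<in> carr C"
    "\<And>x y. x \<in> carr C \<Longrightarrow> y \<in> carr C \<Longrightarrow> f x y \<in> carr U"
  shows "g (sw2 C f c) = sw2 C (\<lambda>x y. g (f x y)) c"
  unfolding sw2_def using assms coalgebraD[OF assms(1)] by (intro tlift_hom) auto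

lemma sw2_swap: "sw2 C (\<lambda>v w. sw2 D (\<lambda>x y. f v w x y) d) c = sw2 D (\<lambda>x y. sw2 C (\<lambda>v w. f v w x y) c) d"
  unfolding sw2_def by (rule tlift_swap)

lemma lin_sw2_arg [lin]:
  "coalgebra C \<Longrightarrow> is_vspace U \<Longrightarrow> bilinear_map C C U f \<Longrightarrow> linear_map X C g \<Longrightarrow>
   linear_map X U (\<lambda>x. sw2 C f (g x))"
  unfolding sw2_def using coalgebraD[of C] linear_map_compose[of C "tens C C" "cop C" X g]
  by (intro lin_tlift_arg) auto

lemma lin_sw2_fun [lin]:
  "coalgebra C \<Longrightarrow> is_vspace U \<Longrightarrow> c \<in> carr C \<Longrightarrow>
   (\<And>x y. x \<in> carr C \<Longrightarrow> y \<in> carr C \<Longrightarrow> linear_map X U (\<lambda>z. f z x y)) \<Longrightarrow>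
   linear_map X U (\<lambda>z. sw2 C (f z) c)"
  unfolding sw2_def using coalgebraD[of C] by (intro lin_tlift_fun) auto

lemma sw2_ptens:
  assumes "coalgebra C" "c \<in> carr C"
  shows "sw2 C (ptens C C) c = cop C c"
  unfolding sw2_def using coalgebraD[OF assms(1)] assms(2) by (intro tlift_ptens_id) auto

text \<open>Translates one side of the coassociativity axiom from \<open>tassoc\<close> and
  \<open>tmap\<close> into a nested Sweedler sum; \<open>tmap_cop_sw2\<close> treats the other side.
  The hypotheses stop short of \<open>coalgebra C\<close> because \<open>coalgebraI\<close> uses
  both lemmas to establish it.\<close>

lemma tassoc_cop_sw2:
  assumes "is_vspace C" "linear_map C (tens C C) (cop C)" "c \<in> carr C"
  shows "tassoc C C C (tmap C C (tens C C) C (cop C) id (cop C c)) =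
    sw2 C (\<lambda>x y. sw2 C (\<lambda>u v. ptens C (tens C C) u (ptens C C v y)) x) c"
proof -
  note [lin] = assms(1)
  have l: "linear_map (tens (tens C C) C) (tens C (tens C C)) (tassoc C C C)"
    unfolding tassoc_def by (intro lin) (auto intro: lin)
  have c: "cop C x \<in> carr (tens C C)" if "x \<in> carr C" for x
    using linear_mapD(1)[OF assms(2) that] .
  have "tassoc C C C (tmap C C (tens C C) C (cop C) id (cop C c)) =
    tlift C C (\<lambda>x y. tassoc C C C (ptens (tens C C) C (cop C x) y)) (cop C c)"
    unfolding tmap_def using c assms
    by (subst tlift_hom[OF _ is_vspace_tens l]) (auto intro: lin)
  also have "\<dots> = sw2 C (\<lambda>x y. sw2 C (\<lambda>u v. ptens C (tens C C) u (ptens C C v y)) x) c"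
    unfolding sw2_def
  proof (intro tlift_cong)
    fix x y assume "x \<in> carr C" "y \<in> carr C"
    then show "tassoc C C C (ptens (tens C C) C (cop C x) y) =
      tlift C C (\<lambda>u v. ptens C (tens C C) u (ptens C C v y)) (cop C x)"
      unfolding tassoc_def using c
      by (intro tlift_ptens[where U = "tens C (tens C C)"]) (auto intro!: lin)
  qed (use assms c in auto)
  finally show ?thesis .
qed

lemma tmap_cop_sw2:
  assumes "is_vspace C" "linear_map C (tens C C) (cop C)" "c \<in> carr C"
  shows "tmap C C C (tens C C) id (cop C) (cop C c) =
    sw2 C (\<lambda>x y. sw2 C (\<lambda>u v. ptens C (tens C C) x (ptens C C u v)) y) c"
proof -
  note [lin] = assms(1)
  have c: "cop C x \<in> carr (tens C C)" if "x \<in> carr C" for x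
    using linear_mapD(1)[OF assms(2) that] .
  show ?thesis
    unfolding sw2_def tmap_def
  proof (intro tlift_cong)
    fix x y assume xy: "x \<in> carr C" "y \<in> carr C"
    then have "tlift C C (\<lambda>u v. ptens C (tens C C) x (ptens C C u v)) (cop C y) =
      ptens C (tens C C) x (tlift C C (ptens C C) (cop C y))"
      using c by (intro tlift_hom[symmetric, where U = "tens C C" and X = "tens C (tens C C)"]) (auto intro!: lin)
    then show "ptens C (tens C C) (id x) (cop C y) =
      tlift C C (\<lambda>u v. ptens C (tens C C) x (ptens C C u v)) (cop C y)"
      using c xy by (simp add: tlift_ptens_id assms)
  qed (use assms c in auto)
qed

lemma coalgebraI:
  assumes "is_vspace C" "linear_map C (tens C C) (cop C)" "linear_map C scalars (coun C)"
    and "\<And>c. c \<in> carr C \<Longrightarrow> sw2 C (\<lambda>x y. sw2 C (\<lambda>u v. ptens C (tens C C) u (ptens C C v y)) x) c =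
      sw2 C (\<lambda>x y. sw2 C (\<lambda>u v. ptens C (tens C C) x (ptens C C u v)) y) c"
    and "\<And>c. c \<in> carr C \<Longrightarrow> sw2 C (\<lambda>x y. scl C (coun C x) y) c = c"
    and "\<And>c. c \<in> carr C \<Longrightarrow> sw2 C (\<lambda>x y. scl C (coun C y) x) c = c"
  shows "coalgebra C"
  unfolding coalgebra_def using assms
  by (auto simp: tassoc_cop_sw2 tmap_cop_sw2 sw2_def[symmetric])

text \<open>The coassociativity axiom is the universal case, where \<open>f\<close> is the threefold
  pure tensor. Any trilinear \<open>f\<close> factors through a linear map on the triple tensor
  product, and that map is applied to both sides.\<close>

lemma sw2_coassoc:
  assumes C: "coalgebra C" and U: "is_vspace U" and f: "trilinear_map C C C U f" and c: "c \<in> carr C"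
  shows "sw2 C (\<lambda>x y. sw2 C (\<lambda>u v. f u v y) x) c = sw2 C (\<lambda>x y. sw2 C (\<lambda>u v. f x u v) y) c"
proof -
  note [lin] = C U coalgebraD(1)[OF C] and [lin] = trilinear_mapD[OF f]
  \<comment> \<open>The linear map induced by \<open>f\<close> on the triple tensor product.\<close>
  let ?g = "tlift C (tens C C) (\<lambda>u t. tlift C C (\<lambda>v w. f u v w) t)"
  have g: "linear_map (tens C (tens C C)) U ?g"
    by (intro lin)
  have gp: "?g (ptens C (tens C C) u (ptens C C v w)) = f u v w"
    if "u \<in> carr C" "v \<in> carr C" "w \<in> carr C" for u v w
  proof -
    have "?g (ptens C (tens C C) u (ptens C C v w)) = tlift C C (\<lambda>v w. f u v w) (ptens C C v w)"
      by (rule tlift_ptens[where U = U]) (intro lin that; assumption)+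
    also have "\<dots> = f u v w"
      by (rule tlift_ptens[where U = U]) (intro lin that; assumption)+
    finally show ?thesis .
  qed
  have eq: "sw2 C (\<lambda>x y. sw2 C (\<lambda>u v. ptens C (tens C C) u (ptens C C v y)) x) c =
     sw2 C (\<lambda>x y. sw2 C (\<lambda>u v. ptens C (tens C C) x (ptens C C u v)) y) c"
    using tassoc_cop_sw2[OF coalgebraD(1,2)[OF C] c] tmap_cop_sw2[OF coalgebraD(1,2)[OF C] c] C c
    unfolding coalgebra_def by metis
  \<comment> \<open>One statement for both bracketings: \<open>e\<close> selects the leg that is
    split again, and \<open>a\<close>, \<open>b\<close>, \<open>d\<close> say which of the resulting
    components fill the three slots.\<close>
  have push: "?g (sw2 C (\<lambda>x y. sw2 C (\<lambda>u v. ptens C (tens C C) (a x y u v) (ptens C C (b x y u v) (d x y u v))) (e x y)) c) =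
      sw2 C (\<lambda>x y. sw2 C (\<lambda>u v. f (a x y u v) (b x y u v) (d x y u v)) (e x y)) c"
    if abd: "\<And>x y u v. x \<in> carr C \<Longrightarrow> y \<in> carr C \<Longrightarrow> u \<in> carr C \<Longrightarrow> v \<in> carr C \<Longrightarrow>
      a x y u v \<in> carr C \<and> b x y u v \<in> carr C \<and> d x y u v \<in> carr C"
      and e: "\<And>x y. x \<in> carr C \<Longrightarrow> y \<in> carr C \<Longrightarrow> e x y \<in> carr C" for a b d e
  proof -
    have m: "ptens C (tens C C) (a x y u v) (ptens C C (b x y u v) (d x y u v)) \<in> carr (tens C (tens C C))"
      if "x \<in> carr C" "y \<in> carr C" "u \<in> carr C" "v \<in> carr C" for x y u v
      using abd[OF that] by (auto intro!: ptens_in_tens)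
    have "?g (sw2 C (\<lambda>x y. sw2 C (\<lambda>u v. ptens C (tens C C) (a x y u v) (ptens C C (b x y u v) (d x y u v))) (e x y)) c) =
      sw2 C (\<lambda>x y. ?g (sw2 C (\<lambda>u v. ptens C (tens C C) (a x y u v) (ptens C C (b x y u v) (d x y u v))) (e x y))) c"
      by (rule sw2_hom[OF C is_vspace_tens g c], rule sw2_mem[OF C is_vspace_tens]) (use e m in auto)
    also have "\<dots> = sw2 C (\<lambda>x y. sw2 C (\<lambda>u v. ?g (ptens C (tens C C) (a x y u v) (ptens C C (b x y u v) (d x y u v)))) (e x y)) c"
      by (rule sw2_cong[OF C c], rule sw2_hom[OF C is_vspace_tens g]) (use e m in auto)
    also have "\<dots> = sw2 C (\<lambda>x y. sw2 C (\<lambda>u v. f (a x y u v) (b x y u v) (d x y u v)) (e x y)) c"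
      by (rule sw2_cong[OF C c], rule sw2_cong[OF C], rule e, assumption+, rule gp) (use abd in auto)
    finally show ?thesis .
  qed
  show ?thesis
    using push[of "\<lambda>x y u v. u" "\<lambda>x y u v. v" "\<lambda>x y u v. y" "\<lambda>x y. x"]
      push[of "\<lambda>x y u v. x" "\<lambda>x y u v. u" "\<lambda>x y u v. v" "\<lambda>x y. y"] eq by simp
qed

lemma sw2_counit:
  assumes C: "coalgebra C" and U: "is_vspace U" and f: "linear_map C U f" and c: "c \<in> carr C"
  shows "sw2 C (\<lambda>x y. scl U (coun C x) (f y)) c = f c"
    and "sw2 C (\<lambda>x y. scl U (coun C y) (f x)) c = f c"
proof -
  note V = coalgebraD(1)[OF C]
  have "f (sw2 C (\<lambda>x y. scl C (coun C x) y) c) = sw2 C (\<lambda>x y. scl U (coun C x) (f y)) c"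
    by (subst sw2_hom[OF C V f c]) (use V c f in \<open>auto intro: lin simp: linear_map_def intro!: sw2_cong[OF C]\<close>)
  then show "sw2 C (\<lambda>x y. scl U (coun C x) (f y)) c = f c"
    using C c by (simp add: coalgebra_def sw2_def)
  have "f (sw2 C (\<lambda>x y. scl C (coun C y) x) c) = sw2 C (\<lambda>x y. scl U (coun C y) (f x)) c"
    by (subst sw2_hom[OF C V f c]) (use V c f in \<open>auto intro: lin simp: linear_map_def intro!: sw2_cong[OF C]\<close>)
  then show "sw2 C (\<lambda>x y. scl U (coun C y) (f x)) c = f c"
    using C c by (simp add: coalgebra_def sw2_def)
qed

text \<open>Coassociativity in two elements simultaneously: the second splitting moves from the
  first legs to the last legs. The sums over \<open>x\<close> and \<open>y\<close> are exchanged so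
  that each element can be regrouped on its own.\<close>

lemma sw2_coassoc2:
  assumes C: "coalgebra C" and U: "is_vspace U" and x: "x \<in> carr C" and y: "y \<in> carr C"
    and f1: "\<And>a b c. a \<in> carr C \<Longrightarrow> b \<in> carr C \<Longrightarrow> c \<in> carr C \<Longrightarrow>
      trilinear_map C C C U (\<lambda>p q r. f p q r a b c)"
    and f2: "\<And>p q r. p \<in> carr C \<Longrightarrow> q \<in> carr C \<Longrightarrow> r \<in> carr C \<Longrightarrow>
      trilinear_map C C C U (f p q r)"
  shows "sw2 C (\<lambda>x1 x2. sw2 C (\<lambda>y1 y2. sw2 C (\<lambda>p q. sw2 C (\<lambda>a b. f p q x2 a b y2) y1) x1) y) x =
    sw2 C (\<lambda>x1 x2. sw2 C (\<lambda>y1 y2. sw2 C (\<lambda>p q. sw2 C (\<lambda>a b. f x1 p q y1 a b) y2) x2) y) x"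
proof -
  note [lin] = C coalgebraD(1)[OF C] U x y trilinear_mapD[OF f1] trilinear_mapD[OF f2]
  have "sw2 C (\<lambda>x1 x2. sw2 C (\<lambda>y1 y2. sw2 C (\<lambda>p q. sw2 C (\<lambda>a b. f p q x2 a b y2) y1) x1) y) x =
    sw2 C (\<lambda>x1 x2. sw2 C (\<lambda>p q. sw2 C (\<lambda>y1 y2. sw2 C (\<lambda>a b. f p q x2 a b y2) y1) y) x1) x"
    by (rule sw2_cong[OF C x sw2_swap])
  also have "\<dots> = sw2 C (\<lambda>x1 x2. sw2 C (\<lambda>p q. sw2 C (\<lambda>y1 y2. sw2 C (\<lambda>a b. f p q x2 y1 a b) y2) y) x1) x"
    by (rule sw2_cong[OF C x], rule sw2_cong[OF C], assumption, rule sw2_coassoc[OF C U])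
      (assumption | rule lin f2)+
  also have "\<dots> = sw2 C (\<lambda>x1 x2. sw2 C (\<lambda>p q. sw2 C (\<lambda>y1 y2. sw2 C (\<lambda>a b. f x1 p q y1 a b) y2) y) x2) x"
    by (rule sw2_coassoc[OF C U]) (assumption | rule lin)+
  also have "\<dots> = sw2 C (\<lambda>x1 x2. sw2 C (\<lambda>y1 y2. sw2 C (\<lambda>p q. sw2 C (\<lambda>a b. f x1 p q y1 a b) y2) x2) y) x"
    by (rule sw2_cong[OF C x sw2_swap])
  finally show ?thesis .
qed

lemma tlift_sw2:
  assumes C: "coalgebra C" and U: "is_vspace U" and V: "is_vspace V" and f: "bilinear_map V W U f"
    and x: "x \<in> carr C"
    and p: "\<And>a b. a \<in> carr C \<Longrightarrow> b \<in> carr C \<Longrightarrow> p a b \<in> carr V \<and> q a b \<in> carr W"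
  shows "tlift V W f (sw2 C (\<lambda>a b. ptens V W (p a b) (q a b)) x) = sw2 C (\<lambda>a b. f (p a b) (q a b)) x"
proof -
  have "tlift V W f (sw2 C (\<lambda>a b. ptens V W (p a b) (q a b)) x) =
    sw2 C (\<lambda>a b. tlift V W f (ptens V W (p a b) (q a b))) x"
    by (rule sw2_hom[OF C is_vspace_tens tlift_linear[OF V U f] x]) (use p in \<open>auto intro: ptens_in_tens\<close>)
  also have "\<dots> = sw2 C (\<lambda>a b. f (p a b) (q a b)) x"
    by (rule sw2_cong[OF C x], rule tlift_ptens[OF U f]) (use p in auto)
  finally show ?thesis .
qed

lemma tlift_sw2_sw2:
  assumes C: "coalgebra C" and E: "coalgebra E" and U: "is_vspace U" and V: "is_vspace V"
    and f: "bilinear_map V W U f" and x: "x \<in> carr C" and y: "y \<in> carr E"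
    and p: "\<And>a b c d. a \<in> carr C \<Longrightarrow> b \<in> carr C \<Longrightarrow> c \<in> carr E \<Longrightarrow> d \<in> carr E \<Longrightarrow>
      p a b c d \<in> carr V \<and> q a b c d \<in> carr W"
  shows "tlift V W f (sw2 C (\<lambda>a b. sw2 E (\<lambda>c d. ptens V W (p a b c d) (q a b c d)) y) x) =
    sw2 C (\<lambda>a b. sw2 E (\<lambda>c d. f (p a b c d) (q a b c d)) y) x"
proof -
  have "tlift V W f (sw2 C (\<lambda>a b. sw2 E (\<lambda>c d. ptens V W (p a b c d) (q a b c d)) y) x) =
    sw2 C (\<lambda>a b. tlift V W f (sw2 E (\<lambda>c d. ptens V W (p a b c d) (q a b c d)) y)) x"
    by (rule sw2_hom[OF C is_vspace_tens tlift_linear[OF V U f] x], rule sw2_mem[OF E is_vspace_tens y])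
      (use p in \<open>auto intro: ptens_in_tens\<close>)
  also have "\<dots> = sw2 C (\<lambda>a b. sw2 E (\<lambda>c d. f (p a b c d) (q a b c d)) y) x"
    by (rule sw2_cong[OF C x], rule tlift_sw2[OF E U V f y]) (use p in auto)
  finally show ?thesis .
qed

lemma sum_list_exchange:
  fixes F :: "'p \<Rightarrow> 'r \<Rightarrow> 'k::field"
  shows "(\<Sum>r\<leftarrow>R. \<Sum>s\<leftarrow>S. (\<Sum>p\<leftarrow>P. F p r * G p s) * (\<Sum>q\<leftarrow>Q. F' q r * G' q s)) =
    (\<Sum>p\<leftarrow>P. \<Sum>q\<leftarrow>Q. (\<Sum>r\<leftarrow>R. F p r * F' q r) * (\<Sum>s\<leftarrow>S. G p s * G' q s))"
proof -
  let ?X = "\<lambda>r s p q. (F p r * F' q r) * (G p s * G' q s)"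
  have prod: "(\<Sum>x\<leftarrow>xs. f x) * (\<Sum>y\<leftarrow>ys. g y) = (\<Sum>x\<leftarrow>xs. \<Sum>y\<leftarrow>ys. f x * g y)"
    for xs :: "'i list" and ys :: "'j list" and f and g :: "_ \<Rightarrow> 'k"
    by (induction xs) (auto simp: sum_list_const_mult distrib_right)
  have "(\<Sum>r\<leftarrow>R. \<Sum>s\<leftarrow>S. (\<Sum>p\<leftarrow>P. F p r * G p s) * (\<Sum>q\<leftarrow>Q. F' q r * G' q s)) =
    (\<Sum>r\<leftarrow>R. \<Sum>s\<leftarrow>S. \<Sum>p\<leftarrow>P. \<Sum>q\<leftarrow>Q. ?X r s p q)"
    unfolding prod by (simp only: mult_ac)
  also have "\<dots> = (\<Sum>r\<leftarrow>R. \<Sum>p\<leftarrow>P. \<Sum>s\<leftarrow>S. \<Sum>q\<leftarrow>Q. ?X r s p q)"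
    by (simp only: sum_list_swap[of _ P S])
  also have "\<dots> = (\<Sum>p\<leftarrow>P. \<Sum>r\<leftarrow>R. \<Sum>q\<leftarrow>Q. \<Sum>s\<leftarrow>S. ?X r s p q)"
    by (subst sum_list_swap[of _ P R], subst sum_list_swap[of _ Q S], rule refl)
  also have "\<dots> = (\<Sum>p\<leftarrow>P. \<Sum>q\<leftarrow>Q. \<Sum>r\<leftarrow>R. \<Sum>s\<leftarrow>S. ?X r s p q)"
    by (simp only: sum_list_swap[of _ Q R])
  also have "\<dots> = (\<Sum>p\<leftarrow>P. \<Sum>q\<leftarrow>Q. (\<Sum>r\<leftarrow>R. F p r * F' q r) * (\<Sum>s\<leftarrow>S. G p s * G' q s))"
    unfolding prod ..
  finally show ?thesis .
qed

text \<open>Four finite sums of scalar products, grouped once by the pair \<open>r\<close>,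
  \<open>s\<close> and once by the pair \<open>p\<close>, \<open>q\<close>. This interchange
  underlies the multiplicativity of the coproduct of the dual.\<close>

lemma sw2_exchange:
  fixes F :: "'p::ab_group_add \<Rightarrow> 'r::ab_group_add \<Rightarrow> 'k::field"
  shows "sw2 C (\<lambda>r1 r2. sw2 D (\<lambda>s1 s2. sw2 E (\<lambda>p1 p2. F p1 r1 * G p2 s1) p *
      sw2 E' (\<lambda>q1 q2. F' q1 r2 * G' q2 s2) q) s) r =
    sw2 E (\<lambda>p1 p2. sw2 E' (\<lambda>q1 q2. sw2 C (\<lambda>r1 r2. F p1 r1 * F' q1 r2) r *
      sw2 D (\<lambda>s1 s2. G p2 s1 * G' q2 s2) s) q) p"
  unfolding sw2_def tlift_trep case_prod_unfold
  by (rule sum_list_exchange[where F = "\<lambda>p r. F (fst p) (fst r)" and G = "\<lambda>p s. G (snd p) (fst s)"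
      and F' = "\<lambda>q r. F' (fst q) (snd r)" and G' = "\<lambda>q s. G' (snd q) (snd s)"])


section \<open>Separating functionals and finite rank\<close>

lemma vspace_minus:
  assumes "is_vspace V" "x \<in> carr V" "y \<in> carr V"
  shows "x - y \<in> carr V"
proof -
  interpret vector_space "scl V" using assms(1) by (simp add: is_vspace_def)
  show ?thesis using assms subspace_diff by (auto simp: is_vspace_def)
qed

lemma linear_map_diff:
  assumes "is_vspace V" "linear_map V W f" "x \<in> carr V" "y \<in> carr V"
  shows "f (x - y) = f x - f y"
  using linear_mapD(2)[OF assms(2), of "x - y" y] vspace_minus[OF assms(1,3,4)] assms(4)
  by (simp add: algebra_simps)

text \<open>Expanding the second legs in a basis of \<open>W\<close> writes the tensor as a finite
  sum of \<open>u e \<otimes> e\<close>. Applying \<phi> to the first leg gives zero, so by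
  independence every \<open>\<phi> (u e)\<close> vanishes, and separation forces
  \<open>u e = 0\<close>. Separating functionals are required on the first factor alone; this
  matters when \<open>W\<close> is \<open>B\<close>.\<close>

lemma tens_eq_0I:
  fixes V :: "('k::field, 'v::ab_group_add, 'z) vsp_scheme" and W :: "('k, 'w::ab_group_add, 'y) vsp_scheme"
  assumes V: "is_vspace V" and W: "is_vspace W"
    and \<Phi>: "\<And>\<phi>. \<phi> \<in> \<Phi> \<Longrightarrow> linear_map V scalars \<phi>"
    and sep: "\<And>v. v \<in> carr V \<Longrightarrow> (\<And>\<phi>. \<phi> \<in> \<Phi> \<Longrightarrow> \<phi> v = 0) \<Longrightarrow> v = 0"
    and t: "t \<in> carr (tens V W)"
    and eq: "\<And>\<phi>. \<phi> \<in> \<Phi> \<Longrightarrow> tlift V W (\<lambda>v w. scl W (\<phi> v) w) t = 0"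
  shows "t = 0"
proof
  fix \<gamma> :: "'v \<Rightarrow> 'w \<Rightarrow> 'k"
  interpret w: vector_space "scl W" using W by (simp add: is_vspace_def)
  define xs where "xs = trep V W t"
  have xs: "set xs \<subseteq> carr V \<times> carr W" "(\<Sum>(v, w)\<leftarrow>xs. ptens V W v w) = t"
    using trep[OF V t] by (auto simp: xs_def)
  have app: "(\<Sum>x\<leftarrow>ys. F x) \<gamma> = (\<Sum>x\<leftarrow>ys. F x \<gamma>)" for ys :: "'c list" and F :: "'c \<Rightarrow> ('k, 'v, 'w) tensor"
    by (induction ys) auto
  have t\<gamma>: "t \<gamma> = (\<Sum>(v, w)\<leftarrow>xs. ptens V W v w \<gamma>)"
    unfolding xs(2)[symmetric] app by (simp add: case_prod_unfold)
  show "t \<gamma> = 0 \<gamma>"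
  proof (cases "bilinear_map V W scalars \<gamma>")
    case False
    then have z: "(\<lambda>(v, w). ptens V W v w \<gamma>) = (\<lambda>_. 0)"
      by (auto simp: ptens_def)
    show ?thesis unfolding t\<gamma> z by simp
  next
    case True
    note \<gamma>l = linear_mapD[OF bspec[OF conjunct1[OF True[unfolded bilinear_map_def]]]]
    note \<gamma>r = linear_mapD[OF bspec[OF conjunct2[OF True[unfolded bilinear_map_def]]]]
    obtain E where E: "E \<subseteq> carr W" "w.independent E" "carr W \<subseteq> w.span E"
      using w.maximal_independent_subset by blast
    let ?r = "w.representation E"
    \<comment> \<open>The basis vectors that occur in some second leg; finitely many, so all
      expansions can be summed over one set.\<close>
    define E0 where "E0 = (\<Union>p\<in>set xs. {e. ?r (snd p) e \<noteq> 0})"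
    have fin: "finite E0" unfolding E0_def by (auto intro: w.finite_representation)
    have E0: "E0 \<subseteq> carr W" using E(1) by (auto simp: E0_def dest: w.representation_ne_zero)
    have rep: "snd p = (\<Sum>e\<in>E0. scl W (?r (snd p) e) e)" if "p \<in> set xs" for p
    proof -
      have "snd p \<in> w.span E" using that xs(1) E(3) by (metis mem_Times_iff subsetD)
      then have "snd p = (\<Sum>e | ?r (snd p) e \<noteq> 0. scl W (?r (snd p) e) e)"
        using w.sum_nonzero_representation_eq[OF E(2)] by simp
      also have "\<dots> = (\<Sum>e\<in>E0. scl W (?r (snd p) e) e)"
        by (rule sum.mono_neutral_left[OF fin]) (use that in \<open>auto simp: E0_def\<close>)
      finally show ?thesis .
    qed
    have \<gamma>sum: "\<gamma> v (\<Sum>e\<in>X. scl W (c e) e) = (\<Sum>e\<in>X. c e * \<gamma> v e) \<and> (\<Sum>e\<in>X. scl W (c e) e) \<in> carr W"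
      if "finite X" "X \<subseteq> carr W" "v \<in> carr V" for X c v
      using that
    proof (induction X rule: finite_induct)
      case empty
      then show ?case using linear_map_zero[OF W, of scalars "\<gamma> v"] True is_vspaceD(1)[OF W]
        by (auto simp: bilinear_map_def)
    next
      case (insert e X)
      then show ?case using \<gamma>l[of v] is_vspaceD[OF W] by auto
    qed
    \<comment> \<open>The coefficient in \<open>V\<close> of the basis vector \<open>e\<close> in
      the tensor.\<close>
    define u where "u e = (\<Sum>p\<leftarrow>xs. scl V (?r (snd p) e) (fst p))" for e
    have um: "u e \<in> carr V" for e
      unfolding u_def by (rule sum_list_mem[OF V]) (use xs(1) is_vspaceD[OF V] in auto)
    have u0: "u e = 0" for e
    proof (rule sep[OF um])
      fix \<phi> assume p: "\<phi> \<in> \<Phi>"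
      note \<phi> = \<Phi>[OF p]
      have z: "(\<Sum>p\<leftarrow>xs. scl W (\<phi> (fst p)) (snd p)) = 0"
        using eq[OF p] by (simp add: tlift_trep xs_def case_prod_unfold)
      have "\<phi> (u e) = (\<Sum>p\<leftarrow>xs. \<phi> (scl V (?r (snd p) e) (fst p)))"
        unfolding u_def by (rule linear_map_sum_list[OF V \<phi>]) (use xs(1) is_vspaceD[OF V] in auto)
      also have "\<dots> = (\<Sum>p\<leftarrow>xs. \<phi> (fst p) * ?r (snd p) e)"
        using xs(1) by (intro arg_cong[of _ _ sum_list] map_cong) (auto simp: linear_mapD(3)[OF \<phi>] mult.commute)
      also have "\<dots> = ?r (\<Sum>p\<leftarrow>xs. scl W (\<phi> (fst p)) (snd p)) e"
      proof -
        have "?r (\<Sum>p\<leftarrow>ys. scl W (\<phi> (fst p)) (snd p)) e = (\<Sum>p\<leftarrow>ys. \<phi> (fst p) * ?r (snd p) e)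
            \<and> (\<Sum>p\<leftarrow>ys. scl W (\<phi> (fst p)) (snd p)) \<in> w.span E"
          if "set ys \<subseteq> carr V \<times> carr W" for ys
          using that
        proof (induction ys)
          case Nil
          then show ?case by (simp add: w.representation_zero w.span_zero)
        next
          case (Cons p ys)
          moreover have "snd p \<in> w.span E" using Cons.prems E(3) by (metis list.set_intros(1) mem_Times_iff subsetD)
          ultimately show ?case
            by (auto simp: w.representation_add[OF E(2)] w.representation_scale[OF E(2)] w.span_add w.span_scale)
        qed
        from this[OF xs(1)] show ?thesis by simp
      qed
      finally show "\<phi> (u e) = 0" by (simp add: z w.representation_zero)
    qed
    have "t \<gamma> = (\<Sum>p\<leftarrow>xs. \<gamma> (fst p) (snd p))"
      unfolding t\<gamma> by (simp add: ptens_def True case_prod_unfold)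
    also have "\<dots> = (\<Sum>p\<leftarrow>xs. \<Sum>e\<in>E0. ?r (snd p) e * \<gamma> (fst p) e)"
    proof (intro arg_cong[of _ _ sum_list] map_cong refl)
      fix p assume p: "p \<in> set xs"
      then have "fst p \<in> carr V" using xs(1) by auto
      from \<gamma>sum[OF fin E0 this, of "?r (snd p)"] rep[OF p]
      show "\<gamma> (fst p) (snd p) = (\<Sum>e\<in>E0. ?r (snd p) e * \<gamma> (fst p) e)" by simp
    qed
    also have "\<dots> = (\<Sum>e\<in>E0. \<Sum>p\<leftarrow>xs. ?r (snd p) e * \<gamma> (fst p) e)"
      by (induction xs) (auto simp: sum.distrib)
    also have "\<dots> = (\<Sum>e\<in>E0. \<gamma> (u e) e)"
    proof (rule sum.cong[OF refl])
      fix e assume e: "e \<in> E0"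
      then have ec: "e \<in> carr W" using E0 by auto
      have l: "linear_map V scalars (\<lambda>v. \<gamma> v e)"
        using True ec by (simp add: bilinear_map_def)
      have "\<gamma> (u e) e = (\<Sum>p\<leftarrow>xs. \<gamma> (scl V (?r (snd p) e) (fst p)) e)"
        unfolding u_def by (rule linear_map_sum_list[OF V l]) (use xs(1) is_vspaceD[OF V] in auto)
      also have "\<dots> = (\<Sum>p\<leftarrow>xs. ?r (snd p) e * \<gamma> (fst p) e)"
        using xs(1) by (intro arg_cong[of _ _ sum_list] map_cong) (auto simp: linear_mapD(3)[OF l])
      finally show "(\<Sum>p\<leftarrow>xs. ?r (snd p) e * \<gamma> (fst p) e) = \<gamma> (u e) e" by simp
    qed
    also have "\<dots> = 0"
    proof -
      have "\<gamma> (u e) e = 0" if "e \<in> E0" for e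
      proof -
        have l: "linear_map V scalars (\<lambda>v. \<gamma> v e)"
          using True that E0 by (auto simp: bilinear_map_def)
        show ?thesis unfolding u0 using linear_map_zero[OF V l] .
      qed
      then show ?thesis by simp
    qed
    finally show ?thesis by simp
  qed
qed

lemma tens_separate:
  assumes V: "is_vspace V" and W: "is_vspace W"
    and \<Phi>: "\<And>\<phi>. \<phi> \<in> \<Phi> \<Longrightarrow> linear_map V scalars \<phi>"
    and sep: "\<And>v. v \<in> carr V \<Longrightarrow> (\<And>\<phi>. \<phi> \<in> \<Phi> \<Longrightarrow> \<phi> v = 0) \<Longrightarrow> v = 0"
    and st: "s \<in> carr (tens V W)" "t \<in> carr (tens V W)"
    and eq: "\<And>\<phi>. \<phi> \<in> \<Phi> \<Longrightarrow> tlift V W (\<lambda>v w. scl W (\<phi> v) w) s = tlift V W (\<lambda>v w. scl W (\<phi> v) w) t"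
  shows "s = t"
proof -
  have "s - t = 0"
  proof (rule tens_eq_0I[OF V W \<Phi> sep vspace_minus[OF is_vspace_tens st]])
    fix \<phi> assume p: "\<phi> \<in> \<Phi>"
    have l: "linear_map (tens V W) W (tlift V W (\<lambda>v w. scl W (\<phi> v) w))"
      by (rule tlift_linear) (assumption | rule lin V W linear_map_compose[OF \<Phi>[OF p]])+
    show "tlift V W (\<lambda>v w. scl W (\<phi> v) w) (s - t) = 0"
      using linear_map_diff[OF is_vspace_tens l st] eq[OF p] by simp
  qed
  then show ?thesis by (metis eq_iff_diff_eq_0)
qed

text \<open>Each further functional enlarges the complement by at most one vector: a
  \<open>u\<close> in the previous kernel on which it does not vanish, if there is one.\<close>

lemma finite_codim_kernels:
  assumes V: "is_vspace V" and "finite \<Phi>" and "\<And>\<phi>. \<phi> \<in> \<Phi> \<Longrightarrow> linear_map V scalars \<phi>"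
  shows "finite_codim V {x \<in> carr V. \<forall>\<phi>\<in>\<Phi>. \<phi> x = 0}"
  using assms(2,3)
proof (induction \<Phi> rule: finite_induct)
  case empty
  interpret vector_space "scl V" using V by (simp add: is_vspace_def)
  show ?case unfolding finite_codim_def by (intro exI[of _ "{}"]) (auto intro: span_base)
next
  case (insert \<phi> \<Phi>)
  interpret vector_space "scl V" using V by (simp add: is_vspace_def)
  let ?K = "{x \<in> carr V. \<forall>\<psi>\<in>\<Phi>. \<psi> x = 0}"
  let ?K' = "{x \<in> carr V. \<forall>\<psi>\<in>insert \<phi> \<Phi>. \<psi> x = 0}"
  obtain F where F: "finite F" "F \<subseteq> carr V" "carr V \<subseteq> span (?K \<union> F)"
    using insert by (auto simp: finite_codim_def)
  show ?case
  proof (cases "\<forall>x\<in>?K. \<phi> x = 0")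
    case True
    then have "?K' = ?K" by auto
    then show ?thesis using F unfolding finite_codim_def by auto
  next
    case False
    then obtain u where u: "u \<in> ?K" "\<phi> u \<noteq> 0" by auto
    have \<phi>: "linear_map V scalars \<phi>" using insert by auto
    have "?K \<subseteq> span (?K' \<union> insert u F)"
    proof
      fix x assume x: "x \<in> ?K"
      \<comment> \<open>The projection of \<open>x\<close> along \<open>u\<close> into the kernel of
        \<phi>; it stays in the other kernels because \<open>u\<close> lies in them.\<close>
      let ?y = "x - scl V (\<phi> x / \<phi> u) u"
      have um: "scl V (\<phi> x / \<phi> u) u \<in> carr V" using u V by (auto simp: is_vspaceD)
      have "\<psi> ?y = 0" if "\<psi> \<in> insert \<phi> \<Phi>" for \<psi>
      proof -
        have l: "linear_map V scalars \<psi>" using that insert.prems by auto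
        show ?thesis
          using that x u um linear_map_diff[OF V l, of x "scl V (\<phi> x / \<phi> u) u"] linear_mapD(3)[OF l, of u]
          by auto
      qed
      then have "?y \<in> ?K'" using x um vspace_minus[OF V] by auto
      then have "?y + scl V (\<phi> x / \<phi> u) u \<in> span (?K' \<union> insert u F)"
        by (intro span_add span_scale span_base) auto
      then show "x \<in> span (?K' \<union> insert u F)" by simp
    qed
    moreover have "F \<subseteq> span (?K' \<union> insert u F)" by (auto intro: span_base)
    ultimately have "span (?K \<union> F) \<subseteq> span (?K' \<union> insert u F)"
      by (intro span_minimal) (auto simp: subspace_span)
    then show ?thesis unfolding finite_codim_def using F u by (intro exI[of _ "insert u F"]) auto
  qed
qed

text \<open>The columns \<open>f _ y\<close> lie in the span of the finitely many
  \<open>g p\<close>, so finitely many of them already span all columns. Vanishing at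
  \<open>x\<close> is inherited by linear combinations. The lemma supplies the finite test sets that
  cut out an ideal of finite codimension.\<close>

lemma finite_rank_detect:
  fixes f :: "'x \<Rightarrow> 'y \<Rightarrow> 'k::field"
  assumes f: "\<And>x y. x \<in> X \<Longrightarrow> y \<in> Y \<Longrightarrow> f x y = (\<Sum>p\<leftarrow>ps. g p x * h p y)"
  shows "\<exists>Y0. finite Y0 \<and> Y0 \<subseteq> Y \<and>
    (\<forall>x\<in>X. (\<forall>y\<in>Y0. f x y = 0) \<longrightarrow> (\<forall>y\<in>Y. f x y = 0))"
proof -
  interpret vector_space "fscale :: 'k \<Rightarrow> ('x \<Rightarrow> 'k) \<Rightarrow> _" by (rule vector_space_fscale)
  \<comment> \<open>The column of \<open>f\<close> at \<open>y\<close>, set to zero off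
    \<open>X\<close> so that it is determined by its values on \<open>X\<close>.\<close>
  define r where "r y = (\<lambda>x. if x \<in> X then f x y else 0)" for y
  let ?G = "(\<lambda>p x. if x \<in> X then g p x else 0) ` set ps"
  have rG: "r y \<in> span ?G" if "y \<in> Y" for y
  proof -
    have "(\<lambda>x. if x \<in> X then \<Sum>p\<leftarrow>qs. g p x * h p y else 0) \<in> span ?G" if "set qs \<subseteq> set ps" for qs
      using that
    proof (induction qs)
      case Nil
      have "(\<lambda>x. if x \<in> X then \<Sum>p\<leftarrow>[]. g p x * h p y else 0) = 0" by (simp add: fun_eq_iff)
      then show ?case by (simp only: span_zero)
    next
      case (Cons p qs)
      have "(\<lambda>x. if x \<in> X then \<Sum>p\<leftarrow>p # qs. g p x * h p y else 0) =
        fscale (h p y) (\<lambda>x. if x \<in> X then g p x else 0) + (\<lambda>x. if x \<in> X then \<Sum>p\<leftarrow>qs. g p x * h p y else 0)"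
        by (auto simp: fun_eq_iff fscale_def)
      moreover have "(\<lambda>x. if x \<in> X then g p x else 0) \<in> span ?G"
        by (rule span_base) (use Cons.prems in auto)
      ultimately show ?case using Cons by (auto intro: span_add span_scale)
    qed
    from this[of ps] show ?thesis using f[OF _ that] by (simp add: r_def cong: if_cong)
  qed
  obtain R0 where R0: "R0 \<subseteq> r ` Y" "independent R0" "r ` Y \<subseteq> span R0"
    using maximal_independent_subset by blast
  have "R0 \<subseteq> span ?G" using R0(1) rG by auto
  then have "finite R0" using independent_span_bound[of ?G R0] R0(2) by simp
  then obtain Y0 where Y0: "Y0 \<subseteq> Y" "finite Y0" "R0 = r ` Y0"
    using R0(1) finite_subset_image by metis
  show ?thesis
  proof (intro exI[of _ Y0] conjI ballI impI Y0(1,2))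
    fix x y assume x: "x \<in> X" and z: "\<forall>y\<in>Y0. f x y = 0" and y: "y \<in> Y"
    have "subspace {q :: 'x \<Rightarrow> 'k. q x = 0}" by (auto simp: subspace_def fscale_def)
    moreover have "R0 \<subseteq> {q. q x = 0}" using z x by (auto simp: Y0(3) r_def)
    ultimately have "span R0 \<subseteq> {q. q x = 0}" by (rule span_minimal[rotated])
    then have "r y x = 0" using R0(3) y by auto
    then show "f x y = 0" using x by (simp add: r_def)
  qed
qed


section \<open>Cleft pairs\<close>

text \<open>The explicit action of the theorem is compared with the abstract one on carriers only;
  this lemma makes that agreement sufficient.\<close>

lemma yd_module_algebra_cong:
  assumes yd: "yd_module_algebra H X act \<delta>"
    and eq: "\<And>h x. h \<in> carr H \<Longrightarrow> x \<in> carr X \<Longrightarrow> act' h x = act h x"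
  shows "yd_module_algebra H X act' \<delta>"
proof -
  have C: "coalgebra H" and A: "algebra H" "algebra X" and b: "bilinear_map H X X act"
    using yd by (auto simp: yd_module_algebra_def hopf_algebra_def bialgebra_def left_module_algebra_def left_module_def)
  have m: "g \<in> carr H \<Longrightarrow> h \<in> carr H \<Longrightarrow> mul H g h \<in> carr H" "unit H \<in> carr H"
    "x \<in> carr X \<Longrightarrow> y \<in> carr X \<Longrightarrow> mul X x y \<in> carr X" "unit X \<in> carr X" for g h x y
    using A by (auto simp: algebra_def bilinear_map_def linear_map_def)
  have V: "is_vspace H" "is_vspace X" using A by (auto simp: algebra_def)
  have am: "h \<in> carr H \<Longrightarrow> x \<in> carr X \<Longrightarrow> act h x \<in> carr X" for h x
    using b by (auto simp: bilinear_map_def linear_map_def)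
  have b': "bilinear_map H X X act'"
    using b by (simp add: bilinear_map_def linear_map_def eq is_vspaceD[OF V(1)] is_vspaceD[OF V(2)])
  have "left_module H X act'"
    using yd b' by (simp add: yd_module_algebra_def left_module_algebra_def left_module_def eq m am)
  moreover have "act' h (mul X x y) = sw2 H (\<lambda>h1 h2. mul X (act' h1 x) (act' h2 y)) h"
    if "h \<in> carr H" "x \<in> carr X" "y \<in> carr X" for h x y
  proof -
    have "act' h (mul X x y) = sw2 H (\<lambda>h1 h2. mul X (act h1 x) (act h2 y)) h"
      using yd that by (simp add: yd_module_algebra_def left_module_algebra_def eq m)
    also have "\<dots> = sw2 H (\<lambda>h1 h2. mul X (act' h1 x) (act' h2 y)) h"
      by (rule sw2_cong[OF C that(1)]) (simp add: eq that)
    finally show ?thesis .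
  qed
  moreover have "sw2 H (\<lambda>h1 h2. tlift H X (\<lambda>u y. ptens H X (mul H u h2) y) (\<delta> (act' h1 x))) h =
        sw2 H (\<lambda>h1 h2. tlift H X (\<lambda>u y. ptens H X (mul H h1 u) (act' h2 y)) (\<delta> x)) h"
    if h: "h \<in> carr H" and x: "x \<in> carr X" for h x
  proof -
    have d: "\<delta> x \<in> carr (tens H X)"
      using yd x by (auto simp: yd_module_algebra_def left_comodule_algebra_def left_comodule_def linear_map_def)
    have "sw2 H (\<lambda>h1 h2. tlift H X (\<lambda>u y. ptens H X (mul H u h2) y) (\<delta> (act' h1 x))) h =
      sw2 H (\<lambda>h1 h2. tlift H X (\<lambda>u y. ptens H X (mul H u h2) y) (\<delta> (act h1 x))) h"
      by (rule sw2_cong[OF C h]) (simp add: eq x)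
    also have "\<dots> = sw2 H (\<lambda>h1 h2. tlift H X (\<lambda>u y. ptens H X (mul H h1 u) (act h2 y)) (\<delta> x)) h"
      using yd h x by (simp add: yd_module_algebra_def)
    also have "\<dots> = sw2 H (\<lambda>h1 h2. tlift H X (\<lambda>u y. ptens H X (mul H h1 u) (act' h2 y)) (\<delta> x)) h"
      by (rule sw2_cong[OF C h], rule tlift_cong[OF V(1) d]) (simp add: eq)
    finally show ?thesis .
  qed
  ultimately show ?thesis
    using yd by (simp add: yd_module_algebra_def left_module_algebra_def eq m)
qed

text \<open>\<open>cop_mul_H\<close> says that the coproduct, viewed as a coaction on
  \<open>H\<close>, is multiplicative. The product of \<open>D\<close> enters only as a bilinear map
  tied to that of \<open>H\<close> by this axiom; associativity, unit laws and compatibility with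
  the coproduct are conclusions, so the locale can be entered before \<open>D\<close> is known to be
  a bialgebra.\<close>

locale cleft_pair =
  fixes D :: "('k::field, 't::ab_group_add) hopf"
    and H :: "('k, 't) alg"
    and psi :: "'t \<Rightarrow> 't"
  assumes carr_H: "carr H = carr D" and scl_H: "scl H = scl D" and unit_H: "unit H = unit D"
    and algebra_H: "algebra H"
    and coalgebra_D: "coalgebra D"
    and mul_D: "bilinear_map D D D (mul D)"
    and psi: "linear_map D D psi"
    and cop_unit: "cop D (unit D) = ptens D D (unit D) (unit D)"
    and coun_unit: "coun D (unit D) = 1"
    and cop_mul_H: "\<And>x y. x \<in> carr D \<Longrightarrow> y \<in> carr D \<Longrightarrow>
      cop D (mul H x y) =
      sw2 D (\<lambda>x1 x2. sw2 D (\<lambda>y1 y2. ptens D D (mul D x1 y1) (mul H x2 y2)) y) x"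
    and conv_right: "\<And>x. x \<in> carr D \<Longrightarrow>
      sw2 D (\<lambda>a b. mul H a (psi b)) x = scl D (coun D x) (unit D)"
    and conv_left: "\<And>x. x \<in> carr D \<Longrightarrow>
      sw2 D (\<lambda>a b. mul H (psi a) b) x = scl D (coun D x) (unit D)"
begin

abbreviation H_mul (infixl "\<cdot>" 70) where "x \<cdot> y \<equiv> mul H x y"
abbreviation D_mul (infixl "\<star>" 70) where "x \<star> y \<equiv> mul D x y"
abbreviation "sw \<equiv> sw2 D"
abbreviation "\<e> \<equiv> unit D"

lemma mul_H: "bilinear_map D D D (mul H)"
  using algebra_H by (simp add: algebra_def bilinear_map_def linear_map_def carr_H scl_H)

lemma unit_mem: "\<e> \<in> carr D"
  using algebra_H by (simp add: algebra_def carr_H unit_H)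

lemma H_assoc: "x \<in> carr D \<Longrightarrow> y \<in> carr D \<Longrightarrow> z \<in> carr D \<Longrightarrow> (x \<cdot> y) \<cdot> z = x \<cdot> (y \<cdot> z)"
  using algebra_H by (simp add: algebra_def carr_H)

lemma H_unit: "x \<in> carr D \<Longrightarrow> \<e> \<cdot> x = x" "x \<in> carr D \<Longrightarrow> x \<cdot> \<e> = x"
  using algebra_H by (simp_all add: algebra_def carr_H unit_H[symmetric])

lemmas coalgD = coalgebraD[OF coalgebra_D]

lemmas [lin] = coalgebra_D coalgD(1) unit_mem bilinear_mapD[OF mul_H] bilinear_mapD[OF mul_D]
  linear_map_compose[OF psi] linear_map_compose[OF coalgD(3)] linear_mapD(1)[OF psi]

lemma sw_cong:
  "\<lbrakk>\<And>x y. x \<in> carr D \<Longrightarrow> y \<in> carr D \<Longrightarrow> f x y = g x y; c \<in> carr D\<rbrakk> \<Longrightarrow> sw f c = sw g c"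
  by (rule sw2_cong[OF coalgebra_D])

lemma sw_hom:
  "\<lbrakk>is_vspace U; linear_map U X g; \<And>x y. x \<in> carr D \<Longrightarrow> y \<in> carr D \<Longrightarrow> f x y \<in> carr U; c \<in> carr D\<rbrakk>
    \<Longrightarrow> g (sw f c) = sw (\<lambda>x y. g (f x y)) c"
  by (rule sw2_hom[OF coalgebra_D])

section \<open>Cancellation rules and the recovery of \<open>\<star>\<close> from
  \<open>\<cdot>\<close>\<close>

lemma sw_mul_H:
  assumes U: "is_vspace U" and f: "bilinear_map D D U f" and x: "x \<in> carr D" and y: "y \<in> carr D"
  shows "sw f (x \<cdot> y) = sw (\<lambda>x1 x2. sw (\<lambda>y1 y2. f (x1 \<star> y1) (x2 \<cdot> y2)) y) x"
  unfolding sw2_def[of D f] cop_mul_H[OF x y]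
  by (rule tlift_sw2_sw2[OF coalgebra_D coalgebra_D U coalgD(1) f x y])
    (auto intro: bilinear_mapD(3)[OF mul_D] bilinear_mapD(3)[OF mul_H])

lemma sw_unit:
  assumes "is_vspace U" "bilinear_map D D U f"
  shows "sw f \<e> = f \<e> \<e>"
  unfolding sw2_def cop_unit by (rule tlift_ptens[OF assms unit_mem unit_mem])

lemma sw_conv:
  assumes U: "is_vspace U" and L: "linear_map D U L" and x: "x \<in> carr D"
  shows "sw (\<lambda>a b. L (a \<cdot> psi b)) x = scl U (coun D x) (L \<e>)"
    and "sw (\<lambda>a b. L (psi a \<cdot> b)) x = scl U (coun D x) (L \<e>)"
proof -
  have "L (sw (\<lambda>a b. a \<cdot> psi b) x) = sw (\<lambda>a b. L (a \<cdot> psi b)) x"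
    by (rule sw_hom[OF coalgD(1) L _ x]) (assumption | rule lin)+
  then show "sw (\<lambda>a b. L (a \<cdot> psi b)) x = scl U (coun D x) (L \<e>)"
    by (simp add: conv_right[OF x] linear_mapD(3)[OF L] unit_mem)
  have "L (sw (\<lambda>a b. psi a \<cdot> b) x) = sw (\<lambda>a b. L (psi a \<cdot> b)) x"
    by (rule sw_hom[OF coalgD(1) L _ x]) (assumption | rule lin)+
  then show "sw (\<lambda>a b. L (psi a \<cdot> b)) x = scl U (coun D x) (L \<e>)"
    by (simp add: conv_left[OF x] linear_mapD(3)[OF L] unit_mem)
qed

text \<open>Coassociativity brings the last two of three legs together; they cancel to a counit,
  which the first leg absorbs. \<open>sw_conv_left\<close> is the same argument with the other
  convolution identity.\<close>

lemma sw_conv_right: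
  assumes U: "is_vspace U" and F: "bilinear_map D D U F" and x: "x \<in> carr D"
  shows "sw (\<lambda>a b. sw (\<lambda>a1 a2. F a1 (a2 \<cdot> psi b)) a) x = F x \<e>"
proof -
  note [lin] = U bilinear_mapD[OF F] x
  have "sw (\<lambda>a b. sw (\<lambda>a1 a2. F a1 (a2 \<cdot> psi b)) a) x =
      sw (\<lambda>a b. sw (\<lambda>b1 b2. F a (b1 \<cdot> psi b2)) b) x"
    by (rule sw2_coassoc[OF coalgebra_D U _ x]) (assumption | rule lin)+
  also have "\<dots> = sw (\<lambda>a b. scl U (coun D b) (F a \<e>)) x"
    by (rule sw_cong[OF _ x], rule sw_conv(1)[OF U]) (assumption | rule lin)+
  also have "\<dots> = F x \<e>"
    by (rule sw2_counit(2)[OF coalgebra_D U _ x]) (assumption | rule lin)+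
  finally show ?thesis .
qed

lemma sw_conv_left:
  assumes U: "is_vspace U" and F: "bilinear_map D D U F" and x: "x \<in> carr D"
  shows "sw (\<lambda>a b. sw (\<lambda>a1 a2. F a1 (psi a2 \<cdot> b)) a) x = F x \<e>"
proof -
  note [lin] = U bilinear_mapD[OF F] x
  have "sw (\<lambda>a b. sw (\<lambda>a1 a2. F a1 (psi a2 \<cdot> b)) a) x =
      sw (\<lambda>a b. sw (\<lambda>b1 b2. F a (psi b1 \<cdot> b2)) b) x"
    by (rule sw2_coassoc[OF coalgebra_D U _ x]) (assumption | rule lin)+
  also have "\<dots> = sw (\<lambda>a b. scl U (coun D b) (F a \<e>)) x"
    by (rule sw_cong[OF _ x], rule sw_conv(2)[OF U]) (assumption | rule lin)+
  also have "\<dots> = F x \<e>"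
    by (rule sw2_counit(2)[OF coalgebra_D U _ x]) (assumption | rule lin)+
  finally show ?thesis .
qed

text \<open>
  Since \<open>psi\<close> is the convolution inverse of the identity, \<open>g \<star> h \<otimes> 1\<close> equals
  \<open>\<Delta>(g' \<cdot> h') (1 \<otimes> psi h'' \<cdot> psi g'')\<close>.  This expresses \<open>\<star>\<close> through \<open>\<cdot>\<close>, and the
  bialgebra axioms for \<open>\<star>\<close> are deduced from it.
\<close>

lemma sw_mul_D:
  assumes U: "is_vspace U" and F: "bilinear_map D D U F" and g: "g \<in> carr D" and h: "h \<in> carr D"
  shows "sw (\<lambda>g1 g2. sw (\<lambda>h1 h2. sw (\<lambda>a b. F a (b \<cdot> (psi h2 \<cdot> psi g2))) (g1 \<cdot> h1)) h) g = F (g \<star> h) \<e>"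
proof -
  note [lin] = U bilinear_mapD[OF F] g h
  have "sw (\<lambda>g1 g2. sw (\<lambda>h1 h2. sw (\<lambda>a b. F a (b \<cdot> (psi h2 \<cdot> psi g2))) (g1 \<cdot> h1)) h) g =
    sw (\<lambda>g1 g2. sw (\<lambda>h1 h2. sw (\<lambda>a1 a2. sw (\<lambda>b1 b2.
      F (a1 \<star> b1) ((a2 \<cdot> b2) \<cdot> (psi h2 \<cdot> psi g2))) h1) g1) h) g"
    by (rule sw_cong, rule sw_cong, rule sw_mul_H[OF U]) (assumption | rule lin)+
  also have "\<dots> = sw (\<lambda>g1 g2. sw (\<lambda>a1 a2. sw (\<lambda>h1 h2. sw (\<lambda>b1 b2.
      F (a1 \<star> b1) ((a2 \<cdot> b2) \<cdot> (psi h2 \<cdot> psi g2))) h1) h) g1) g"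
    by (intro sw_cong[OF sw2_swap] g)
  also have "\<dots> = sw (\<lambda>g1 g2. sw (\<lambda>a1 a2. sw (\<lambda>h1 h2. sw (\<lambda>b1 b2.
      F (a1 \<star> b1) (a2 \<cdot> ((b2 \<cdot> psi h2) \<cdot> psi g2))) h1) h) g1) g"
    by (intro sw_cong g h) (simp_all add: H_assoc bilinear_mapD(3)[OF mul_H] linear_mapD(1)[OF psi])
  \<comment> \<open>The sum over \<open>h\<close> collapses first because
    \<open>b2 \<cdot> psi h2\<close> stands innermost; the same cancellation for \<open>g\<close>
    becomes available once the resulting unit is removed.\<close>
  also have "\<dots> = sw (\<lambda>g1 g2. sw (\<lambda>a1 a2. F (a1 \<star> h) (a2 \<cdot> (\<e> \<cdot> psi g2))) g1) g"
    by (rule sw_cong, rule sw_cong, rule sw_conv_right[OF U]) (assumption | rule lin)+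
  also have "\<dots> = sw (\<lambda>g1 g2. sw (\<lambda>a1 a2. F (a1 \<star> h) (a2 \<cdot> psi g2)) g1) g"
    by (intro sw_cong g h) (simp_all add: H_unit linear_mapD(1)[OF psi])
  also have "\<dots> = F (g \<star> h) \<e>"
    by (rule sw_conv_right[OF U]) (assumption | rule lin)+
  finally show ?thesis .
qed

text \<open>Twisted anti-multiplicativity of \<open>psi\<close>. The two products differ by a
  cocycle, and its inverse separates \<open>psi h \<cdot> psi g\<close> from
  \<open>psi (g \<star> h)\<close>. With the first leg kept, and \<open>\<star>\<close> exchanged
  for \<open>\<cdot>\<close> there, cocycle and inverse cancel.\<close>

lemma sw_psi_mul_D:
  assumes U: "is_vspace U" and f: "bilinear_map D D U f" and g: "g \<in> carr D" and h: "h \<in> carr D"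
  shows "sw (\<lambda>p q. f p (psi q)) (g \<star> h) =
    sw (\<lambda>g1 g2. sw (\<lambda>h1 h2. f (g1 \<cdot> h1) (psi h2 \<cdot> psi g2)) h) g"
proof -
  note [lin] = U bilinear_mapD[OF f] g h
  have "sw (\<lambda>p q. f p (psi q)) (g \<star> h) = sw (\<lambda>p q. f p (psi q \<cdot> \<e>)) (g \<star> h)"
    by (intro sw_cong lin) (simp add: H_unit linear_mapD(1)[OF psi])
  \<comment> \<open>\<open>sw_mul_D\<close> read backwards for the bilinear map that sends
    \<open>a\<close>, \<open>r\<close> to \<open>f a' (psi a'' \<cdot> r)\<close>.\<close>
  also have "\<dots> = sw (\<lambda>g1 g2. sw (\<lambda>h1 h2. sw (\<lambda>a b.
      sw (\<lambda>p q. f p (psi q \<cdot> (b \<cdot> (psi h2 \<cdot> psi g2)))) a) (g1 \<cdot> h1)) h) g"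
    by (rule sw_mul_D[symmetric, OF U]) (assumption | rule lin)+
  also have "\<dots> = sw (\<lambda>g1 g2. sw (\<lambda>h1 h2. sw (\<lambda>a b.
      sw (\<lambda>p q. f p ((psi q \<cdot> b) \<cdot> (psi h2 \<cdot> psi g2))) a) (g1 \<cdot> h1)) h) g"
    by (intro sw_cong lin; (assumption | simp_all add: H_assoc bilinear_mapD(3)[OF mul_H] linear_mapD(1)[OF psi]))
  also have "\<dots> = sw (\<lambda>g1 g2. sw (\<lambda>h1 h2. f (g1 \<cdot> h1) (\<e> \<cdot> (psi h2 \<cdot> psi g2))) h) g"
    by (rule sw_cong, rule sw_cong, rule sw_conv_left[OF U]) (assumption | rule lin)+
  also have "\<dots> = sw (\<lambda>g1 g2. sw (\<lambda>h1 h2. f (g1 \<cdot> h1) (psi h2 \<cdot> psi g2)) h) g"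
    by (intro sw_cong g h) (simp_all add: H_unit linear_mapD(1)[OF psi] bilinear_mapD(3)[OF mul_H])
  finally show ?thesis .
qed

text \<open>With a counit in the second slot, \<open>sw_mul_D\<close> expresses
  \<open>x \<star> y\<close> through \<open>x' \<cdot> y'\<close>, whose coproduct is known.
  Splitting off the first leg produces \<open>x1 \<star> y1\<close>, and what remains is again an
  instance of \<open>sw_mul_D\<close>, which returns \<open>x2 \<star> y2\<close>.\<close>

lemma sw_mul_D_multiplicative:
  assumes U: "is_vspace U" and f: "bilinear_map D D U f" and x: "x \<in> carr D" and y: "y \<in> carr D"
  shows "sw f (x \<star> y) = sw (\<lambda>x1 x2. sw (\<lambda>y1 y2. f (x1 \<star> y1) (x2 \<star> y2)) y) x"
proof -
  note [lin] = U bilinear_mapD[OF f] x y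
  let ?w = "\<lambda>y2 x2. psi y2 \<cdot> psi x2"
  have "sw f (x \<star> y) = scl U (coun D \<e>) (sw f (x \<star> y))"
    by (simp add: coun_unit is_vspaceD'[OF U])
  also have "\<dots> = sw (\<lambda>x1 x2. sw (\<lambda>y1 y2. sw (\<lambda>c b. scl U (coun D (b \<cdot> ?w y2 x2)) (sw f c)) (x1 \<cdot> y1)) y) x"
    by (rule sw_mul_D[symmetric, OF U]) (assumption | rule lin)+
  also have "\<dots> = sw (\<lambda>x1 x2. sw (\<lambda>y1 y2. sw (\<lambda>c b. sw (\<lambda>a1 a2.
      scl U (coun D (b \<cdot> ?w y2 x2)) (f a1 a2)) c) (x1 \<cdot> y1)) y) x"
    by (rule sw_cong, rule sw_cong, rule sw_cong, rule sw_hom[OF U]) (assumption | rule lin)+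
  also have "\<dots> = sw (\<lambda>x1 x2. sw (\<lambda>y1 y2. sw (\<lambda>a1 c. sw (\<lambda>a2 b.
      scl U (coun D (b \<cdot> ?w y2 x2)) (f a1 a2)) c) (x1 \<cdot> y1)) y) x"
    by (rule sw_cong, rule sw_cong, rule sw2_coassoc[OF coalgebra_D U]) (assumption | rule lin)+
  also have "\<dots> = sw (\<lambda>x1 x2. sw (\<lambda>y1 y2. sw (\<lambda>p q. sw (\<lambda>r s. sw (\<lambda>a2 b.
      scl U (coun D (b \<cdot> ?w y2 x2)) (f (p \<star> r) a2)) (q \<cdot> s)) y1) x1) y) x"
    by (rule sw_cong, rule sw_cong, rule sw_mul_H[OF U]) (assumption | rule lin)+
  also have "\<dots> = sw (\<lambda>x1 x2. sw (\<lambda>y1 y2. sw (\<lambda>p q. sw (\<lambda>r s. sw (\<lambda>a2 b.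
      scl U (coun D (b \<cdot> ?w s q)) (f (x1 \<star> y1) a2)) (p \<cdot> r)) y2) x2) y) x"
    by (rule sw2_coassoc2[OF coalgebra_D U]) (assumption | rule lin)+
  also have "\<dots> = sw (\<lambda>x1 x2. sw (\<lambda>y1 y2. scl U (coun D \<e>) (f (x1 \<star> y1) (x2 \<star> y2))) y) x"
    by (rule sw_cong, rule sw_cong, rule sw_mul_D[OF U]) (assumption | rule lin)+
  also have "\<dots> = sw (\<lambda>x1 x2. sw (\<lambda>y1 y2. f (x1 \<star> y1) (x2 \<star> y2)) y) x"
    by (simp add: coun_unit is_vspaceD'[OF U])
  finally show ?thesis .
qed

text \<open>With the counit in the first slot, \<open>sw_mul_D\<close> turns the counit of
  \<open>x \<star> y\<close> into \<open>x' \<cdot> y' \<cdot> psi y'' \<cdot> psi x''\<close>,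
  which telescopes to a multiple of the unit. Applying the counit once more strips that
  unit.\<close>

lemma coun_mul_D:
  assumes x: "x \<in> carr D" and y: "y \<in> carr D"
  shows "coun D (x \<star> y) = coun D x * coun D y"
proof -
  note [lin] = x y
  note V = coalgD(1)
  have "scl D (coun D (x \<star> y)) \<e> =
     sw (\<lambda>x1 x2. sw (\<lambda>y1 y2. sw (\<lambda>a b. scl D (coun D a) (b \<cdot> (psi y2 \<cdot> psi x2))) (x1 \<cdot> y1)) y) x"
    by (rule sw_mul_D[symmetric, OF V]) (assumption | rule lin)+
  also have "\<dots> = sw (\<lambda>x1 x2. sw (\<lambda>y1 y2. (x1 \<cdot> y1) \<cdot> (psi y2 \<cdot> psi x2)) y) x"
    by (rule sw_cong, rule sw_cong, rule sw2_counit[OF coalgebra_D V]) (assumption | rule lin)+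
  also have "\<dots> = sw (\<lambda>x1 x2. sw (\<lambda>y1 y2. x1 \<cdot> ((y1 \<cdot> psi y2) \<cdot> psi x2)) y) x"
    by (intro sw_cong lin; (assumption | simp_all add: H_assoc bilinear_mapD(3)[OF mul_H] linear_mapD(1)[OF psi]))
  also have "\<dots> = sw (\<lambda>x1 x2. scl D (coun D y) (x1 \<cdot> (\<e> \<cdot> psi x2))) x"
    by (rule sw_cong, rule sw_conv[OF V]) (assumption | rule lin)+
  also have "\<dots> = sw (\<lambda>x1 x2. scl D (coun D y) (x1 \<cdot> psi x2)) x"
    by (rule sw_cong[OF _ x]) (simp add: H_unit linear_mapD(1)[OF psi])
  also have "\<dots> = scl D (coun D x) (scl D (coun D y) \<e>)"
    by (rule sw_conv[OF V]) (assumption | rule lin)+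
  finally have "coun D (scl D (coun D (x \<star> y)) \<e>) = coun D (scl D (coun D x) (scl D (coun D y) \<e>))"
    by simp
  then show ?thesis
    using V by (simp add: linear_mapD[OF coalgD(3)] unit_mem coun_unit is_vspaceD)
qed

text \<open>Both bracketings unfold, by \<open>sw_psi_mul_D\<close>, to one expression in the
  products of the first legs and the reversed products of the \<open>psi\<close> legs. In that form
  only associativity of \<open>\<cdot>\<close> is involved.\<close>

lemma D_assoc:
  assumes x: "x \<in> carr D" and y: "y \<in> carr D" and z: "z \<in> carr D"
  shows "(x \<star> y) \<star> z = x \<star> (y \<star> z)"
proof -
  note V = coalgD(1)
  note [lin] = x y z
  \<comment> \<open>\<open>sw_mul_D\<close> followed by the counit on the second leg:
    \<open>u \<star> v\<close> becomes \<open>G\<close> evaluated at \<open>u' \<cdot> v'\<close>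
    and \<open>psi v'' \<cdot> psi u''\<close>.\<close>
  define G where "G p r = sw (\<lambda>a b. scl D (coun D (b \<cdot> r)) a) p" for p r
  have "bilinear_map D D D G"
    unfolding G_def by (assumption | rule lin)+
  note [lin] = bilinear_mapD[OF this]
  have G: "u \<star> v = sw (\<lambda>u1 u2. sw (\<lambda>v1 v2. G (u1 \<cdot> v1) (psi v2 \<cdot> psi u2)) v) u"
    if uv: "u \<in> carr D" "v \<in> carr D" for u v
  proof -
    have "scl D (coun D \<e>) (u \<star> v) = sw (\<lambda>u1 u2. sw (\<lambda>v1 v2. G (u1 \<cdot> v1) (psi v2 \<cdot> psi u2)) v) u"
      unfolding G_def by (rule sw_mul_D[symmetric, OF V]) (assumption | rule lin uv)+
    then show ?thesis by (simp add: coun_unit is_vspaceD'[OF V])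
  qed
  have "(x \<star> y) \<star> z = sw (\<lambda>p q. sw (\<lambda>z1 z2. G (p \<cdot> z1) (psi z2 \<cdot> psi q)) z) (x \<star> y)"
    by (rule G) (assumption | rule lin)+
  also have "\<dots> = sw (\<lambda>x1 x2. sw (\<lambda>y1 y2. sw (\<lambda>z1 z2.
      G ((x1 \<cdot> y1) \<cdot> z1) (psi z2 \<cdot> (psi y2 \<cdot> psi x2))) z) y) x"
    by (rule sw_psi_mul_D[OF V]) (assumption | rule lin)+
  also have "\<dots> = sw (\<lambda>x1 x2. sw (\<lambda>y1 y2. sw (\<lambda>z1 z2.
      G (x1 \<cdot> (y1 \<cdot> z1)) ((psi z2 \<cdot> psi y2) \<cdot> psi x2)) z) y) x"
    by (intro sw_cong lin; (assumption | simp_all add: H_assoc bilinear_mapD(3)[OF mul_H] linear_mapD(1)[OF psi]))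
  also have "\<dots> = sw (\<lambda>x1 x2. sw (\<lambda>p q. G (x1 \<cdot> p) (psi q \<cdot> psi x2)) (y \<star> z)) x"
    by (rule sw_cong, rule sw_psi_mul_D[symmetric, OF V]) (assumption | rule lin)+
  also have "\<dots> = x \<star> (y \<star> z)"
    by (rule G[symmetric]) (assumption | rule lin)+
  finally show ?thesis .
qed

text \<open>Expand \<open>x\<close> by the counit, write it as a \<open>\<cdot>\<close>-product with
  the unit, and use the multiplicativity of the coaction: the first leg acquires a
  \<open>\<star>\<close>-product with the unit, and the second leg is absorbed by the
  counit.\<close>

lemma D_unit:
  assumes x: "x \<in> carr D"
  shows "\<e> \<star> x = x" "x \<star> \<e> = x"
proof -
  note V = coalgD(1)
  note [lin] = x
  have "x = sw (\<lambda>a b. scl D (coun D b) a) (\<e> \<cdot> x)"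
    by (subst sw2_counit(2)[OF coalgebra_D V lin_id]) (simp_all add: H_unit x)
  also have "\<dots> = sw (\<lambda>e1 e2. sw (\<lambda>x1 x2. scl D (coun D (e2 \<cdot> x2)) (e1 \<star> x1)) x) \<e>"
    by (rule sw_mul_H[OF V]) (assumption | rule lin)+
  also have "\<dots> = sw (\<lambda>x1 x2. scl D (coun D (\<e> \<cdot> x2)) (\<e> \<star> x1)) x"
    by (rule sw_unit[OF V]) (assumption | rule lin)+
  also have "\<dots> = sw (\<lambda>x1 x2. scl D (coun D x2) (\<e> \<star> x1)) x"
    by (rule sw_cong[OF _ x]) (simp add: H_unit)
  also have "\<dots> = \<e> \<star> x"
    by (rule sw2_counit(2)[OF coalgebra_D V]) (assumption | rule lin)+
  finally show "\<e> \<star> x = x" by simp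
  have "x = sw (\<lambda>a b. scl D (coun D b) a) (x \<cdot> \<e>)"
    by (subst sw2_counit(2)[OF coalgebra_D V lin_id]) (simp_all add: H_unit x)
  also have "\<dots> = sw (\<lambda>x1 x2. sw (\<lambda>e1 e2. scl D (coun D (x2 \<cdot> e2)) (x1 \<star> e1)) \<e>) x"
    by (rule sw_mul_H[OF V]) (assumption | rule lin)+
  also have "\<dots> = sw (\<lambda>x1 x2. scl D (coun D (x2 \<cdot> \<e>)) (x1 \<star> \<e>)) x"
    by (rule sw_cong, rule sw_unit[OF V]) (assumption | rule lin)+
  also have "\<dots> = sw (\<lambda>x1 x2. scl D (coun D x2) (x1 \<star> \<e>)) x"
    by (rule sw_cong[OF _ x]) (simp add: H_unit)
  also have "\<dots> = x \<star> \<e>"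
    by (rule sw2_counit(2)[OF coalgebra_D V]) (assumption | rule lin)+
  finally show "x \<star> \<e> = x" by simp
qed

lemma bialgebra_D: "bialgebra D"
proof -
  have t: "carr (talg D D) = carr (tens D D)" "scl (talg D D) = scl (tens D D)"
    by (simp_all add: talg_def tens_def)
  have "algebra D"
    unfolding algebra_def using coalgD(1) mul_D unit_mem D_assoc D_unit by auto
  moreover have "alg_hom D (talg D D) (cop D)"
    unfolding alg_hom_def
  proof (intro conjI ballI)
    show "linear_map D (talg D D) (cop D)"
      using coalgD(2) by (simp add: linear_map_def t)
    show "cop D \<e> = unit (talg D D)" by (simp add: talg_def cop_unit)
    fix x y assume xy: "x \<in> carr D" "y \<in> carr D"
    have "cop D (x \<star> y) = sw (\<lambda>x1 x2. sw (\<lambda>y1 y2. ptens D D (x1 \<star> y1) (x2 \<star> y2)) y) x"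
      using sw_mul_D_multiplicative[OF is_vspace_tens ptens_bilinear xy]
        sw2_ptens[OF coalgebra_D, of "x \<star> y"] xy bilinear_mapD(3)[OF mul_D] by simp
    then show "cop D (x \<star> y) = mul (talg D D) (cop D x) (cop D y)"
      by (simp add: talg_def sw2_def)
  qed
  moreover have "alg_hom D scalar_alg (coun D)"
    using coalgD(3) by (simp add: alg_hom_def scalar_alg_def linear_map_def coun_unit coun_mul_D)
  ultimately show ?thesis
    using coalgebra_D by (simp add: bialgebra_def)
qed

section \<open>The Miyashita--Ulbrich action\<close>

definition act :: "'t \<Rightarrow> 't \<Rightarrow> 't" where
  "act h x = sw (\<lambda>p q. (p \<cdot> x) \<cdot> psi q) h"

lemma bilinear_act: "bilinear_map D D D act"
  unfolding act_def by (assumption | rule lin)+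

lemmas [lin] = bilinear_mapD[OF bilinear_act]

lemma psi_unit: "psi \<e> = \<e>"
proof -
  have "sw (\<lambda>a b. a \<cdot> psi b) \<e> = \<e> \<cdot> psi \<e>"
    by (rule sw_unit[OF coalgD(1)]) (assumption | rule lin)+
  then show ?thesis
    using conv_right[OF unit_mem] coalgD(1)
    by (simp add: coun_unit H_unit is_vspaceD' linear_mapD(1)[OF psi] unit_mem)
qed

lemma act_unit_left:
  assumes "x \<in> carr D"
  shows "act \<e> x = x"
proof -
  note [lin] = assms
  have "act \<e> x = (\<e> \<cdot> x) \<cdot> psi \<e>"
    unfolding act_def by (rule sw_unit[OF coalgD(1)]) (assumption | rule lin)+
  then show ?thesis by (simp add: psi_unit H_unit assms)
qed

lemma act_unit_right:
  assumes "h \<in> carr D"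
  shows "act h \<e> = scl D (coun D h) \<e>"
  unfolding act_def conv_right[OF assms, symmetric] by (rule sw_cong[OF _ assms]) (simp add: H_unit)

text \<open>An instance of \<open>sw_psi_mul_D\<close>, with \<open>f\<close> multiplying its two
  arguments around \<open>x\<close>.\<close>

lemma act_mul_D:
  assumes g: "g \<in> carr D" and h: "h \<in> carr D" and x: "x \<in> carr D"
  shows "act (g \<star> h) x = act g (act h x)"
proof -
  note V = coalgD(1)
  note [lin] = g h x
  have "act (g \<star> h) x = sw (\<lambda>g1 g2. sw (\<lambda>h1 h2. ((g1 \<cdot> h1) \<cdot> x) \<cdot> (psi h2 \<cdot> psi g2)) h) g"
    unfolding act_def by (rule sw_psi_mul_D[OF V]) (assumption | rule lin)+
  also have "\<dots> = sw (\<lambda>g1 g2. sw (\<lambda>h1 h2. (g1 \<cdot> ((h1 \<cdot> x) \<cdot> psi h2)) \<cdot> psi g2) h) g"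
    by (intro sw_cong lin; (assumption | simp_all add: H_assoc bilinear_mapD(3)[OF mul_H] linear_mapD(1)[OF psi] x))
  also have "\<dots> = sw (\<lambda>g1 g2. (g1 \<cdot> act h x) \<cdot> psi g2) g"
    unfolding act_def
    by (rule sw_cong, rule sw_hom[OF V, symmetric, where g = "\<lambda>z. (_ \<cdot> z) \<cdot> psi _"]) (assumption | rule lin)+
  finally show ?thesis by (simp add: act_def[of g])
qed

text \<open>In the product of the two acted elements the factors \<open>psi b \<cdot> c\<close>
  built from adjacent legs of \<open>h\<close> meet in the middle and cancel.\<close>

lemma act_mul_H:
  assumes h: "h \<in> carr D" and x: "x \<in> carr D" and y: "y \<in> carr D"
  shows "act h (x \<cdot> y) = sw (\<lambda>h1 h2. act h1 x \<cdot> act h2 y) h"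
proof -
  note V = coalgD(1)
  note [lin] = h x y
  have "sw (\<lambda>h1 h2. act h1 x \<cdot> act h2 y) h =
    sw (\<lambda>h1 h2. sw (\<lambda>a b. ((a \<cdot> x) \<cdot> psi b) \<cdot> act h2 y) h1) h"
    unfolding act_def
    by (rule sw_cong, rule sw_hom[OF V, where g = "\<lambda>z. z \<cdot> _"]) (assumption | rule lin)+
  also have "\<dots> = sw (\<lambda>a k. sw (\<lambda>b h2. ((a \<cdot> x) \<cdot> psi b) \<cdot> act h2 y) k) h"
    by (rule sw2_coassoc[OF coalgebra_D V]) (assumption | rule lin)+
  also have "\<dots> = sw (\<lambda>a k. sw (\<lambda>b h2. sw (\<lambda>c d. ((a \<cdot> x) \<cdot> psi b) \<cdot> ((c \<cdot> y) \<cdot> psi d)) h2) k) h"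
    unfolding act_def
    by (rule sw_cong, rule sw_cong, rule sw_hom[OF V]) (assumption | rule lin)+
  also have "\<dots> = sw (\<lambda>a k. sw (\<lambda>b h2. sw (\<lambda>c d. (a \<cdot> x) \<cdot> ((psi b \<cdot> c) \<cdot> (y \<cdot> psi d))) h2) k) h"
    by (intro sw_cong lin; (assumption | simp_all add: H_assoc bilinear_mapD(3)[OF mul_H] linear_mapD(1)[OF psi] x y))
  also have "\<dots> = sw (\<lambda>a k. sw (\<lambda>j d. sw (\<lambda>b c. (a \<cdot> x) \<cdot> ((psi b \<cdot> c) \<cdot> (y \<cdot> psi d))) j) k) h"
    by (rule sw_cong, rule sw2_coassoc[OF coalgebra_D V, symmetric]) (assumption | rule lin)+
  also have "\<dots> = sw (\<lambda>a k. sw (\<lambda>j d. scl D (coun D j) ((a \<cdot> x) \<cdot> (\<e> \<cdot> (y \<cdot> psi d)))) k) h"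
    by (rule sw_cong, rule sw_cong, rule sw_conv(2)[OF V]) (assumption | rule lin)+
  also have "\<dots> = sw (\<lambda>a k. (a \<cdot> x) \<cdot> (\<e> \<cdot> (y \<cdot> psi k))) h"
    by (rule sw_cong, rule sw2_counit(1)[OF coalgebra_D V]) (assumption | rule lin)+
  also have "\<dots> = act h (x \<cdot> y)"
    unfolding act_def
    by (intro sw_cong lin; (assumption | simp_all add: H_assoc H_unit bilinear_mapD(3)[OF mul_H] linear_mapD(1)[OF psi] x y))
  finally show ?thesis by simp
qed

text \<open>In a Hopf algebra this is the colinearity
  \<open>psi(h)' \<otimes> psi(h)'' = S(h'') \<otimes> psi(h')\<close> multiplied by a further leg
  of \<open>h\<close>, a form that avoids the antipode.\<close>

lemma sw_psi_cancel:
  assumes U: "is_vspace U" and f: "bilinear_map D D U f" and h: "h \<in> carr D"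
  shows "sw (\<lambda>h1 h2. sw (\<lambda>z1 z2. f (z1 \<star> h2) z2) (psi h1)) h = f \<e> (psi h)"
proof -
  note [lin] = U bilinear_mapD[OF f] h
  have "sw (\<lambda>h1 h2. sw (\<lambda>z1 z2. f (z1 \<star> h2) z2) (psi h1)) h =
    sw (\<lambda>h1 h2. sw (\<lambda>z1 z2. f (z1 \<star> h2) (z2 \<cdot> \<e>)) (psi h1)) h"
    by (intro sw_cong lin; (assumption | simp_all add: H_unit))
  \<comment> \<open>A cancelling pair \<open>r \<cdot> psi s\<close> is inserted, so that the
    coproducts of \<open>psi h1\<close> and of the next leg combine into that of
    \<open>psi h1 \<cdot> k\<close>, which the convolution identity makes trivial.\<close>
  also have "\<dots> = sw (\<lambda>h1 h2. sw (\<lambda>z1 z2. sw (\<lambda>k s. sw (\<lambda>c r. f (z1 \<star> c) (z2 \<cdot> (r \<cdot> psi s))) k) h2) (psi h1)) h"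
    by (rule sw_cong, rule sw_cong, rule sw_conv_right[OF U, symmetric]) (assumption | rule lin)+
  also have "\<dots> = sw (\<lambda>h1 h2. sw (\<lambda>k s. sw (\<lambda>z1 z2. sw (\<lambda>c r. f (z1 \<star> c) (z2 \<cdot> (r \<cdot> psi s))) k) (psi h1)) h2) h"
    by (rule sw_cong[OF sw2_swap h])
  also have "\<dots> = sw (\<lambda>h1 h2. sw (\<lambda>k s. sw (\<lambda>z1 z2. sw (\<lambda>c r. f (z1 \<star> c) ((z2 \<cdot> r) \<cdot> psi s)) k) (psi h1)) h2) h"
    by (intro sw_cong lin; (assumption | simp_all add: H_assoc bilinear_mapD(3)[OF mul_H] linear_mapD(1)[OF psi]))
  also have "\<dots> = sw (\<lambda>h1 h2. sw (\<lambda>k s. sw (\<lambda>u v. f u (v \<cdot> psi s)) (psi h1 \<cdot> k)) h2) h"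
    by (rule sw_cong, rule sw_cong, rule sw_mul_H[OF U, symmetric]) (assumption | rule lin)+
  also have "\<dots> = sw (\<lambda>j s. sw (\<lambda>h1 k. sw (\<lambda>u v. f u (v \<cdot> psi s)) (psi h1 \<cdot> k)) j) h"
    by (rule sw2_coassoc[OF coalgebra_D U, symmetric]) (assumption | rule lin)+
  also have "\<dots> = sw (\<lambda>j s. scl U (coun D j) (sw (\<lambda>u v. f u (v \<cdot> psi s)) \<e>)) h"
    by (rule sw_cong, rule sw_conv(2)[OF U]) (assumption | rule lin)+
  also have "\<dots> = sw (\<lambda>u v. f u (v \<cdot> psi h)) \<e>"
    by (rule sw2_counit(1)[OF coalgebra_D U]) (assumption | rule lin)+
  also have "\<dots> = f \<e> (\<e> \<cdot> psi h)"
    by (rule sw_unit[OF U]) (assumption | rule lin)+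
  finally show ?thesis by (simp add: H_unit linear_mapD(1)[OF psi h])
qed

text \<open>The coaction on \<open>h' \<cdot> x \<cdot> psi h''\<close> is multiplicative. After
  right multiplication by the last leg of \<open>h\<close>, \<open>sw_psi_cancel\<close> removes
  both that leg and the coaction on \<open>psi\<close>, leaving \<open>h' \<star> x'\<close> beside
  the acted element.\<close>

lemma yetter_drinfeld:
  assumes U: "is_vspace U" and f: "bilinear_map D D U f" and h: "h \<in> carr D" and x: "x \<in> carr D"
  shows "sw (\<lambda>h1 h2. sw (\<lambda>u v. f (u \<star> h2) v) (act h1 x)) h =
    sw (\<lambda>h1 h2. sw (\<lambda>x1 x2. f (h1 \<star> x1) (act h2 x2)) x) h"
proof -
  note [lin] = U bilinear_mapD[OF f] h x
  \<comment> \<open>The final rebracketing uses associativity of \<open>\<star>\<close> and places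
    \<open>z1\<close>, from the coproduct of \<open>psi q\<close>, next to \<open>k\<close>, as
    \<open>sw_psi_cancel\<close> requires.\<close>
  have sw_act: "sw (\<lambda>u v. f (u \<star> k) v) (act j x) =
      sw (\<lambda>p q. sw (\<lambda>a b. sw (\<lambda>x1 x2. sw (\<lambda>z1 z2.
        f ((a \<star> x1) \<star> (z1 \<star> k)) ((b \<cdot> x2) \<cdot> z2)) (psi q)) x) p) j"
    if j: "j \<in> carr D" and k: "k \<in> carr D" for j k
  proof -
    note [lin] = j k
    have "sw (\<lambda>u v. f (u \<star> k) v) (act j x) = sw (\<lambda>p q. sw (\<lambda>u v. f (u \<star> k) v) ((p \<cdot> x) \<cdot> psi q)) j"
      unfolding act_def by (rule sw_hom[OF coalgD(1)]) (assumption | rule lin)+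
    also have "\<dots> = sw (\<lambda>p q. sw (\<lambda>u v. sw (\<lambda>z1 z2. f ((u \<star> z1) \<star> k) (v \<cdot> z2)) (psi q)) (p \<cdot> x)) j"
      by (rule sw_cong, rule sw_mul_H[OF U]) (assumption | rule lin)+
    also have "\<dots> = sw (\<lambda>p q. sw (\<lambda>a b. sw (\<lambda>x1 x2. sw (\<lambda>z1 z2.
        f (((a \<star> x1) \<star> z1) \<star> k) ((b \<cdot> x2) \<cdot> z2)) (psi q)) x) p) j"
      by (rule sw_cong, rule sw_mul_H[OF U]) (assumption | rule lin)+
    also have "\<dots> = sw (\<lambda>p q. sw (\<lambda>a b. sw (\<lambda>x1 x2. sw (\<lambda>z1 z2.
        f ((a \<star> x1) \<star> (z1 \<star> k)) ((b \<cdot> x2) \<cdot> z2)) (psi q)) x) p) j"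
      by (intro sw_cong lin; (assumption | simp_all add: D_assoc bilinear_mapD(3)[OF mul_D] k))
    finally show ?thesis .
  qed
  have "sw (\<lambda>h1 h2. sw (\<lambda>u v. f (u \<star> h2) v) (act h1 x)) h =
    sw (\<lambda>h1 h2. sw (\<lambda>p q. sw (\<lambda>a b. sw (\<lambda>x1 x2. sw (\<lambda>z1 z2.
        f ((a \<star> x1) \<star> (z1 \<star> h2)) ((b \<cdot> x2) \<cdot> z2)) (psi q)) x) p) h1) h"
    by (rule sw_cong[OF sw_act h])
  also have "\<dots> = sw (\<lambda>p k. sw (\<lambda>q h2. sw (\<lambda>a b. sw (\<lambda>x1 x2. sw (\<lambda>z1 z2.
        f ((a \<star> x1) \<star> (z1 \<star> h2)) ((b \<cdot> x2) \<cdot> z2)) (psi q)) x) p) k) h"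
    by (rule sw2_coassoc[OF coalgebra_D U]) (assumption | rule lin)+
  also have "\<dots> = sw (\<lambda>p k. sw (\<lambda>a b. sw (\<lambda>q h2. sw (\<lambda>x1 x2. sw (\<lambda>z1 z2.
        f ((a \<star> x1) \<star> (z1 \<star> h2)) ((b \<cdot> x2) \<cdot> z2)) (psi q)) x) k) p) h"
    by (rule sw_cong[OF sw2_swap h])
  also have "\<dots> = sw (\<lambda>p k. sw (\<lambda>a b. sw (\<lambda>x1 x2. sw (\<lambda>q h2. sw (\<lambda>z1 z2.
        f ((a \<star> x1) \<star> (z1 \<star> h2)) ((b \<cdot> x2) \<cdot> z2)) (psi q)) k) x) p) h"
    by (rule sw_cong[OF sw_cong[OF sw2_swap] h])
  also have "\<dots> = sw (\<lambda>p k. sw (\<lambda>a b. sw (\<lambda>x1 x2. f ((a \<star> x1) \<star> \<e>) ((b \<cdot> x2) \<cdot> psi k)) x) p) h"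
    by (rule sw_cong, rule sw_cong, rule sw_cong, rule sw_psi_cancel[OF U]) (assumption | rule lin)+
  also have "\<dots> = sw (\<lambda>p k. sw (\<lambda>a b. sw (\<lambda>x1 x2. f (a \<star> x1) ((b \<cdot> x2) \<cdot> psi k)) x) p) h"
    by (intro sw_cong lin; (assumption | simp_all add: D_unit bilinear_mapD(3)[OF mul_D]))
  also have "\<dots> = sw (\<lambda>a j. sw (\<lambda>b k. sw (\<lambda>x1 x2. f (a \<star> x1) ((b \<cdot> x2) \<cdot> psi k)) x) j) h"
    by (rule sw2_coassoc[OF coalgebra_D U]) (assumption | rule lin)+
  also have "\<dots> = sw (\<lambda>a j. sw (\<lambda>x1 x2. sw (\<lambda>b k. f (a \<star> x1) ((b \<cdot> x2) \<cdot> psi k)) j) x) h"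
    by (rule sw_cong[OF sw2_swap h])
  also have "\<dots> = sw (\<lambda>a j. sw (\<lambda>x1 x2. f (a \<star> x1) (act j x2)) x) h"
    unfolding act_def
    by (rule sw_cong, rule sw_cong, rule sw_hom[OF coalgD(1), symmetric]) (assumption | rule lin)+
  finally show ?thesis .
qed

text \<open>The locale does not constrain the antipode field of \<open>D\<close>, so the Hopf
  property comes in as a hypothesis; everything else in the conclusion is assembled from the lemmas
  above.\<close>

lemma yd_module_algebra_act:
  assumes "hopf_algebra D"
  shows "yd_module_algebra D H act (cop D)"
proof -
  have tH: "ptens X H = ptens X D" "tens X H = tens X D" "tlift X H = tlift X D"
    for X :: "('k, 'x::ab_group_add, 'y) vsp_scheme"
    using tens_cong[of X X H D] by (auto simp: carr_H scl_H)
  have tH2: "tlift D H = tlift D D"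
    using tens_cong(4)[of D D H D] by (simp add: carr_H scl_H)
  have V: "is_vspace H"
    using coalgD(1) by (simp add: is_vspace_def carr_H scl_H)
  have t: "carr (talg D H) = carr (tens D D)" "scl (talg D H) = scl (tens D D)"
    by (simp_all add: talg_def tH)
  have lH: "linear_map H = linear_map D" "linear_map H' H = linear_map H' D" for H'
    by (simp_all add: linear_map_def fun_eq_iff carr_H scl_H)
  have "left_module_algebra D H act"
    unfolding left_module_algebra_def left_module_def
    using algebra_H V bilinear_act act_mul_D act_unit_left act_mul_H act_unit_right
    by (auto simp: carr_H scl_H unit_H bilinear_map_def linear_map_def)
  moreover have "left_comodule_algebra D H (cop D)"
    unfolding left_comodule_algebra_def left_comodule_def alg_hom_def
  proof (intro conjI ballI)
    fix x assume "x \<in> carr H"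
    then have x: "x \<in> carr D" by (simp add: carr_H)
    show "tassoc D D H (tmap D H (tens D D) H (cop D) id (cop D x)) =
        tmap D H D (tens D H) id (cop D) (cop D x)"
      using coalgebra_D x by (simp add: tassoc_def tmap_def tH coalgebra_def)
    show "tlift D H (\<lambda>h y. scl H (coun D h) y) (cop D x) = x"
      using coalgebra_D x by (simp add: tH scl_H coalgebra_def)
  next
    fix x y assume "x \<in> carr H" "y \<in> carr H"
    then have xy: "x \<in> carr D" "y \<in> carr D" by (simp_all add: carr_H)
    show "cop D (x \<cdot> y) = mul (talg D H) (cop D x) (cop D y)"
      using cop_mul_H[OF xy] by (simp add: talg_def tH sw2_def)
  qed (use algebra_H V coalgD(2) in \<open>simp_all add: lH tH unit_H cop_unit talg_def linear_map_def\<close>)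
  moreover have "sw (\<lambda>h1 h2. tlift D H (\<lambda>u y. ptens D H (mul D u h2) y) (cop D (act h1 x))) h =
        sw (\<lambda>h1 h2. tlift D H (\<lambda>u y. ptens D H (mul D h1 u) (act h2 y)) (cop D x)) h"
    if "h \<in> carr D" "x \<in> carr H" for h x
    using yetter_drinfeld[OF is_vspace_tens ptens_bilinear that(1), of x] that(2)
    by (simp add: tH carr_H sw2_def)
  ultimately show ?thesis
    using assms by (simp add: yd_module_algebra_def)
qed

end


section \<open>Hopf algebras with bijective antipode\<close>

locale hopf_bij =
  fixes B :: "('k::field, 'b::ab_group_add) hopf"
  assumes hopf: "hopf_algebra B" and bij: "bij_betw (antip B) (carr B) (carr B)"
begin

abbreviation B_mul (infixl "\<cdot>" 70) where "x \<cdot> y \<equiv> mul B x y"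
abbreviation "\<e> \<equiv> unit B"
abbreviation "\<epsilon> \<equiv> coun B"
abbreviation "S \<equiv> antip B"
abbreviation "T \<equiv> antip_inv B"

lemma algebra_B: "algebra B" and coalgebra_B: "coalgebra B" and antip_linear: "linear_map B B S"
  using hopf by (auto simp: hopf_algebra_def bialgebra_def)

lemmas coalgB = coalgebraD[OF coalgebra_B]

lemma mul_B: "bilinear_map B B B (mul B)"
  using algebra_B by (simp add: algebra_def)

lemma unit_mem: "\<e> \<in> carr B"
  using algebra_B by (simp add: algebra_def)

lemma B_assoc: "x \<in> carr B \<Longrightarrow> y \<in> carr B \<Longrightarrow> z \<in> carr B \<Longrightarrow> (x \<cdot> y) \<cdot> z = x \<cdot> (y \<cdot> z)"
  using algebra_B by (simp add: algebra_def)

lemma B_unit: "x \<in> carr B \<Longrightarrow> \<e> \<cdot> x = x" "x \<in> carr B \<Longrightarrow> x \<cdot> \<e> = x"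
  using algebra_B by (simp_all add: algebra_def)

lemma cop_unit: "cop B \<e> = ptens B B \<e> \<e>"
  using hopf by (simp add: hopf_algebra_def bialgebra_def alg_hom_def talg_def)

lemma coun_unit: "\<epsilon> \<e> = 1"
  using hopf by (simp add: hopf_algebra_def bialgebra_def alg_hom_def scalar_alg_def)

lemma coun_mul: "x \<in> carr B \<Longrightarrow> y \<in> carr B \<Longrightarrow> \<epsilon> (x \<cdot> y) = \<epsilon> x * \<epsilon> y"
  using hopf by (simp add: hopf_algebra_def bialgebra_def alg_hom_def scalar_alg_def)

lemma antip_inv_mem: "x \<in> carr B \<Longrightarrow> T x \<in> carr B"
  and antip_antip_inv: "x \<in> carr B \<Longrightarrow> S (T x) = x"
  and antip_inv_antip: "x \<in> carr B \<Longrightarrow> T (S x) = x"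
  using bij by (auto simp: antip_inv_def bij_betw_def inv_into_into f_inv_into_f)

lemma antip_inj: "x \<in> carr B \<Longrightarrow> y \<in> carr B \<Longrightarrow> S x = S y \<Longrightarrow> x = y"
  using bij by (auto simp: bij_betw_def inj_on_def)

lemma antip_inv_linear: "linear_map B B T"
  unfolding linear_map_def
proof (intro conjI ballI allI)
  fix x y c assume x: "x \<in> carr B" and y: "y \<in> carr B"
  note m = antip_inv_mem is_vspaceD(2,3)[OF coalgB(1)]
  show "T (x + y) = T x + T y"
    by (rule antip_inj) (simp_all add: m x y antip_antip_inv linear_mapD[OF antip_linear])
  show "T (scl B c x) = scl B c (T x)"
    by (rule antip_inj) (simp_all add: m x y antip_antip_inv linear_mapD[OF antip_linear])
qed (simp_all add: antip_inv_mem)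

lemmas [lin] = coalgebra_B coalgB(1) unit_mem bilinear_mapD[OF mul_B]
  linear_map_compose[OF coalgB(3)] linear_map_compose[OF antip_linear]
  linear_map_compose[OF antip_inv_linear] linear_mapD(1)[OF antip_linear] antip_inv_mem

lemmas B_mem = bilinear_mapD(3)[OF mul_B] linear_mapD(1)[OF antip_linear] antip_inv_mem unit_mem

lemma sw_cong:
  "\<lbrakk>\<And>x y. x \<in> carr B \<Longrightarrow> y \<in> carr B \<Longrightarrow> f x y = g x y; c \<in> carr B\<rbrakk> \<Longrightarrow> sw2 B f c = sw2 B g c"
  by (rule sw2_cong[OF coalgebra_B])

lemma sw_hom:
  "\<lbrakk>is_vspace U; linear_map U X g; \<And>x y. x \<in> carr B \<Longrightarrow> y \<in> carr B \<Longrightarrow> f x y \<in> carr U; c \<in> carr B\<rbrakk>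
    \<Longrightarrow> g (sw2 B f c) = sw2 B (\<lambda>x y. g (f x y)) c"
  by (rule sw2_hom[OF coalgebra_B])

lemma sw_unit:
  assumes "is_vspace U" "bilinear_map B B U f"
  shows "sw2 B f \<e> = f \<e> \<e>"
  unfolding sw2_def cop_unit by (rule tlift_ptens[OF assms unit_mem unit_mem])

lemma sw_mul:
  assumes U: "is_vspace U" and f: "bilinear_map B B U f" and x: "x \<in> carr B" and y: "y \<in> carr B"
  shows "sw2 B f (x \<cdot> y) = sw2 B (\<lambda>x1 x2. sw2 B (\<lambda>y1 y2. f (x1 \<cdot> y1) (x2 \<cdot> y2)) y) x"
proof -
  have "cop B (x \<cdot> y) = sw2 B (\<lambda>x1 x2. sw2 B (\<lambda>y1 y2. ptens B B (x1 \<cdot> y1) (x2 \<cdot> y2)) y) x"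
    using hopf x y by (simp add: hopf_algebra_def bialgebra_def alg_hom_def talg_def sw2_def)
  then show ?thesis
    unfolding sw2_def[of B f]
    by (simp only:) (rule tlift_sw2_sw2[OF coalgebra_B coalgebra_B U coalgB(1) f x y],
      auto intro: bilinear_mapD(3)[OF mul_B])
qed

lemma sw_antip:
  assumes U: "is_vspace U" and L: "linear_map B U L" and x: "x \<in> carr B"
  shows "sw2 B (\<lambda>a b. L (a \<cdot> S b)) x = scl U (\<epsilon> x) (L \<e>)"
    and "sw2 B (\<lambda>a b. L (S a \<cdot> b)) x = scl U (\<epsilon> x) (L \<e>)"
proof -
  have eq: "sw2 B (\<lambda>a b. a \<cdot> S b) x = scl B (\<epsilon> x) \<e>" "sw2 B (\<lambda>a b. S a \<cdot> b) x = scl B (\<epsilon> x) \<e>"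
    using hopf x by (simp_all add: hopf_algebra_def sw2_def)
  have "L (sw2 B (\<lambda>a b. a \<cdot> S b) x) = sw2 B (\<lambda>a b. L (a \<cdot> S b)) x"
    by (rule sw_hom[OF coalgB(1) L _ x]) (assumption | rule lin)+
  then show "sw2 B (\<lambda>a b. L (a \<cdot> S b)) x = scl U (\<epsilon> x) (L \<e>)"
    by (simp add: eq linear_mapD(3)[OF L] unit_mem)
  have "L (sw2 B (\<lambda>a b. S a \<cdot> b) x) = sw2 B (\<lambda>a b. L (S a \<cdot> b)) x"
    by (rule sw_hom[OF coalgB(1) L _ x]) (assumption | rule lin)+
  then show "sw2 B (\<lambda>a b. L (S a \<cdot> b)) x = scl U (\<epsilon> x) (L \<e>)"
    by (simp add: eq linear_mapD(3)[OF L] unit_mem)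
qed

section \<open>The antipode of \<open>B\<close> and its inverse\<close>

lemma antip_unit: "S \<e> = \<e>"
proof -
  have "sw2 B (\<lambda>a b. S a \<cdot> b) \<e> = S \<e> \<cdot> \<e>"
    by (rule sw_unit[OF coalgB(1)]) (assumption | rule lin)+
  then show ?thesis
    using sw_antip(2)[OF coalgB(1) lin_id unit_mem] coalgB(1)
    by (simp add: coun_unit B_unit is_vspaceD' B_mem)
qed

lemma antip_inv_unit: "T \<e> = \<e>"
  using antip_inv_antip[OF unit_mem] by (simp add: antip_unit)

text \<open>Both sides are convolution inverses of the multiplication of \<open>B\<close>, viewed on
  pairs. The chain runs from the left inverse to the right inverse through their product with the
  multiplication in between.\<close>

lemma antip_mul:
  assumes x: "x \<in> carr B" and y: "y \<in> carr B"
  shows "S (x \<cdot> y) = S y \<cdot> S x"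
proof -
  note V = coalgB(1)
  note [lin] = x y
  note cc = sw2_counit[OF coalgebra_B V]
  have "S y \<cdot> S x = sw2 B (\<lambda>x1 x2. scl B (\<epsilon> x2) (S y \<cdot> S x1)) x"
    by (rule cc(2)[symmetric]) (assumption | rule lin)+
  also have "\<dots> = sw2 B (\<lambda>x1 x2. sw2 B (\<lambda>y1 y2. scl B (\<epsilon> y2) (scl B (\<epsilon> x2) (S y1 \<cdot> S x1))) y) x"
    by (rule sw_cong, rule cc(2)[symmetric]) (assumption | rule lin)+
  also have "\<dots> = sw2 B (\<lambda>x1 x2. sw2 B (\<lambda>y1 y2. scl B (\<epsilon> (x2 \<cdot> y2)) ((S y1 \<cdot> S x1) \<cdot> \<e>)) y) x"
    by (intro sw_cong x y) (simp_all add: coun_mul is_vspaceD'(2)[OF V, symmetric] mult.commute B_unit B_mem)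
  \<comment> \<open>The counit of \<open>x2 \<cdot> y2\<close> is expanded by the antipode axiom for
    a product; this is where the antipode of a product enters.\<close>
  also have "\<dots> = sw2 B (\<lambda>x1 x2. sw2 B (\<lambda>y1 y2. sw2 B (\<lambda>u v. (S y1 \<cdot> S x1) \<cdot> (u \<cdot> S v)) (x2 \<cdot> y2)) y) x"
    by (rule sw_cong, rule sw_cong, rule sw_antip(1)[OF V, symmetric]) (assumption | rule lin)+
  also have "\<dots> = sw2 B (\<lambda>x1 x2. sw2 B (\<lambda>y1 y2. sw2 B (\<lambda>p q. sw2 B (\<lambda>a b.
      (S y1 \<cdot> S x1) \<cdot> ((p \<cdot> a) \<cdot> S (q \<cdot> b))) y2) x2) y) x"
    by (rule sw_cong, rule sw_cong, rule sw_mul[OF V]) (assumption | rule lin)+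
  also have "\<dots> = sw2 B (\<lambda>x1 x2. sw2 B (\<lambda>y1 y2. sw2 B (\<lambda>p q. sw2 B (\<lambda>a b.
      (S a \<cdot> S p) \<cdot> ((q \<cdot> b) \<cdot> S (x2 \<cdot> y2))) y1) x1) y) x"
    by (rule sw2_coassoc2[OF coalgebra_B V, symmetric]) (assumption | rule lin)+
  also have "\<dots> = sw2 B (\<lambda>x1 x2. sw2 B (\<lambda>y1 y2. sw2 B (\<lambda>a b. sw2 B (\<lambda>p q.
      (S a \<cdot> S p) \<cdot> ((q \<cdot> b) \<cdot> S (x2 \<cdot> y2))) x1) y1) y) x"
    by (intro sw_cong[OF sw_cong[OF sw2_swap]] x y)
  also have "\<dots> = sw2 B (\<lambda>x1 x2. sw2 B (\<lambda>y1 y2. sw2 B (\<lambda>a b. sw2 B (\<lambda>p q.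
      S a \<cdot> ((S p \<cdot> q) \<cdot> (b \<cdot> S (x2 \<cdot> y2)))) x1) y1) y) x"
    by (intro sw_cong x y; (assumption | simp_all add: B_assoc B_mem))
  also have "\<dots> = sw2 B (\<lambda>x1 x2. sw2 B (\<lambda>y1 y2. sw2 B (\<lambda>a b.
      scl B (\<epsilon> x1) (S a \<cdot> (\<e> \<cdot> (b \<cdot> S (x2 \<cdot> y2))))) y1) y) x"
    by (rule sw_cong, rule sw_cong, rule sw_cong, rule sw_antip(2)[OF V]) (assumption | rule lin)+
  also have "\<dots> = sw2 B (\<lambda>x1 x2. sw2 B (\<lambda>y1 y2. sw2 B (\<lambda>a b.
      scl B (\<epsilon> x1) ((S a \<cdot> b) \<cdot> S (x2 \<cdot> y2))) y1) y) x"
    by (intro sw_cong x y; (assumption | simp_all add: B_assoc B_unit B_mem))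
  also have "\<dots> = sw2 B (\<lambda>x1 x2. sw2 B (\<lambda>y1 y2. scl B (\<epsilon> y1) (scl B (\<epsilon> x1) (\<e> \<cdot> S (x2 \<cdot> y2)))) y) x"
    by (rule sw_cong, rule sw_cong, rule sw_antip(2)[OF V]) (assumption | rule lin)+
  also have "\<dots> = sw2 B (\<lambda>x1 x2. scl B (\<epsilon> x1) (\<e> \<cdot> S (x2 \<cdot> y))) x"
    by (rule sw_cong, rule cc(1)) (assumption | rule lin)+
  also have "\<dots> = \<e> \<cdot> S (x \<cdot> y)"
    by (rule cc(1)) (assumption | rule lin)+
  finally show ?thesis by (simp add: B_unit B_mem x y)
qed

lemma antip_inv_mul:
  assumes "x \<in> carr B" and "y \<in> carr B"
  shows "T (x \<cdot> y) = T y \<cdot> T x"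
  by (rule antip_inj) (simp_all add: antip_mul antip_antip_inv B_mem assms)

text \<open>\<open>T\<close> is the antipode for the opposite coproduct, hence the reversed legs.
  Applying the injective anti-homomorphism \<open>S\<close> turns each claim into an antipode
  axiom.\<close>

lemma sw_antip_inv:
  assumes U: "is_vspace U" and L: "linear_map B U L" and x: "x \<in> carr B"
  shows "sw2 B (\<lambda>a b. L (b \<cdot> T a)) x = scl U (\<epsilon> x) (L \<e>)"
    and "sw2 B (\<lambda>a b. L (T b \<cdot> a)) x = scl U (\<epsilon> x) (L \<e>)"
proof -
  note V = coalgB(1)
  note [lin] = x
  have m: "sw2 B (\<lambda>a b. b \<cdot> T a) x \<in> carr B" "sw2 B (\<lambda>a b. T b \<cdot> a) x \<in> carr B"
    by (assumption | rule lin)+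
  have "S (sw2 B (\<lambda>a b. b \<cdot> T a) x) = sw2 B (\<lambda>a b. S (b \<cdot> T a)) x"
    by (rule sw_hom[OF V antip_linear]) (assumption | rule lin)+
  also have "\<dots> = sw2 B (\<lambda>a b. a \<cdot> S b) x"
    by (rule sw_cong[OF _ x]) (simp add: antip_mul antip_antip_inv B_mem)
  also have "\<dots> = S (scl B (\<epsilon> x) \<e>)"
    using sw_antip(1)[OF V lin_id x] by (simp add: linear_mapD(3)[OF antip_linear] unit_mem antip_unit)
  finally have 1: "sw2 B (\<lambda>a b. b \<cdot> T a) x = scl B (\<epsilon> x) \<e>"
    using antip_inj m V by (simp add: is_vspaceD unit_mem)
  have "S (sw2 B (\<lambda>a b. T b \<cdot> a) x) = sw2 B (\<lambda>a b. S (T b \<cdot> a)) x"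
    by (rule sw_hom[OF V antip_linear]) (assumption | rule lin)+
  also have "\<dots> = sw2 B (\<lambda>a b. S a \<cdot> b) x"
    by (rule sw_cong[OF _ x]) (simp add: antip_mul antip_antip_inv B_mem)
  also have "\<dots> = S (scl B (\<epsilon> x) \<e>)"
    using sw_antip(2)[OF V lin_id x] by (simp add: linear_mapD(3)[OF antip_linear] unit_mem antip_unit)
  finally have 2: "sw2 B (\<lambda>a b. T b \<cdot> a) x = scl B (\<epsilon> x) \<e>"
    using antip_inj m V by (simp add: is_vspaceD unit_mem)
  have "L (sw2 B (\<lambda>a b. b \<cdot> T a) x) = sw2 B (\<lambda>a b. L (b \<cdot> T a)) x"
    by (rule sw_hom[OF V L _ x]) (assumption | rule lin)+
  then show "sw2 B (\<lambda>a b. L (b \<cdot> T a)) x = scl U (\<epsilon> x) (L \<e>)"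
    by (simp add: 1 linear_mapD(3)[OF L] unit_mem)
  have "L (sw2 B (\<lambda>a b. T b \<cdot> a) x) = sw2 B (\<lambda>a b. L (T b \<cdot> a)) x"
    by (rule sw_hom[OF V L _ x]) (assumption | rule lin)+
  then show "sw2 B (\<lambda>a b. L (T b \<cdot> a)) x = scl U (\<epsilon> x) (L \<e>)"
    by (simp add: 2 linear_mapD(3)[OF L] unit_mem)
qed


section \<open>The finite dual\<close>

abbreviation "A \<equiv> dual B"

text \<open>
  Evaluation gets a constant of its own because a linearity rule about a bare application \<open>\<beta> b\<close>
  would match every term.
\<close>

definition pairing :: "('b \<Rightarrow> 'k) \<Rightarrow> 'b \<Rightarrow> 'k" ("\<langle>_,/ _\<rangle>") where
  "\<langle>\<beta>, b\<rangle> = \<beta> b"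

lemma A_simps:
  "carr A = carr (fin_dual B)" "scl A = fscale" "coun A \<beta> = \<langle>\<beta>, \<e>\<rangle>"
  "unit A = extend0 (carr B) \<epsilon>" "scl (fin_dual B) = fscale"
  by (simp_all add: dual_def fin_dual_def pairing_def)

lemma mem_AD:
  assumes "\<beta> \<in> carr A"
  shows "linear_map B scalars \<beta>" "x \<notin> carr B \<Longrightarrow> \<beta> x = 0"
    "\<exists>I. two_sided_ideal B I \<and> finite_codim B I \<and> (\<forall>x\<in>I. \<beta> x = 0)"
  using assms by (auto simp: dual_def fin_dual_def)

text \<open>A functional lies in the finite dual as soon as \<open>f (a \<cdot> b)\<close> has
  finite rank. The ideal is the largest two-sided one inside the kernel; finite rank in each
  argument reduces its defining conditions to finitely many, so its codimension is finite.\<close>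

lemma mem_AI:
  assumes f: "linear_map B scalars f" and off: "\<And>x. x \<notin> carr B \<Longrightarrow> f x = 0"
    and rank: "\<And>a b. a \<in> carr B \<Longrightarrow> b \<in> carr B \<Longrightarrow> f (a \<cdot> b) = (\<Sum>p\<leftarrow>ps. g p a * h p b)"
  shows "f \<in> carr A"
proof -
  note V = coalgB(1)
  have "\<exists>Y. finite Y \<and> Y \<subseteq> carr B \<and>
    (\<forall>x\<in>carr B. (\<forall>y\<in>Y. f (x \<cdot> y) = 0) \<longrightarrow> (\<forall>y\<in>carr B. f (x \<cdot> y) = 0))"
    by (rule finite_rank_detect[OF rank])
  then obtain Y where Y: "finite Y" "Y \<subseteq> carr B"
    "\<And>x y. x \<in> carr B \<Longrightarrow> \<forall>y\<in>Y. f (x \<cdot> y) = 0 \<Longrightarrow> y \<in> carr B \<Longrightarrow> f (x \<cdot> y) = 0"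
    by blast
  have rank': "f (y \<cdot> x) = (\<Sum>p\<leftarrow>ps. h p x * g p y)" if "x \<in> carr B" "y \<in> carr B" for x y
    using rank[OF that(2,1)] by (simp add: mult.commute)
  have "\<exists>Y. finite Y \<and> Y \<subseteq> carr B \<and>
    (\<forall>x\<in>carr B. (\<forall>y\<in>Y. f (y \<cdot> x) = 0) \<longrightarrow> (\<forall>y\<in>carr B. f (y \<cdot> x) = 0))"
    by (rule finite_rank_detect[OF rank'])
  then obtain Z where Z: "finite Z" "Z \<subseteq> carr B"
    "\<And>x y. x \<in> carr B \<Longrightarrow> \<forall>y\<in>Z. f (y \<cdot> x) = 0 \<Longrightarrow> y \<in> carr B \<Longrightarrow> f (y \<cdot> x) = 0"
    by blast
  define I where "I = {x \<in> carr B. \<forall>a\<in>carr B. \<forall>b\<in>carr B. f (a \<cdot> (x \<cdot> b)) = 0}"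
  \<comment> \<open>The finitely many test functionals: left factors from \<open>Z\<close>, right
    factors from \<open>Y\<close>.\<close>
  define \<Phi> where "\<Phi> = (\<lambda>(z, y) x. f (z \<cdot> (x \<cdot> y))) ` (Z \<times> Y)"
  note [lin] = linear_map_compose[OF f]
  have \<phi>l: "linear_map B scalars (\<lambda>x. f (a \<cdot> (x \<cdot> b)))" if "a \<in> carr B" "b \<in> carr B" for a b
    by (assumption | rule lin that)+
  have \<Phi>: "finite \<Phi>" "\<And>\<phi>. \<phi> \<in> \<Phi> \<Longrightarrow> linear_map B scalars \<phi>"
    using Y(1,2) Z(1,2) \<phi>l by (auto simp: \<Phi>_def)
  have I\<Phi>: "I = {x \<in> carr B. \<forall>\<phi>\<in>\<Phi>. \<phi> x = 0}"
  proof (intro equalityI subsetI)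
    fix x assume "x \<in> I"
    then show "x \<in> {x \<in> carr B. \<forall>\<phi>\<in>\<Phi>. \<phi> x = 0}"
      using Y(2) Z(2) by (auto simp: I_def \<Phi>_def)
  next
    fix x assume "x \<in> {x \<in> carr B. \<forall>\<phi>\<in>\<Phi>. \<phi> x = 0}"
    then have x: "x \<in> carr B" and zy: "\<And>z y. z \<in> Z \<Longrightarrow> y \<in> Y \<Longrightarrow> f (z \<cdot> (x \<cdot> y)) = 0"
      by (auto simp: \<Phi>_def)
    \<comment> \<open>First the left factor is freed from \<open>Z\<close> with the right factor
      still in \<open>Y\<close>; then the right factor is freed from \<open>Y\<close>.\<close>
    have ay: "f (a \<cdot> (x \<cdot> y)) = 0" if "a \<in> carr B" "y \<in> Y" for a y
      using Z(3)[of "x \<cdot> y"] zy that x Y(2) by (auto simp: B_mem)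
    have "f (a \<cdot> (x \<cdot> b)) = 0" if a: "a \<in> carr B" and b: "b \<in> carr B" for a b
    proof -
      have "f ((a \<cdot> x) \<cdot> y) = 0" if "y \<in> Y" for y
        using ay[OF a that] that Y(2) a x by (auto simp: B_assoc)
      then have "f ((a \<cdot> x) \<cdot> b) = 0" using Y(3)[of "a \<cdot> x"] a b x by (auto simp: B_mem)
      then show ?thesis using a b x by (simp add: B_assoc)
    qed
    then show "x \<in> I" using x by (simp add: I_def)
  qed
  have "finite_codim B I" unfolding I\<Phi> by (rule finite_codim_kernels[OF V \<Phi>])
  moreover have "two_sided_ideal B I"
    unfolding two_sided_ideal_def
  proof (intro conjI ballI)
    interpret vector_space "scl B" using V by (simp add: is_vspace_def)
    show "I \<subseteq> carr B" by (auto simp: I_def)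
    show "subspace I"
    proof (rule subspaceI)
      show "0 \<in> I"
        using linear_map_zero[OF V \<phi>l] V by (auto simp: I_def is_vspaceD)
      show "x + y \<in> I" if "x \<in> I" "y \<in> I" for x y
        using that linear_mapD(2)[OF \<phi>l] V by (auto simp: I_def is_vspaceD)
      show "scl B c x \<in> I" if "x \<in> I" for c x
        using that linear_mapD(3)[OF \<phi>l] V by (auto simp: I_def is_vspaceD)
    qed
    fix a x assume a: "a \<in> carr B" and x: "x \<in> I"
    have xm: "x \<in> carr B" and z: "\<And>c d. c \<in> carr B \<Longrightarrow> d \<in> carr B \<Longrightarrow> f (c \<cdot> (x \<cdot> d)) = 0"
      using x by (auto simp: I_def)
    have "f (c \<cdot> ((a \<cdot> x) \<cdot> d)) = 0" if "c \<in> carr B" "d \<in> carr B" for c d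
      using z[of "c \<cdot> a" d] that a xm by (simp add: B_assoc B_mem)
    then show "a \<cdot> x \<in> I" using a xm by (simp add: I_def B_mem)
    have "f (c \<cdot> ((x \<cdot> a) \<cdot> d)) = 0" if "c \<in> carr B" "d \<in> carr B" for c d
      using z[of c "a \<cdot> d"] that a xm by (simp add: B_assoc B_mem)
    then show "x \<cdot> a \<in> I" using a xm by (simp add: I_def B_mem)
  qed
  moreover have "f x = 0" if "x \<in> I" for x
    using that by (auto simp: I_def B_unit unit_mem dest!: bspec[OF _ unit_mem])
  ultimately show ?thesis
    using f off by (auto simp: A_simps(1) fin_dual_def)
qed

lemma A_scale_mem: "\<beta> \<in> carr A \<Longrightarrow> fscale c \<beta> \<in> carr A"
  by (auto simp: dual_def fin_dual_def linear_map_def fscale_def algebra_simps)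

text \<open>Modulo the ideal \<open>I\<close> only finitely many coordinates survive. The coordinate
  functionals \<open>d e\<close> vanish on \<open>I\<close> themselves and so belong to the finite
  dual; expanding \<open>a\<close> and \<open>b\<close> modulo \<open>I\<close> gives the matrix of
  values \<open>\<alpha> (e \<cdot> e')\<close> as coefficients. This makes the coproduct of the
  dual land in the tensor square of the dual.\<close>

lemma finite_dual_rank:
  assumes \<alpha>: "\<alpha> \<in> carr A"
  obtains xs where "set xs \<subseteq> carr A \<times> carr A"
    "\<And>a b. a \<in> carr B \<Longrightarrow> b \<in> carr B \<Longrightarrow> \<alpha> (a \<cdot> b) = (\<Sum>(\<beta>, \<gamma>)\<leftarrow>xs. \<beta> a * \<gamma> b)"
proof -
  note V = coalgB(1)
  note al = mem_AD(1)[OF \<alpha>]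
  obtain I where I: "two_sided_ideal B I" "finite_codim B I" "\<And>x. x \<in> I \<Longrightarrow> \<alpha> x = 0"
    using mem_AD(3)[OF \<alpha>] by blast
  interpret vector_space "scl B" using V by (simp add: is_vspace_def)
  have Is: "subspace I" and Ic: "I \<subseteq> carr B"
    and Im: "\<And>a x. a \<in> carr B \<Longrightarrow> x \<in> I \<Longrightarrow> a \<cdot> x \<in> I" "\<And>a x. a \<in> carr B \<Longrightarrow> x \<in> I \<Longrightarrow> x \<cdot> a \<in> I"
    using I(1) by (auto simp: two_sided_ideal_def)
  obtain F where F: "finite F" "F \<subseteq> carr B" "carr B \<subseteq> span (I \<union> F)"
    using I(2) by (auto simp: finite_codim_def)
  obtain Ib where Ib: "Ib \<subseteq> I" "independent Ib" "I \<subseteq> span Ib"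
    using maximal_independent_subset by blast
  have spI: "span Ib \<subseteq> I" using span_minimal[OF Ib(1) Is] .
  obtain Bs where Bs: "Ib \<subseteq> Bs" "Bs \<subseteq> I \<union> F" "independent Bs" "I \<union> F \<subseteq> span Bs"
    using maximal_independent_subset_extend[of Ib "I \<union> F"] Ib by blast
  define E where "E = Bs - Ib"
  \<comment> \<open>A vector of \<open>E\<close> inside \<open>I\<close> would lie in the span of
    \<open>Ib\<close>, contradicting the independence of \<open>Bs\<close>. Hence \<open>E\<close>
    is contained in the finite set \<open>F\<close>.\<close>
  have EF: "E \<subseteq> F"
  proof
    fix e assume e: "e \<in> E"
    have "e \<notin> I"
    proof
      assume "e \<in> I"
      then have "e \<in> span Ib" using Ib(3) by auto
      moreover have "span Ib \<subseteq> span (Bs - {e})" using e Bs(1) by (intro span_mono) (auto simp: E_def)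
      ultimately have "dependent Bs" using e unfolding dependent_def E_def by blast
      then show False using Bs(3) by simp
    qed
    then show "e \<in> F" using e Bs(2) by (auto simp: E_def)
  qed
  have finE: "finite E" and Ec: "E \<subseteq> carr B" using EF F by (auto intro: finite_subset)
  then have Em: "e \<in> E \<Longrightarrow> e \<in> carr B" for e by blast
  have cB: "carr B \<subseteq> span Bs"
    using F(3) span_mono[OF Bs(4)] by (simp add: span_span)
  let ?r = "representation Bs"
  \<comment> \<open>The coordinate at \<open>e\<close> in a basis adapted to \<open>I\<close>; for
    \<open>e\<close> outside \<open>Ib\<close> it vanishes on \<open>I\<close>.\<close>
  define d where "d e = extend0 (carr B) (\<lambda>x. ?r x e)" for e
  have dA: "d e \<in> carr A" if e: "e \<in> E" for e
  proof -
    have "linear_map B scalars (d e)"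
      using V cB by (auto simp: linear_map_def d_def extend0_def is_vspaceD subset_iff
          representation_add[OF Bs(3)] representation_scale[OF Bs(3)])
    moreover have "d e x = 0" if "x \<in> I" for x
    proof -
      have "?r x = representation Ib x"
        by (rule representation_extend[OF Bs(3)]) (use that Ib(3) Bs(1) in auto)
      then have "?r x e = 0" using representation_ne_zero[of Ib x e] e by (auto simp: E_def)
      then show ?thesis by (simp add: d_def extend0_def)
    qed
    moreover have "d e x = 0" if "x \<notin> carr B" for x
      using that by (simp add: d_def extend0_def)
    ultimately show ?thesis
      using I(1,2) by (auto simp: A_simps(1) fin_dual_def)
  qed
  have sumE: "(\<Sum>e\<in>E. scl B (c e) e) \<in> carr B" for c
    using linear_map_sum[OF V lin_id, of E "\<lambda>e. scl B (c e) e"] Em V by (auto simp: is_vspaceD)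
  \<comment> \<open>What is left after subtracting the coordinates in \<open>E\<close> is a
    combination of \<open>Ib\<close>, hence lies in \<open>I\<close>.\<close>
  have decomp: "a - (\<Sum>e\<in>E. scl B (d e a) e) \<in> I" if a: "a \<in> carr B" for a
  proof -
    let ?Z = "{b. ?r a b \<noteq> 0}"
    have Z: "finite ?Z" "?Z \<subseteq> Bs" by (auto intro: finite_representation dest: representation_ne_zero)
    have d: "d e a = ?r a e" for e using a by (simp add: d_def extend0_def)
    have sE: "(\<Sum>e\<in>E. scl B (d e a) e) = (\<Sum>e\<in>?Z \<inter> E. scl B (?r a e) e)"
      unfolding d by (rule sum.mono_neutral_right[OF finE]) auto
    have sZ: "a = (\<Sum>b\<in>?Z. scl B (?r a b) b)"
      using sum_nonzero_representation_eq[OF Bs(3), of a] a cB by auto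
    have cancel: "p = q + r \<Longrightarrow> s = q \<Longrightarrow> p - s = r" for p q r s :: 'b
      by simp
    have "a - (\<Sum>e\<in>E. scl B (d e a) e) = (\<Sum>b\<in>?Z - E. scl B (?r a b) b)"
      by (rule cancel[OF trans[OF sZ sum.Int_Diff[OF Z(1)]] sE])
    also have "\<dots> \<in> span Ib"
      using Z(2) by (intro span_sum span_scale span_base) (auto simp: E_def)
    finally show ?thesis using spI by auto
  qed
  have expandL: "\<alpha> (a \<cdot> b) = (\<Sum>e\<in>E. d e a * \<alpha> (e \<cdot> b))" if a: "a \<in> carr B" and b: "b \<in> carr B" for a b
  proof -
    have l: "linear_map B scalars (\<lambda>x. \<alpha> (x \<cdot> b))"
      by (assumption | rule lin b linear_map_compose[OF al])+
    let ?s = "\<Sum>e\<in>E. scl B (d e a) e"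
    have "\<alpha> (a \<cdot> b) - \<alpha> (?s \<cdot> b) = \<alpha> ((a - ?s) \<cdot> b)"
      using linear_map_diff[OF V l a sumE] by simp
    also have "\<dots> = 0" using I(3) Im(2)[OF b decomp[OF a]] by simp
    finally have "\<alpha> (a \<cdot> b) = \<alpha> (?s \<cdot> b)" by simp
    also have "\<dots> = (\<Sum>e\<in>E. \<alpha> (scl B (d e a) e \<cdot> b))"
      using linear_map_sum[OF V l, of E "\<lambda>e. scl B (d e a) e"] Em V by (auto simp: is_vspaceD)
    also have "\<dots> = (\<Sum>e\<in>E. d e a * \<alpha> (e \<cdot> b))"
      using linear_mapD(3)[OF l] Em by (intro sum.cong) auto
    finally show ?thesis .
  qed
  have expandR: "\<alpha> (a \<cdot> b) = (\<Sum>e\<in>E. d e b * \<alpha> (a \<cdot> e))" if a: "a \<in> carr B" and b: "b \<in> carr B" for a b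
  proof -
    have l: "linear_map B scalars (\<lambda>x. \<alpha> (a \<cdot> x))"
      by (assumption | rule lin a linear_map_compose[OF al])+
    let ?s = "\<Sum>e\<in>E. scl B (d e b) e"
    have "\<alpha> (a \<cdot> b) - \<alpha> (a \<cdot> ?s) = \<alpha> (a \<cdot> (b - ?s))"
      using linear_map_diff[OF V l b sumE] by simp
    also have "\<dots> = 0" using I(3) Im(1)[OF a decomp[OF b]] by simp
    finally have "\<alpha> (a \<cdot> b) = \<alpha> (a \<cdot> ?s)" by simp
    also have "\<dots> = (\<Sum>e\<in>E. \<alpha> (a \<cdot> scl B (d e b) e))"
      using linear_map_sum[OF V l, of E "\<lambda>e. scl B (d e b) e"] Em V by (auto simp: is_vspaceD)
    also have "\<dots> = (\<Sum>e\<in>E. d e b * \<alpha> (a \<cdot> e))"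
      using linear_mapD(3)[OF l] Em by (intro sum.cong) auto
    finally show ?thesis .
  qed
  obtain es where es: "set es = E" "distinct es" using finE finite_distinct_list by blast
  define xs where "xs = map (\<lambda>p. (fscale (\<alpha> (fst p \<cdot> snd p)) (d (fst p)), d (snd p))) (List.product es es)"
  show thesis
  proof (rule that[of xs])
    show "set xs \<subseteq> carr A \<times> carr A"
      using es(1) dA by (auto simp: xs_def A_scale_mem)
    fix a b assume ab: "a \<in> carr B" "b \<in> carr B"
    have "\<alpha> (a \<cdot> b) = (\<Sum>e\<in>E. \<Sum>e'\<in>E. \<alpha> (e \<cdot> e') * d e a * d e' b)"
      unfolding expandL[OF ab] using expandR[OF _ ab(2)] Em
      by (intro sum.cong) (auto simp: sum_distrib_left algebra_simps subset_iff)
    also have "\<dots> = (\<Sum>e\<leftarrow>es. \<Sum>e'\<leftarrow>es. \<alpha> (e \<cdot> e') * d e a * d e' b)"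
      by (simp only: es(1)[symmetric] sum.distinct_set_conv_list[OF es(2)])
    also have "\<dots> = (\<Sum>p\<leftarrow>List.product es es. \<alpha> (fst p \<cdot> snd p) * d (fst p) a * d (snd p) b)"
      by (rule sum_list_product[symmetric])
    also have "\<dots> = (\<Sum>(\<beta>, \<gamma>)\<leftarrow>xs. \<beta> a * \<gamma> b)"
      by (simp add: xs_def comp_def fscale_def)
    finally show "\<alpha> (a \<cdot> b) = (\<Sum>(\<beta>, \<gamma>)\<leftarrow>xs. \<beta> a * \<gamma> b)" .
  qed
qed

text \<open>Closure under sums goes through the finite-rank criterion: two decompositions are
  concatenated, instead of intersecting two ideals.\<close>

lemma is_vspace_A: "is_vspace A"
proof -
  interpret vector_space "fscale :: 'k \<Rightarrow> ('b \<Rightarrow> 'k) \<Rightarrow> _" by (rule vector_space_fscale)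
  have "subspace (carr A)"
  proof (rule subspaceI)
    show "0 \<in> carr A"
      by (rule mem_AI[where ps = "[]"]) (auto simp: linear_map_def)
    fix \<alpha> \<beta> assume a: "\<alpha> \<in> carr A" and b: "\<beta> \<in> carr A"
    obtain xs where xs: "\<And>a b. a \<in> carr B \<Longrightarrow> b \<in> carr B \<Longrightarrow> \<alpha> (a \<cdot> b) = (\<Sum>(\<beta>, \<gamma>)\<leftarrow>xs. \<beta> a * \<gamma> b)"
      using finite_dual_rank[OF a] by metis
    obtain ys where ys: "\<And>a b. a \<in> carr B \<Longrightarrow> b \<in> carr B \<Longrightarrow> \<beta> (a \<cdot> b) = (\<Sum>(\<beta>, \<gamma>)\<leftarrow>ys. \<beta> a * \<gamma> b)"
      using finite_dual_rank[OF b] by metis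
    show "\<alpha> + \<beta> \<in> carr A"
      by (rule mem_AI[where ps = "xs @ ys" and g = fst and h = snd])
        (use mem_AD[OF a] mem_AD[OF b] in \<open>auto simp: xs ys linear_map_def algebra_simps case_prod_unfold\<close>)
  qed (rule A_scale_mem)
  then show ?thesis
    by (simp add: is_vspace_def A_simps(2) vector_space_axioms)
qed

lemma lin_pairing_left [lin]: "linear_map X A g \<Longrightarrow> linear_map X scalars (\<lambda>x. \<langle>g x, b\<rangle>)"
  by (auto simp: linear_map_def pairing_def A_simps(2) fscale_def)

lemma lin_pairing_right [lin]: "\<beta> \<in> carr A \<Longrightarrow> linear_map X B g \<Longrightarrow> linear_map X scalars (\<lambda>x. \<langle>\<beta>, g x\<rangle>)"
  unfolding pairing_def by (rule linear_map_compose[OF mem_AD(1)])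

lemmas [lin] = is_vspace_A A_scale_mem
  lin_scl_left[OF is_vspace_A, unfolded A_simps(2)] lin_scl_right[OF is_vspace_A, unfolded A_simps(2)]

section \<open>Separation by evaluation, and the coproduct of the finite dual\<close>

lemma A_eqI:
  assumes "\<alpha> \<in> carr A" "\<beta> \<in> carr A" "\<And>b. b \<in> carr B \<Longrightarrow> \<langle>\<alpha>, b\<rangle> = \<langle>\<beta>, b\<rangle>"
  shows "\<alpha> = \<beta>"
proof
  fix x
  show "\<alpha> x = \<beta> x"
    using assms(3)[of x] mem_AD(2)[OF assms(1), of x] mem_AD(2)[OF assms(2), of x]
    by (cases "x \<in> carr B") (simp_all add: pairing_def)
qed

lemma pairing_simps: "\<langle>fscale c \<alpha>, b\<rangle> = c * \<langle>\<alpha>, b\<rangle>" "\<langle>0, b\<rangle> = 0"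
  by (simp_all add: pairing_def fscale_def)

text \<open>Elements of \<open>B\<close> separate the dual by definition of a functional, so
  evaluating the first leg suffices for any second factor. The choice of \<open>B\<close> as second
  factor is the important one, since the dual need not separate it.\<close>

lemma tens_A_eqI:
  assumes W: "is_vspace W" and st: "s \<in> carr (tens A W)" "t \<in> carr (tens A W)"
    and eq: "\<And>b. b \<in> carr B \<Longrightarrow>
      tlift A W (\<lambda>\<beta> w. scl W \<langle>\<beta>, b\<rangle> w) s = tlift A W (\<lambda>\<beta> w. scl W \<langle>\<beta>, b\<rangle> w) t"
  shows "s = t"
proof (rule tens_separate[OF is_vspace_A W _ _ st, where \<Phi> = "(\<lambda>b \<beta>. \<langle>\<beta>, b\<rangle>) ` carr B"])
  fix \<phi> assume "\<phi> \<in> (\<lambda>b \<beta>. \<langle>\<beta>, b\<rangle>) ` carr B"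
  then obtain b where b: "b \<in> carr B" "\<phi> = (\<lambda>\<beta>. \<langle>\<beta>, b\<rangle>)" by auto
  show "linear_map A scalars \<phi>" unfolding b(2) by (assumption | rule lin)+
  show "tlift A W (\<lambda>v w. scl W (\<phi> v) w) s = tlift A W (\<lambda>v w. scl W (\<phi> v) w) t"
    unfolding b(2) by (rule eq[OF b(1)])
next
  fix v assume v: "v \<in> carr A" and z: "\<And>\<phi>. \<phi> \<in> (\<lambda>b \<beta>. \<langle>\<beta>, b\<rangle>) ` carr B \<Longrightarrow> \<phi> v = 0"
  show "v = 0"
    by (rule A_eqI[OF v is_vspaceD(1)[OF is_vspace_A]]) (simp add: z[OF imageI] pairing_simps)
qed

lemma tens_AA_eqI:
  assumes st: "s \<in> carr (tens A A)" "t \<in> carr (tens A A)"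
    and eq: "\<And>a b. a \<in> carr B \<Longrightarrow> b \<in> carr B \<Longrightarrow>
      tlift A A (\<lambda>\<beta> \<gamma>. \<langle>\<beta>, a\<rangle> * \<langle>\<gamma>, b\<rangle>) s = tlift A A (\<lambda>\<beta> \<gamma>. \<langle>\<beta>, a\<rangle> * \<langle>\<gamma>, b\<rangle>) t"
  shows "s = t"
proof (rule tens_A_eqI[OF is_vspace_A st])
  fix a assume a: "a \<in> carr B"
  have m: "tlift A A (\<lambda>\<beta> \<gamma>. fscale \<langle>\<beta>, a\<rangle> \<gamma>) r \<in> carr A" if "r \<in> carr (tens A A)" for r
    by (assumption | rule lin that)+
  have ev: "\<langle>tlift A A (\<lambda>\<beta> \<gamma>. fscale \<langle>\<beta>, a\<rangle> \<gamma>) r, b\<rangle> = tlift A A (\<lambda>\<beta> \<gamma>. \<langle>\<beta>, a\<rangle> * \<langle>\<gamma>, b\<rangle>) r"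
    if r: "r \<in> carr (tens A A)" for r b
  proof -
    have l: "linear_map A scalars (\<lambda>\<alpha>. \<langle>\<alpha>, b\<rangle>)" by (assumption | rule lin)+
    show ?thesis
      by (subst tlift_hom[OF is_vspace_A is_vspace_A l r]) (auto simp: A_scale_mem pairing_simps)
  qed
  show "tlift A A (\<lambda>\<beta> w. scl A \<langle>\<beta>, a\<rangle> w) s = tlift A A (\<lambda>\<beta> w. scl A \<langle>\<beta>, a\<rangle> w) t"
    unfolding A_simps(2) by (rule A_eqI[OF m[OF st(1)] m[OF st(2)]]) (simp add: ev st eq a)
qed

lemma tens_fin_dual:
  "tens (fin_dual B) (fin_dual B) = tens A A" "tlift (fin_dual B) (fin_dual B) = tlift A A"
  by (rule tens_cong(3), simp_all only: A_simps) (rule tens_cong(4), simp_all only: A_simps)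

lemma cop_A_ex:
  assumes \<alpha>: "\<alpha> \<in> carr A"
  shows "\<exists>t. t \<in> carr (tens A A) \<and>
    (\<forall>a\<in>carr B. \<forall>b\<in>carr B. \<alpha> (a \<cdot> b) = tlift A A (\<lambda>\<beta> \<gamma>. \<beta> a * \<gamma> b) t)"
proof -
  obtain xs where xs: "set xs \<subseteq> carr A \<times> carr A"
    "\<And>a b. a \<in> carr B \<Longrightarrow> b \<in> carr B \<Longrightarrow> \<alpha> (a \<cdot> b) = (\<Sum>(\<beta>, \<gamma>)\<leftarrow>xs. \<beta> a * \<gamma> b)"
    using finite_dual_rank[OF \<alpha>] by metis
  have "bilinear_map A A scalars (\<lambda>\<beta> \<gamma>. \<langle>\<beta>, a\<rangle> * \<langle>\<gamma>, b\<rangle>)" for a b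
    by (assumption | rule lin)+
  note bl = this[unfolded pairing_def]
  show ?thesis
  proof (intro exI conjI ballI)
    show "(\<Sum>(\<beta>, \<gamma>)\<leftarrow>xs. ptens A A \<beta> \<gamma>) \<in> carr (tens A A)"
      by (rule sum_list_mem[OF is_vspace_tens]) (use xs(1) in \<open>auto intro: ptens_in_tens\<close>)
    fix a b assume "a \<in> carr B" "b \<in> carr B"
    then show "\<alpha> (a \<cdot> b) = tlift A A (\<lambda>\<beta> \<gamma>. \<beta> a * \<gamma> b) (\<Sum>(\<beta>, \<gamma>)\<leftarrow>xs. ptens A A \<beta> \<gamma>)"
      by (simp add: xs(2) tlift_repr[OF is_vspace_scalars bl xs(1)])
  qed
qed

text \<open>Resolves the definite description in \<open>dual\<close>: existence is
  \<open>cop_A_ex\<close>, uniqueness is \<open>tens_AA_eqI\<close>.\<close>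

lemma cop_A:
  assumes \<alpha>: "\<alpha> \<in> carr A"
  shows cop_A_mem: "cop A \<alpha> \<in> carr (tens A A)"
    and cop_A_pairing: "a \<in> carr B \<Longrightarrow> b \<in> carr B \<Longrightarrow> sw2 A (\<lambda>\<beta> \<gamma>. \<langle>\<beta>, a\<rangle> * \<langle>\<gamma>, b\<rangle>) \<alpha> = \<langle>\<alpha>, a \<cdot> b\<rangle>"
proof -
  let ?P = "\<lambda>t. t \<in> carr (tens A A) \<and>
    (\<forall>a\<in>carr B. \<forall>b\<in>carr B. \<alpha> (a \<cdot> b) = tlift A A (\<lambda>\<beta> \<gamma>. \<beta> a * \<gamma> b) t)"
  have c: "cop A \<alpha> = (THE t. ?P t)"
    unfolding tens_fin_dual[symmetric] by (simp add: dual_def)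
  have "\<exists>!t. ?P t"
    using cop_A_ex[OF \<alpha>] by (auto intro!: tens_AA_eqI simp: pairing_def)
  then have P: "?P (cop A \<alpha>)" unfolding c by (rule theI')
  then show "cop A \<alpha> \<in> carr (tens A A)" by blast
  show "sw2 A (\<lambda>\<beta> \<gamma>. \<langle>\<beta>, a\<rangle> * \<langle>\<gamma>, b\<rangle>) \<alpha> = \<langle>\<alpha>, a \<cdot> b\<rangle>" if "a \<in> carr B" "b \<in> carr B"
    using P that by (simp add: sw2_def pairing_def)
qed

lemma cop_A_eqI:
  assumes "\<alpha> \<in> carr A" "t \<in> carr (tens A A)"
    and "\<And>a b. a \<in> carr B \<Longrightarrow> b \<in> carr B \<Longrightarrow> tlift A A (\<lambda>\<beta> \<gamma>. \<langle>\<beta>, a\<rangle> * \<langle>\<gamma>, b\<rangle>) t = \<langle>\<alpha>, a \<cdot> b\<rangle>"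
  shows "cop A \<alpha> = t"
  by (rule tens_AA_eqI[OF cop_A_mem[OF assms(1)] assms(2)])
    (simp add: cop_A_pairing[OF assms(1), unfolded sw2_def] assms(3))

section \<open>Product, unit and antipode of the finite dual\<close>

lemma A_mul_off: "x \<notin> carr B \<Longrightarrow> mul A \<alpha> \<beta> x = 0"
  by (simp add: dual_def extend0_def)

lemma pairing_mul: "b \<in> carr B \<Longrightarrow> \<langle>mul A \<alpha> \<beta>, b\<rangle> = sw2 B (\<lambda>b1 b2. \<langle>\<alpha>, b1\<rangle> * \<langle>\<beta>, b2\<rangle>) b"
  by (simp add: dual_def extend0_def pairing_def)

lemma pairing_unit: "b \<in> carr B \<Longrightarrow> \<langle>unit A, b\<rangle> = \<epsilon> b"
  by (simp add: dual_def extend0_def pairing_def)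

text \<open>Multiplicativity of the coproduct of \<open>B\<close>, transposed. It also exhibits
  \<open>mul A \<alpha> \<beta>\<close> as having finite rank, which places the product in the
  finite dual.\<close>

lemma pairing_mul_mul:
  assumes a: "\<alpha> \<in> carr A" and b: "\<beta> \<in> carr A" and xy: "x \<in> carr B" "y \<in> carr B"
  shows "\<langle>mul A \<alpha> \<beta>, x \<cdot> y\<rangle> = sw2 A (\<lambda>\<alpha>1 \<alpha>2. sw2 A (\<lambda>\<beta>1 \<beta>2.
    \<langle>mul A \<alpha>1 \<beta>1, x\<rangle> * \<langle>mul A \<alpha>2 \<beta>2, y\<rangle>) \<beta>) \<alpha>"
proof -
  note [lin] = a b xy
  have "\<langle>mul A \<alpha> \<beta>, x \<cdot> y\<rangle> = sw2 B (\<lambda>x1 x2. sw2 B (\<lambda>y1 y2. \<langle>\<alpha>, x1 \<cdot> y1\<rangle> * \<langle>\<beta>, x2 \<cdot> y2\<rangle>) y) x"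
    unfolding pairing_mul[OF bilinear_mapD(3)[OF mul_B xy]]
    by (rule sw_mul[OF is_vspace_scalars]) (assumption | rule lin)+
  also have "\<dots> = sw2 B (\<lambda>x1 x2. sw2 B (\<lambda>y1 y2. sw2 A (\<lambda>\<alpha>1 \<alpha>2. \<langle>\<alpha>1, x1\<rangle> * \<langle>\<alpha>2, y1\<rangle>) \<alpha> *
      sw2 A (\<lambda>\<beta>1 \<beta>2. \<langle>\<beta>1, x2\<rangle> * \<langle>\<beta>2, y2\<rangle>) \<beta>) y) x"
    by (intro sw_cong xy) (simp add: cop_A_pairing a b)
  also have "\<dots> = sw2 A (\<lambda>\<alpha>1 \<alpha>2. sw2 A (\<lambda>\<beta>1 \<beta>2. sw2 B (\<lambda>x1 x2. \<langle>\<alpha>1, x1\<rangle> * \<langle>\<beta>1, x2\<rangle>) x *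
      sw2 B (\<lambda>y1 y2. \<langle>\<alpha>2, y1\<rangle> * \<langle>\<beta>2, y2\<rangle>) y) \<beta>) \<alpha>"
    by (rule sw2_exchange)
  finally show ?thesis by (simp add: pairing_mul xy)
qed

lemma A_mul_mem:
  assumes a: "\<alpha> \<in> carr A" and b: "\<beta> \<in> carr A"
  shows "mul A \<alpha> \<beta> \<in> carr A"
proof (rule mem_AI[where ps = "List.product (trep A A (cop A \<alpha>)) (trep A A (cop A \<beta>))"
      and g = "\<lambda>p x. \<langle>mul A (fst (fst p)) (fst (snd p)), x\<rangle>"
      and h = "\<lambda>p x. \<langle>mul A (snd (fst p)) (snd (snd p)), x\<rangle>"])
  have "linear_map B scalars (\<lambda>x. sw2 B (\<lambda>b1 b2. \<langle>\<alpha>, b1\<rangle> * \<langle>\<beta>, b2\<rangle>) x)"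
    by (assumption | rule lin a b)+
  moreover have "mul A \<alpha> \<beta> x = sw2 B (\<lambda>b1 b2. \<langle>\<alpha>, b1\<rangle> * \<langle>\<beta>, b2\<rangle>) x" if "x \<in> carr B" for x
    by (subst pairing_mul[OF that, symmetric]) (simp only: pairing_def)
  ultimately show "linear_map B scalars (mul A \<alpha> \<beta>)"
    using coalgB(1) by (simp add: linear_map_def is_vspaceD)
  fix x y assume xy: "x \<in> carr B" "y \<in> carr B"
  show "mul A \<alpha> \<beta> (x \<cdot> y) = (\<Sum>p\<leftarrow>List.product (trep A A (cop A \<alpha>)) (trep A A (cop A \<beta>)).
    \<langle>mul A (fst (fst p)) (fst (snd p)), x\<rangle> * \<langle>mul A (snd (fst p)) (snd (snd p)), y\<rangle>)"
    using pairing_mul_mul[OF a b xy]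
    unfolding sum_list_product[where f = "\<lambda>p q. \<langle>mul A (fst p) (fst q), x\<rangle> * \<langle>mul A (snd p) (snd q), y\<rangle>"]
    by (simp add: sw2_def tlift_trep case_prod_unfold pairing_def)
qed (rule A_mul_off)

lemma A_unit_mem: "unit A \<in> carr A"
proof (rule mem_AI[where ps = "[()]" and g = "\<lambda>_. \<epsilon>" and h = "\<lambda>_. \<epsilon>"])
  show "linear_map B scalars (unit A)"
    using coalgB(1,3) by (auto simp: linear_map_def is_vspaceD A_simps extend0_def)
qed (auto simp: A_simps extend0_def coun_mul B_mem)

lemma A_comp_mem:
  assumes a: "\<alpha> \<in> carr A" and f: "linear_map B B f"
    and anti: "\<And>x y. x \<in> carr B \<Longrightarrow> y \<in> carr B \<Longrightarrow> f (x \<cdot> y) = f y \<cdot> f x"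
  shows "extend0 (carr B) (\<alpha> \<circ> f) \<in> carr A"
proof -
  obtain xs where xs: "\<And>a b. a \<in> carr B \<Longrightarrow> b \<in> carr B \<Longrightarrow> \<alpha> (a \<cdot> b) = (\<Sum>(\<beta>, \<gamma>)\<leftarrow>xs. \<beta> a * \<gamma> b)"
    using finite_dual_rank[OF a] by metis
  show ?thesis
  \<comment> \<open>The two factors are exchanged because \<open>f\<close> reverses
    products.\<close>
  proof (rule mem_AI[where ps = xs and g = "\<lambda>p x. snd p (f x)" and h = "\<lambda>p x. fst p (f x)"])
    show "linear_map B scalars (extend0 (carr B) (\<alpha> \<circ> f))"
      using f mem_AD(1)[OF a] coalgB(1) by (auto simp: linear_map_def is_vspaceD extend0_def)
  qed (use f in \<open>auto simp: extend0_def xs anti linear_map_def mult.commute case_prod_unfold B_mem\<close>)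
qed

lemma pairing_antip: "b \<in> carr B \<Longrightarrow> \<langle>antip A \<alpha>, b\<rangle> = \<langle>\<alpha>, S b\<rangle>"
  by (simp add: dual_def extend0_def pairing_def)

lemma antip_A_mem: "\<alpha> \<in> carr A \<Longrightarrow> antip A \<alpha> \<in> carr A"
  using A_comp_mem[OF _ antip_linear antip_mul] by (simp add: dual_def)

text \<open>\<open>antip_inv\<close> is defined through \<open>inv_into\<close>, so injectivity of
  the antipode of the dual is needed, along with an explicit preimage: composition with
  \<open>T\<close>.\<close>

lemma antip_inv_A_eq:
  assumes a: "\<alpha> \<in> carr A"
  shows "antip_inv A \<alpha> = extend0 (carr B) (\<alpha> \<circ> T)"
proof -
  let ?\<beta> = "extend0 (carr B) (\<alpha> \<circ> T)"
  have b: "?\<beta> \<in> carr A" by (rule A_comp_mem[OF a antip_inv_linear antip_inv_mul])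
  have "inj_on (antip A) (carr A)"
  proof (rule inj_onI)
    fix \<gamma> \<delta> assume g: "\<gamma> \<in> carr A" and d: "\<delta> \<in> carr A" and eq: "antip A \<gamma> = antip A \<delta>"
    show "\<gamma> = \<delta>"
    proof (rule A_eqI[OF g d])
      fix b assume "b \<in> carr B"
      then show "\<langle>\<gamma>, b\<rangle> = \<langle>\<delta>, b\<rangle>"
        using pairing_antip[of "T b" \<gamma>] pairing_antip[of "T b" \<delta>] eq
        by (simp add: antip_inv_mem antip_antip_inv)
    qed
  qed
  moreover have "antip A ?\<beta> = \<alpha>"
    by (rule A_eqI[OF antip_A_mem[OF b] a])
      (simp add: pairing_antip, simp add: pairing_def extend0_def antip_inv_antip B_mem)
  ultimately show ?thesis
    unfolding antip_inv_def[of A] using b by (intro inv_into_f_eq) auto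
qed

abbreviation "T' \<equiv> antip_inv A"

lemma antip_inv_A_mem: "\<alpha> \<in> carr A \<Longrightarrow> T' \<alpha> \<in> carr A"
  using A_comp_mem[OF _ antip_inv_linear antip_inv_mul] by (simp add: antip_inv_A_eq)

lemma pairing_antip_inv: "\<alpha> \<in> carr A \<Longrightarrow> b \<in> carr B \<Longrightarrow> \<langle>T' \<alpha>, b\<rangle> = \<langle>\<alpha>, T b\<rangle>"
  by (simp add: antip_inv_A_eq extend0_def pairing_def)

lemma pairing_add: "\<langle>\<alpha> + \<beta>, b\<rangle> = \<langle>\<alpha>, b\<rangle> + \<langle>\<beta>, b\<rangle>"
  by (simp add: pairing_def)

lemma A_mul_bilinear: "bilinear_map A A A (mul A)"
proof (rule bilinear_mapI)
  note m = A_mul_mem is_vspaceD[OF is_vspace_A, unfolded A_simps(2)]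
  have l: "linear_map A scalars (\<lambda>\<alpha>. sw2 B (\<lambda>b1 b2. \<langle>\<alpha>, b1\<rangle> * \<langle>\<gamma>, b2\<rangle>) b)"
    "linear_map A scalars (\<lambda>\<alpha>. sw2 B (\<lambda>b1 b2. \<langle>\<gamma>, b1\<rangle> * \<langle>\<alpha>, b2\<rangle>) b)" if "b \<in> carr B" for \<gamma> b
    by (assumption | rule lin that)+
  fix \<gamma> assume g: "\<gamma> \<in> carr A"
  show "linear_map A A (\<lambda>\<alpha>. mul A \<alpha> \<gamma>)" unfolding linear_map_def A_simps(2)
  proof (intro conjI ballI allI)
    fix \<alpha> \<beta> c assume ab: "\<alpha> \<in> carr A" "\<beta> \<in> carr A"
    show "mul A (\<alpha> + \<beta>) \<gamma> = mul A \<alpha> \<gamma> + mul A \<beta> \<gamma>"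
      by (rule A_eqI) (use linear_mapD(2)[OF l(1) ab] ab g in \<open>simp_all add: m pairing_mul pairing_add\<close>)
    show "mul A (fscale c \<alpha>) \<gamma> = fscale c (mul A \<alpha> \<gamma>)"
      by (rule A_eqI) (use linear_mapD(3)[OF l(1) ab(1)] ab g in \<open>simp_all add: m pairing_mul pairing_simps A_simps(2)\<close>)
  qed (simp add: m g)
  show "linear_map A A (\<lambda>\<alpha>. mul A \<gamma> \<alpha>)" unfolding linear_map_def A_simps(2)
  proof (intro conjI ballI allI)
    fix \<alpha> \<beta> c assume ab: "\<alpha> \<in> carr A" "\<beta> \<in> carr A"
    show "mul A \<gamma> (\<alpha> + \<beta>) = mul A \<gamma> \<alpha> + mul A \<gamma> \<beta>"
      by (rule A_eqI) (use linear_mapD(2)[OF l(2) ab] ab g in \<open>simp_all add: m pairing_mul pairing_add\<close>)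
    show "mul A \<gamma> (fscale c \<alpha>) = fscale c (mul A \<gamma> \<alpha>)"
      by (rule A_eqI) (use linear_mapD(3)[OF l(2) ab(1)] ab g in \<open>simp_all add: m pairing_mul pairing_simps A_simps(2)\<close>)
  qed (simp add: m g)
qed

lemma antip_inv_A_linear: "linear_map A A T'"
  unfolding linear_map_def A_simps(2)
proof (intro conjI ballI allI)
  note m = antip_inv_A_mem is_vspaceD[OF is_vspace_A, unfolded A_simps(2)]
  fix \<alpha> \<beta> c assume ab: "\<alpha> \<in> carr A" "\<beta> \<in> carr A"
  show "T' (\<alpha> + \<beta>) = T' \<alpha> + T' \<beta>"
    by (rule A_eqI) (simp_all add: m ab pairing_antip_inv pairing_add)
  show "T' (fscale c \<alpha>) = fscale c (T' \<alpha>)"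
    by (rule A_eqI) (simp_all add: m ab pairing_antip_inv pairing_simps)
qed (rule antip_inv_A_mem)

lemmas [lin] = bilinear_mapD[OF A_mul_bilinear] A_unit_mem antip_inv_A_mem
  linear_map_compose[OF antip_inv_A_linear]

lemma A_unit:
  assumes a: "\<alpha> \<in> carr A"
  shows "mul A (unit A) \<alpha> = \<alpha>" "mul A \<alpha> (unit A) = \<alpha>"
proof -
  have l: "linear_map B scalars (\<lambda>b. \<langle>\<alpha>, b\<rangle>)" by (assumption | rule lin a)+
  show "mul A (unit A) \<alpha> = \<alpha>"
    by (rule A_eqI) (use sw2_counit(1)[OF coalgebra_B is_vspace_scalars l] in
      \<open>simp_all add: A_mul_mem A_unit_mem a pairing_mul pairing_unit cong: sw_cong\<close>)
  show "mul A \<alpha> (unit A) = \<alpha>"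
    by (rule A_eqI) (use sw2_counit(2)[OF coalgebra_B is_vspace_scalars l] in
      \<open>simp_all add: A_mul_mem A_unit_mem a pairing_mul pairing_unit mult.commute cong: sw_cong\<close>)
qed

lemma cop_A_linear: "linear_map A (tens A A) (cop A)"
  unfolding linear_map_def A_simps(2) tens_simps
proof (intro conjI ballI allI)
  note m = cop_A_mem is_vspaceD[OF is_vspace_A, unfolded A_simps(2)]
    is_vspaceD[OF is_vspace_tens, unfolded tens_simps]
  have l: "linear_map (tens A A) scalars (tlift A A (\<lambda>\<beta> \<gamma>. \<langle>\<beta>, a\<rangle> * \<langle>\<gamma>, b\<rangle>))" for a b
    by (rule tlift_linear) (assumption | rule lin)+
  note l' = linear_mapD[OF l, unfolded tens_simps scalars_simps]
  note p = cop_A_pairing[unfolded sw2_def]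
  fix \<alpha> \<beta> c assume ab: "\<alpha> \<in> carr A" "\<beta> \<in> carr A"
  show "cop A (\<alpha> + \<beta>) = cop A \<alpha> + cop A \<beta>"
    by (rule cop_A_eqI) (use ab in \<open>simp_all add: m l' p pairing_add\<close>)
  show "cop A (fscale c \<alpha>) = fscale c (cop A \<alpha>)"
    by (rule cop_A_eqI) (use ab in \<open>simp_all add: m l' p pairing_simps\<close>)
qed (rule cop_A_mem)

lemma swA_hom:
  assumes "is_vspace U" "linear_map U X g" "\<alpha> \<in> carr A"
    "\<And>x y. x \<in> carr A \<Longrightarrow> y \<in> carr A \<Longrightarrow> f x y \<in> carr U"
  shows "g (sw2 A f \<alpha>) = sw2 A (\<lambda>x y. g (f x y)) \<alpha>"
  unfolding sw2_def by (rule tlift_hom[OF is_vspace_A assms(1,2) cop_A_mem[OF assms(3)] assms(4)])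

lemma swA_cong:
  assumes "\<And>x y. x \<in> carr A \<Longrightarrow> y \<in> carr A \<Longrightarrow> f x y = g x y" "\<alpha> \<in> carr A"
  shows "sw2 A f \<alpha> = sw2 A g \<alpha>"
  unfolding sw2_def by (rule tlift_cong[OF is_vspace_A cop_A_mem[OF assms(2)] assms(1)])

lemma swA_mem:
  assumes "is_vspace U" "\<alpha> \<in> carr A" "\<And>x y. x \<in> carr A \<Longrightarrow> y \<in> carr A \<Longrightarrow> f x y \<in> carr U"
  shows "sw2 A f \<alpha> \<in> carr U"
  unfolding sw2_def by (rule tlift_mem[OF is_vspace_A assms(1) cop_A_mem[OF assms(2)] assms(3)])

text \<open>Evaluation at three elements separates triple tensors, by \<open>tens_A_eqI\<close>
  followed by \<open>tens_AA_eqI\<close>. Under it coassociativity becomes associativity of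
  \<open>B\<close>, and the counit laws become the unit laws of \<open>B\<close>.\<close>

lemma coalgebra_A: "coalgebra A"
proof (rule coalgebraI[OF is_vspace_A cop_A_linear])
  show "linear_map A scalars (coun A)"
    unfolding A_simps(3)[abs_def] by (assumption | rule lin)+
next
  fix \<alpha> assume a: "\<alpha> \<in> carr A"
  let ?l = "sw2 A (\<lambda>x y. sw2 A (\<lambda>u v. ptens A (tens A A) u (ptens A A v y)) x) \<alpha>"
  let ?r = "sw2 A (\<lambda>x y. sw2 A (\<lambda>u v. ptens A (tens A A) x (ptens A A u v)) y) \<alpha>"
  \<comment> \<open>Evaluation of a triple tensor at \<open>a\<close>, \<open>b\<close>,
    \<open>c\<close>, carried out one leg at a time.\<close>
  let ?E = "\<lambda>a b c t. tlift A A (\<lambda>\<beta> \<gamma>. \<langle>\<beta>, b\<rangle> * \<langle>\<gamma>, c\<rangle>) (tlift A (tens A A) (\<lambda>\<beta> w. fscale \<langle>\<beta>, a\<rangle> w) t)"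
  have ll: "linear_map X (tens A A) (\<lambda>x. fscale (\<phi> x) w)"
    if "linear_map X scalars \<phi>" "w \<in> carr (tens A A)" for X :: "('k, 'x::ab_group_add, 'y) vsp_scheme" and \<phi> w
    using lin_scl_left[OF is_vspace_tens that] by simp
  have lr: "linear_map X (tens A A) (\<lambda>x. fscale c (w x))"
    if "linear_map X (tens A A) w" for X :: "('k, 'x::ab_group_add, 'y) vsp_scheme" and c w
    using lin_scl_right[OF is_vspace_tens that] by simp
  have bl: "bilinear_map A (tens A A) (tens A A) (\<lambda>\<beta> w. fscale \<langle>\<beta>, a\<rangle> w)" for a
    by (assumption | rule lin ll lr)+
  have bl2: "bilinear_map A A scalars (\<lambda>\<beta> \<gamma>. \<langle>\<beta>, b\<rangle> * \<langle>\<gamma>, c\<rangle>)" for b c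
    by (assumption | rule lin)+
  have E: "linear_map (tens A (tens A A)) scalars (?E a b c)" for a b c
    by (rule lin_tlift_arg[OF is_vspace_A is_vspace_scalars bl2]) (assumption | rule lin bl)+
  have Ep: "?E a b c (ptens A (tens A A) u (ptens A A v w)) = \<langle>u, a\<rangle> * (\<langle>v, b\<rangle> * \<langle>w, c\<rangle>)"
    if uvw: "u \<in> carr A" "v \<in> carr A" "w \<in> carr A" for a b c u v w
    using tlift_linear[OF is_vspace_A is_vspace_scalars bl2[of b c]] uvw
    by (simp add: tlift_ptens[OF is_vspace_tens bl] tlift_ptens[OF is_vspace_scalars bl2] ptens_in_tens
        linear_mapD(3)[of "tens A A" scalars, unfolded tens_simps scalars_simps])
  have m: "?l \<in> carr (tens A (tens A A))" "?r \<in> carr (tens A (tens A A))"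
    using a by (auto intro!: swA_mem is_vspace_tens ptens_in_tens)
  have El: "?E x y z ?l = \<langle>\<alpha>, (x \<cdot> y) \<cdot> z\<rangle>" if xyz: "x \<in> carr B" "y \<in> carr B" "z \<in> carr B" for x y z
  proof -
    have "?E x y z ?l = sw2 A (\<lambda>p q. ?E x y z (sw2 A (\<lambda>u v. ptens A (tens A A) u (ptens A A v q)) p)) \<alpha>"
      by (rule swA_hom[OF is_vspace_tens E a]) (auto intro!: swA_mem is_vspace_tens ptens_in_tens)
    also have "\<dots> = sw2 A (\<lambda>p q. sw2 A (\<lambda>u v. ?E x y z (ptens A (tens A A) u (ptens A A v q))) p) \<alpha>"
      by (rule swA_cong[OF _ a], rule swA_hom[OF is_vspace_tens E]) (auto intro!: ptens_in_tens)
    also have "\<dots> = sw2 A (\<lambda>p q. sw2 A (\<lambda>u v. \<langle>u, x\<rangle> * \<langle>v, y\<rangle> * \<langle>q, z\<rangle>) p) \<alpha>"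
      by (intro swA_cong a; (assumption | simp only: Ep mult.assoc))
    also have "\<dots> = sw2 A (\<lambda>p q. sw2 A (\<lambda>u v. \<langle>u, x\<rangle> * \<langle>v, y\<rangle>) p * \<langle>q, z\<rangle>) \<alpha>"
      by (rule swA_cong[OF _ a], rule swA_hom[OF is_vspace_scalars, where X = scalars, symmetric]) (assumption | rule lin)+
    also have "\<dots> = sw2 A (\<lambda>p q. \<langle>p, x \<cdot> y\<rangle> * \<langle>q, z\<rangle>) \<alpha>"
      by (rule swA_cong[OF _ a]) (simp add: cop_A_pairing xyz)
    also have "\<dots> = \<langle>\<alpha>, (x \<cdot> y) \<cdot> z\<rangle>"
      by (simp add: cop_A_pairing a xyz B_mem)
    finally show ?thesis .
  qed
  have Er: "?E x y z ?r = \<langle>\<alpha>, x \<cdot> (y \<cdot> z)\<rangle>" if xyz: "x \<in> carr B" "y \<in> carr B" "z \<in> carr B" for x y z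
  proof -
    have "?E x y z ?r = sw2 A (\<lambda>p q. ?E x y z (sw2 A (\<lambda>u v. ptens A (tens A A) p (ptens A A u v)) q)) \<alpha>"
      by (rule swA_hom[OF is_vspace_tens E a]) (auto intro!: swA_mem is_vspace_tens ptens_in_tens)
    also have "\<dots> = sw2 A (\<lambda>p q. sw2 A (\<lambda>u v. ?E x y z (ptens A (tens A A) p (ptens A A u v))) q) \<alpha>"
      by (rule swA_cong[OF _ a], rule swA_hom[OF is_vspace_tens E]) (auto intro!: ptens_in_tens)
    also have "\<dots> = sw2 A (\<lambda>p q. sw2 A (\<lambda>u v. \<langle>p, x\<rangle> * (\<langle>u, y\<rangle> * \<langle>v, z\<rangle>)) q) \<alpha>"
      by (intro swA_cong a; (assumption | simp only: Ep))
    also have "\<dots> = sw2 A (\<lambda>p q. \<langle>p, x\<rangle> * sw2 A (\<lambda>u v. \<langle>u, y\<rangle> * \<langle>v, z\<rangle>) q) \<alpha>"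
      by (rule swA_cong[OF _ a], rule swA_hom[OF is_vspace_scalars, where X = scalars, symmetric]) (assumption | rule lin)+
    also have "\<dots> = sw2 A (\<lambda>p q. \<langle>p, x\<rangle> * \<langle>q, y \<cdot> z\<rangle>) \<alpha>"
      by (rule swA_cong[OF _ a]) (simp add: cop_A_pairing xyz)
    also have "\<dots> = \<langle>\<alpha>, x \<cdot> (y \<cdot> z)\<rangle>"
      by (simp add: cop_A_pairing a xyz B_mem)
    finally show ?thesis .
  qed
  show "?l = ?r"
  proof (rule tens_A_eqI[OF is_vspace_tens m], unfold tens_simps, rule tens_AA_eqI)
    fix x assume x: "x \<in> carr B"
    have b: "tlift A (tens A A) (\<lambda>\<beta> w. fscale \<langle>\<beta>, x\<rangle> w) t \<in> carr (tens A A)" if "t \<in> carr (tens A (tens A A))" for t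
      using linear_mapD(1)[OF tlift_linear[OF is_vspace_A is_vspace_tens bl] that] .
    show "tlift A (tens A A) (\<lambda>\<beta> w. fscale \<langle>\<beta>, x\<rangle> w) ?l \<in> carr (tens A A)"
      "tlift A (tens A A) (\<lambda>\<beta> w. fscale \<langle>\<beta>, x\<rangle> w) ?r \<in> carr (tens A A)"
      using b m by auto
    show "?E x y z ?l = ?E x y z ?r" if "y \<in> carr B" "z \<in> carr B" for y z
      using El Er x that by (simp only: B_assoc)
  qed
next
  fix \<alpha> assume a: "\<alpha> \<in> carr A"
  have l: "linear_map A scalars (\<lambda>\<alpha>. \<langle>\<alpha>, b\<rangle>)" for b by (assumption | rule lin)+
  have m: "sw2 A (\<lambda>x y. fscale \<langle>x, \<e>\<rangle> y) \<alpha> \<in> carr A" "sw2 A (\<lambda>x y. fscale \<langle>y, \<e>\<rangle> x) \<alpha> \<in> carr A"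
    using a by (auto intro!: swA_mem is_vspace_A A_scale_mem)
  show "sw2 A (\<lambda>x y. scl A (coun A x) y) \<alpha> = \<alpha>" unfolding A_simps
  proof (rule A_eqI[OF m(1) a])
    fix b assume b: "b \<in> carr B"
    have "\<langle>sw2 A (\<lambda>x y. fscale \<langle>x, \<e>\<rangle> y) \<alpha>, b\<rangle> = sw2 A (\<lambda>x y. \<langle>x, \<e>\<rangle> * \<langle>y, b\<rangle>) \<alpha>"
      by (subst swA_hom[OF is_vspace_A l a]) (auto simp: A_scale_mem pairing_simps)
    then show "\<langle>sw2 A (\<lambda>x y. fscale \<langle>x, \<e>\<rangle> y) \<alpha>, b\<rangle> = \<langle>\<alpha>, b\<rangle>"
      by (simp add: cop_A_pairing a b unit_mem B_unit)
  qed
  show "sw2 A (\<lambda>x y. scl A (coun A y) x) \<alpha> = \<alpha>" unfolding A_simps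
  proof (rule A_eqI[OF m(2) a])
    fix b assume b: "b \<in> carr B"
    have "\<langle>sw2 A (\<lambda>x y. fscale \<langle>y, \<e>\<rangle> x) \<alpha>, b\<rangle> = sw2 A (\<lambda>x y. \<langle>x, b\<rangle> * \<langle>y, \<e>\<rangle>) \<alpha>"
      by (subst swA_hom[OF is_vspace_A l a]) (auto simp: A_scale_mem pairing_simps mult.commute)
    then show "\<langle>sw2 A (\<lambda>x y. fscale \<langle>y, \<e>\<rangle> x) \<alpha>, b\<rangle> = \<langle>\<alpha>, b\<rangle>"
      by (simp add: cop_A_pairing a b unit_mem B_unit)
  qed
qed

lemmas [lin] = coalgebra_A

lemma lin_fscale_tens_left [lin]:
  "linear_map X scalars \<phi> \<Longrightarrow> w \<in> carr (tens V W) \<Longrightarrow> linear_map X (tens V W) (\<lambda>x. fscale (\<phi> x) w)"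
  using lin_scl_left[OF is_vspace_tens, of X \<phi> w V W] by simp

lemma lin_fscale_tens_right [lin]:
  "linear_map X (tens V W) f \<Longrightarrow> linear_map X (tens V W) (\<lambda>x. fscale c (f x))"
  using lin_scl_right[OF is_vspace_tens, of X V W f c] by simp

lemmas A_mem = A_mul_mem A_unit_mem antip_inv_A_mem A_scale_mem

lemma tlift_swA:
  assumes "is_vspace U" "bilinear_map A A U f" "\<alpha> \<in> carr A" "cop A \<alpha> = sw2 C (\<lambda>a b. ptens A A (p a b) (q a b)) x"
    "coalgebra C" "x \<in> carr C"
    "\<And>a b. a \<in> carr C \<Longrightarrow> b \<in> carr C \<Longrightarrow> p a b \<in> carr A \<and> q a b \<in> carr A"
  shows "sw2 A f \<alpha> = sw2 C (\<lambda>a b. f (p a b) (q a b)) x"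
  unfolding sw2_def[of A f] assms(4) by (rule tlift_sw2[OF assms(5,1) is_vspace_A assms(2,6,7)])

lemma bilinear_pairings: "bilinear_map A A scalars (\<lambda>\<beta> \<gamma>. \<langle>\<beta>, a\<rangle> * \<langle>\<gamma>, b\<rangle>)"
  by (assumption | rule lin)+

lemma swA_mul:
  assumes U: "is_vspace U" and f: "bilinear_map A A U f" and ab: "\<alpha> \<in> carr A" "\<beta> \<in> carr A"
  shows "sw2 A f (mul A \<alpha> \<beta>) =
    sw2 A (\<lambda>\<alpha>1 \<alpha>2. sw2 A (\<lambda>\<beta>1 \<beta>2. f (mul A \<alpha>1 \<beta>1) (mul A \<alpha>2 \<beta>2)) \<beta>) \<alpha>"
proof -
  note t = tlift_sw2_sw2[OF coalgebra_A coalgebra_A _ is_vspace_A _ ab]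
  have "cop A (mul A \<alpha> \<beta>) =
    sw2 A (\<lambda>\<alpha>1 \<alpha>2. sw2 A (\<lambda>\<beta>1 \<beta>2. ptens A A (mul A \<alpha>1 \<beta>1) (mul A \<alpha>2 \<beta>2)) \<beta>) \<alpha>"
  proof (rule cop_A_eqI)
    fix a b assume "a \<in> carr B" "b \<in> carr B"
    then show "tlift A A (\<lambda>\<beta> \<gamma>. \<langle>\<beta>, a\<rangle> * \<langle>\<gamma>, b\<rangle>) (sw2 A (\<lambda>\<alpha>1 \<alpha>2. sw2 A (\<lambda>\<beta>1 \<beta>2.
        ptens A A (mul A \<alpha>1 \<beta>1) (mul A \<alpha>2 \<beta>2)) \<beta>) \<alpha>) = \<langle>mul A \<alpha> \<beta>, a \<cdot> b\<rangle>"
      by (subst t[OF is_vspace_scalars bilinear_pairings]) (simp_all add: A_mem pairing_mul_mul ab)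
  qed (use ab in \<open>auto intro!: swA_mem is_vspace_tens ptens_in_tens A_mul_mem\<close>)
  then show ?thesis
    unfolding sw2_def[of A f] by (simp only:) (rule t[OF U f], simp add: A_mem)
qed

lemma swA_unit:
  assumes U: "is_vspace U" and f: "bilinear_map A A U f"
  shows "sw2 A f (unit A) = f (unit A) (unit A)"
proof -
  have "cop A (unit A) = ptens A A (unit A) (unit A)"
    by (rule cop_A_eqI[OF A_unit_mem])
      (auto simp: ptens_in_tens A_unit_mem tlift_ptens[OF is_vspace_scalars bilinear_pairings] pairing_unit
        coun_mul B_mem)
  then show ?thesis
    by (simp add: sw2_def tlift_ptens[OF U f] A_unit_mem)
qed

text \<open>The transpose of the anti-multiplicativity of \<open>T\<close>. It produces the reversed
  pair of inverse antipodes in the action formula.\<close>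

lemma swA_antip_inv:
  assumes U: "is_vspace U" and f: "bilinear_map A A U f" and a: "\<alpha> \<in> carr A"
  shows "sw2 A f (T' \<alpha>) = sw2 A (\<lambda>\<alpha>1 \<alpha>2. f (T' \<alpha>2) (T' \<alpha>1)) \<alpha>"
proof (rule tlift_swA[OF U f antip_inv_A_mem[OF a] _ coalgebra_A a])
  show "cop A (T' \<alpha>) = sw2 A (\<lambda>\<alpha>1 \<alpha>2. ptens A A (T' \<alpha>2) (T' \<alpha>1)) \<alpha>"
  proof (rule cop_A_eqI)
    fix x y assume xy: "x \<in> carr B" "y \<in> carr B"
    have "tlift A A (\<lambda>\<beta> \<gamma>. \<langle>\<beta>, x\<rangle> * \<langle>\<gamma>, y\<rangle>) (sw2 A (\<lambda>\<alpha>1 \<alpha>2. ptens A A (T' \<alpha>2) (T' \<alpha>1)) \<alpha>) =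
      sw2 A (\<lambda>\<alpha>1 \<alpha>2. \<langle>T' \<alpha>2, x\<rangle> * \<langle>T' \<alpha>1, y\<rangle>) \<alpha>"
      by (rule tlift_sw2[OF coalgebra_A is_vspace_scalars is_vspace_A bilinear_pairings a]) (simp add: A_mem)
    also have "\<dots> = sw2 A (\<lambda>\<alpha>1 \<alpha>2. \<langle>\<alpha>1, T y\<rangle> * \<langle>\<alpha>2, T x\<rangle>) \<alpha>"
      by (rule swA_cong[OF _ a]) (simp add: pairing_antip_inv xy)
    also have "\<dots> = \<langle>T' \<alpha>, x \<cdot> y\<rangle>"
      by (simp add: cop_A_pairing pairing_antip_inv antip_inv_mul B_mem xy a)
    finally show "tlift A A (\<lambda>\<beta> \<gamma>. \<langle>\<beta>, x\<rangle> * \<langle>\<gamma>, y\<rangle>) (sw2 A (\<lambda>\<alpha>1 \<alpha>2. ptens A A (T' \<alpha>2) (T' \<alpha>1)) \<alpha>) =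
      \<langle>T' \<alpha>, x \<cdot> y\<rangle>" .
  qed (use a in \<open>auto intro!: swA_mem is_vspace_tens ptens_in_tens A_mem\<close>)
qed (simp add: A_mem)

text \<open>\<open>T'\<close> is the antipode for the co-opposite coproduct, which is the one
  carried by the dual inside the Drinfeld double. Evaluated at \<open>b\<close>, each claim is a
  cancellation of \<open>T\<close> against an adjacent leg of \<open>b\<close>.\<close>

lemma swA_conv:
  assumes U: "is_vspace U" and L: "linear_map A U L" and a: "\<alpha> \<in> carr A"
  shows "sw2 A (\<lambda>\<alpha>1 \<alpha>2. L (mul A \<alpha>2 (T' \<alpha>1))) \<alpha> = scl U \<langle>\<alpha>, \<e>\<rangle> (L (unit A))"
    and "sw2 A (\<lambda>\<alpha>1 \<alpha>2. L (mul A (T' \<alpha>2) \<alpha>1)) \<alpha> = scl U \<langle>\<alpha>, \<e>\<rangle> (L (unit A))"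
proof -
  note [lin] = a
  have ev: "linear_map A scalars (\<lambda>\<beta>. \<langle>\<beta>, b\<rangle>)" for b by (assumption | rule lin)+
  have ev': "linear_map B scalars (\<lambda>b. \<langle>\<alpha>, b\<rangle>)" by (assumption | rule lin)+
  have r: "\<langle>fscale \<langle>\<alpha>, \<e>\<rangle> (unit A), b\<rangle> = \<epsilon> b * \<langle>\<alpha>, \<e>\<rangle>" if "b \<in> carr B" for b
    by (simp add: pairing_simps pairing_unit that)
  have 1: "sw2 A (\<lambda>\<alpha>1 \<alpha>2. mul A \<alpha>2 (T' \<alpha>1)) \<alpha> = fscale \<langle>\<alpha>, \<e>\<rangle> (unit A)"
  proof (rule A_eqI)
    fix b assume b: "b \<in> carr B"
    note [lin] = b
    have "\<langle>sw2 A (\<lambda>\<alpha>1 \<alpha>2. mul A \<alpha>2 (T' \<alpha>1)) \<alpha>, b\<rangle> = sw2 A (\<lambda>\<alpha>1 \<alpha>2. \<langle>mul A \<alpha>2 (T' \<alpha>1), b\<rangle>) \<alpha>"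
      by (rule swA_hom[OF is_vspace_A ev a]) (simp add: A_mem)
    also have "\<dots> = sw2 A (\<lambda>\<alpha>1 \<alpha>2. sw2 B (\<lambda>b1 b2. \<langle>\<alpha>1, T b2\<rangle> * \<langle>\<alpha>2, b1\<rangle>) b) \<alpha>"
      by (intro swA_cong a) (simp add: pairing_mul pairing_antip_inv b mult.commute cong: sw_cong)
    also have "\<dots> = sw2 B (\<lambda>b1 b2. sw2 A (\<lambda>\<alpha>1 \<alpha>2. \<langle>\<alpha>1, T b2\<rangle> * \<langle>\<alpha>2, b1\<rangle>) \<alpha>) b"
      by (rule sw2_swap)
    also have "\<dots> = sw2 B (\<lambda>b1 b2. \<langle>\<alpha>, T b2 \<cdot> b1\<rangle>) b"
      by (intro sw_cong b) (simp add: cop_A_pairing B_mem a)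
    also have "\<dots> = \<epsilon> b * \<langle>\<alpha>, \<e>\<rangle>"
      using sw_antip_inv(2)[OF is_vspace_scalars ev' b] by simp
    finally show "\<langle>sw2 A (\<lambda>\<alpha>1 \<alpha>2. mul A \<alpha>2 (T' \<alpha>1)) \<alpha>, b\<rangle> = \<langle>fscale \<langle>\<alpha>, \<e>\<rangle> (unit A), b\<rangle>"
      by (simp add: r b)
  qed (use a in \<open>auto intro!: swA_mem is_vspace_A A_mem\<close>)
  have 2: "sw2 A (\<lambda>\<alpha>1 \<alpha>2. mul A (T' \<alpha>2) \<alpha>1) \<alpha> = fscale \<langle>\<alpha>, \<e>\<rangle> (unit A)"
  proof (rule A_eqI)
    fix b assume b: "b \<in> carr B"
    note [lin] = b
    have "\<langle>sw2 A (\<lambda>\<alpha>1 \<alpha>2. mul A (T' \<alpha>2) \<alpha>1) \<alpha>, b\<rangle> = sw2 A (\<lambda>\<alpha>1 \<alpha>2. \<langle>mul A (T' \<alpha>2) \<alpha>1, b\<rangle>) \<alpha>"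
      by (rule swA_hom[OF is_vspace_A ev a]) (simp add: A_mem)
    also have "\<dots> = sw2 A (\<lambda>\<alpha>1 \<alpha>2. sw2 B (\<lambda>b1 b2. \<langle>\<alpha>1, b2\<rangle> * \<langle>\<alpha>2, T b1\<rangle>) b) \<alpha>"
      by (intro swA_cong a) (simp add: pairing_mul pairing_antip_inv b mult.commute cong: sw_cong)
    also have "\<dots> = sw2 B (\<lambda>b1 b2. sw2 A (\<lambda>\<alpha>1 \<alpha>2. \<langle>\<alpha>1, b2\<rangle> * \<langle>\<alpha>2, T b1\<rangle>) \<alpha>) b"
      by (rule sw2_swap)
    also have "\<dots> = sw2 B (\<lambda>b1 b2. \<langle>\<alpha>, b2 \<cdot> T b1\<rangle>) b"
      by (intro sw_cong b) (simp add: cop_A_pairing B_mem a)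
    also have "\<dots> = \<epsilon> b * \<langle>\<alpha>, \<e>\<rangle>"
      using sw_antip_inv(1)[OF is_vspace_scalars ev' b] by simp
    finally show "\<langle>sw2 A (\<lambda>\<alpha>1 \<alpha>2. mul A (T' \<alpha>2) \<alpha>1) \<alpha>, b\<rangle> = \<langle>fscale \<langle>\<alpha>, \<e>\<rangle> (unit A), b\<rangle>"
      by (simp add: r b)
  qed (use a in \<open>auto intro!: swA_mem is_vspace_A A_mem\<close>)
  have "L (sw2 A (\<lambda>\<alpha>1 \<alpha>2. mul A \<alpha>2 (T' \<alpha>1)) \<alpha>) = sw2 A (\<lambda>\<alpha>1 \<alpha>2. L (mul A \<alpha>2 (T' \<alpha>1))) \<alpha>"
    by (rule swA_hom[OF is_vspace_A L a]) (simp add: A_mem)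
  then show "sw2 A (\<lambda>\<alpha>1 \<alpha>2. L (mul A \<alpha>2 (T' \<alpha>1))) \<alpha> = scl U \<langle>\<alpha>, \<e>\<rangle> (L (unit A))"
    by (simp add: 1 linear_mapD(3)[OF L, unfolded A_simps(2)] A_unit_mem)
  have "L (sw2 A (\<lambda>\<alpha>1 \<alpha>2. mul A (T' \<alpha>2) \<alpha>1) \<alpha>) = sw2 A (\<lambda>\<alpha>1 \<alpha>2. L (mul A (T' \<alpha>2) \<alpha>1)) \<alpha>"
    by (rule swA_hom[OF is_vspace_A L a]) (simp add: A_mem)
  then show "sw2 A (\<lambda>\<alpha>1 \<alpha>2. L (mul A (T' \<alpha>2) \<alpha>1)) \<alpha> = scl U \<langle>\<alpha>, \<e>\<rangle> (L (unit A))"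
    by (simp add: 2 linear_mapD(3)[OF L, unfolded A_simps(2)] A_unit_mem)
qed

lemma swA_counit:
  assumes U: "is_vspace U" and f: "linear_map A U f" and c: "\<alpha> \<in> carr A"
  shows "sw2 A (\<lambda>x y. scl U \<langle>x, \<e>\<rangle> (f y)) \<alpha> = f \<alpha>"
    and "sw2 A (\<lambda>x y. scl U \<langle>y, \<e>\<rangle> (f x)) \<alpha> = f \<alpha>"
  using sw2_counit[OF coalgebra_A assms] by (simp_all add: A_simps)

section \<open>Regular actions as transposes of multiplication\<close>

lemma lreg_eq: "lreg B b \<beta> = sw2 A (\<lambda>\<beta>1 \<beta>2. fscale \<langle>\<beta>2, b\<rangle> \<beta>1) \<beta>"
  by (simp add: lreg_def pairing_def)

lemma rreg_eq: "rreg B \<beta> b = sw2 A (\<lambda>\<beta>1 \<beta>2. fscale \<langle>\<beta>1, b\<rangle> \<beta>2) \<beta>"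
  by (simp add: rreg_def pairing_def)

lemma rreg_dual_eq: "rreg_dual B b \<beta> = sw2 B (\<lambda>b1 b2. scl B \<langle>\<beta>, b1\<rangle> b2) b"
  by (simp add: rreg_dual_def pairing_def)

lemma lreg_bilinear: "bilinear_map B A A (lreg B)"
  unfolding lreg_eq[abs_def] by (assumption | rule lin)+

lemma rreg_bilinear: "bilinear_map A B A (rreg B)"
  unfolding rreg_eq[abs_def] by (assumption | rule lin)+

lemma rreg_dual_bilinear: "bilinear_map B A B (rreg_dual B)"
  unfolding rreg_dual_eq[abs_def] by (assumption | rule lin)+

lemmas [lin] = bilinear_mapD[OF lreg_bilinear] bilinear_mapD[OF rreg_bilinear] bilinear_mapD[OF rreg_dual_bilinear]
lemmas reg_mem = bilinear_mapD(3)[OF lreg_bilinear] bilinear_mapD(3)[OF rreg_bilinear]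
  bilinear_mapD(3)[OF rreg_dual_bilinear]

text \<open>The left regular action is the transpose of right multiplication, and the right one that
  of left multiplication. In this form the laws of the regular actions are associativity and unit
  laws of \<open>B\<close>.\<close>

lemma pairing_lreg:
  assumes "b \<in> carr B" "c \<in> carr B" "\<beta> \<in> carr A"
  shows "\<langle>lreg B b \<beta>, c\<rangle> = \<langle>\<beta>, c \<cdot> b\<rangle>"
proof -
  have ev: "linear_map A scalars (\<lambda>\<beta>. \<langle>\<beta>, c\<rangle>)" by (assumption | rule lin)+
  have "\<langle>lreg B b \<beta>, c\<rangle> = sw2 A (\<lambda>\<beta>1 \<beta>2. \<langle>fscale \<langle>\<beta>2, b\<rangle> \<beta>1, c\<rangle>) \<beta>"
    unfolding lreg_eq by (rule swA_hom[OF is_vspace_A ev]) (simp_all add: A_mem assms)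
  also have "\<dots> = \<langle>\<beta>, c \<cdot> b\<rangle>"
    by (simp add: pairing_simps mult.commute[of "\<langle>_, b\<rangle>"] cop_A_pairing assms)
  finally show ?thesis .
qed

lemma pairing_rreg:
  assumes "b \<in> carr B" "c \<in> carr B" "\<beta> \<in> carr A"
  shows "\<langle>rreg B \<beta> b, c\<rangle> = \<langle>\<beta>, b \<cdot> c\<rangle>"
proof -
  have ev: "linear_map A scalars (\<lambda>\<beta>. \<langle>\<beta>, c\<rangle>)" by (assumption | rule lin)+
  have "\<langle>rreg B \<beta> b, c\<rangle> = sw2 A (\<lambda>\<beta>1 \<beta>2. \<langle>fscale \<langle>\<beta>1, b\<rangle> \<beta>2, c\<rangle>) \<beta>"
    unfolding rreg_eq by (rule swA_hom[OF is_vspace_A ev]) (simp_all add: A_mem assms)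
  also have "\<dots> = \<langle>\<beta>, b \<cdot> c\<rangle>"
    by (simp add: pairing_simps cop_A_pairing assms)
  finally show ?thesis .
qed

lemma lreg_unit: "\<beta> \<in> carr A \<Longrightarrow> lreg B \<e> \<beta> = \<beta>"
  and rreg_unit: "\<beta> \<in> carr A \<Longrightarrow> rreg B \<beta> \<e> = \<beta>"
  and lreg_counit: "b \<in> carr B \<Longrightarrow> lreg B b (unit A) = fscale (\<epsilon> b) (unit A)"
  and rreg_counit: "b \<in> carr B \<Longrightarrow> rreg B (unit A) b = fscale (\<epsilon> b) (unit A)"
  by (rule A_eqI; simp add: reg_mem A_mem unit_mem pairing_lreg pairing_rreg B_unit pairing_unit
      pairing_simps coun_mul B_mem)+

lemma lreg_rreg:
  "\<beta> \<in> carr A \<Longrightarrow> b \<in> carr B \<Longrightarrow> c \<in> carr B \<Longrightarrow> rreg B (lreg B b \<beta>) c = lreg B b (rreg B \<beta> c)"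
  by (rule A_eqI) (simp_all add: reg_mem pairing_lreg pairing_rreg B_mem B_assoc)

text \<open>Right multiplication by \<open>b\<close> affects only the right factor of a product, so
  the transposed action touches only the last leg of the coproduct.\<close>

lemma swA_lreg:
  assumes U: "is_vspace U" and f: "bilinear_map A A U f" and b: "b \<in> carr B" and \<beta>: "\<beta> \<in> carr A"
  shows "sw2 A f (lreg B b \<beta>) = sw2 A (\<lambda>\<beta>1 \<beta>2. f \<beta>1 (lreg B b \<beta>2)) \<beta>"
proof (rule tlift_swA[OF U f _ _ coalgebra_A \<beta>])
  show "cop A (lreg B b \<beta>) = sw2 A (\<lambda>\<beta>1 \<beta>2. ptens A A \<beta>1 (lreg B b \<beta>2)) \<beta>"
  proof (rule cop_A_eqI)
    fix x y assume xy: "x \<in> carr B" "y \<in> carr B"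
    have "tlift A A (\<lambda>\<beta> \<gamma>. \<langle>\<beta>, x\<rangle> * \<langle>\<gamma>, y\<rangle>) (sw2 A (\<lambda>\<beta>1 \<beta>2. ptens A A \<beta>1 (lreg B b \<beta>2)) \<beta>) =
      sw2 A (\<lambda>\<beta>1 \<beta>2. \<langle>\<beta>1, x\<rangle> * \<langle>lreg B b \<beta>2, y\<rangle>) \<beta>"
      by (rule tlift_sw2[OF coalgebra_A is_vspace_scalars is_vspace_A bilinear_pairings \<beta>]) (simp add: reg_mem b)
    also have "\<dots> = sw2 A (\<lambda>\<beta>1 \<beta>2. \<langle>\<beta>1, x\<rangle> * \<langle>\<beta>2, y \<cdot> b\<rangle>) \<beta>"
      by (rule swA_cong[OF _ \<beta>]) (simp add: pairing_lreg xy b)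
    also have "\<dots> = \<langle>lreg B b \<beta>, x \<cdot> y\<rangle>"
      by (simp add: cop_A_pairing pairing_lreg B_assoc B_mem xy b \<beta>)
    finally show "tlift A A (\<lambda>\<beta> \<gamma>. \<langle>\<beta>, x\<rangle> * \<langle>\<gamma>, y\<rangle>) (sw2 A (\<lambda>\<beta>1 \<beta>2. ptens A A \<beta>1 (lreg B b \<beta>2)) \<beta>) =
      \<langle>lreg B b \<beta>, x \<cdot> y\<rangle>" .
  qed (use b \<beta> in \<open>auto intro!: swA_mem is_vspace_tens ptens_in_tens simp: reg_mem\<close>)
qed (simp_all add: reg_mem b \<beta>)

text \<open>Acting by \<open>d\<close> at the end of \<open>\<nu>1\<close> or at the beginning of
  \<open>\<nu>2\<close> pairs \<open>d\<close> with the same middle leg of \<open>\<nu>\<close>.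
  This moves a leg of \<open>m\<close> from the Heisenberg factor next to the inverse antipode in
  the Drinfeld factor.\<close>

lemma swA_lreg_rreg:
  assumes U: "is_vspace U" and f: "bilinear_map A A U f" and \<nu>: "\<nu> \<in> carr A"
    and s: "s \<in> carr B" and d: "d \<in> carr B"
  shows "sw2 A (\<lambda>\<nu>1 \<nu>2. f (rreg B \<nu>2 s) (lreg B d \<nu>1)) \<nu> =
    sw2 A (\<lambda>\<nu>1 \<nu>2. f (rreg B \<nu>2 (d \<cdot> s)) \<nu>1) \<nu>"
proof -
  note [lin] = U bilinear_mapD[OF f] \<nu> s d
  have "sw2 A (\<lambda>\<nu>1 \<nu>2. f (rreg B \<nu>2 s) (lreg B d \<nu>1)) \<nu> =
    sw2 A (\<lambda>\<nu>1 \<nu>2. sw2 A (\<lambda>p q. f (rreg B \<nu>2 s) (fscale \<langle>q, d\<rangle> p)) \<nu>1) \<nu>"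
    unfolding lreg_eq
    by (rule swA_cong, rule swA_hom[OF is_vspace_A, where g = "f _"]) (assumption | rule lin)+
  also have "\<dots> = sw2 A (\<lambda>p k. sw2 A (\<lambda>q \<nu>2. f (rreg B \<nu>2 s) (fscale \<langle>q, d\<rangle> p)) k) \<nu>"
    by (rule sw2_coassoc[OF coalgebra_A U]) (assumption | rule lin)+
  also have "\<dots> = sw2 A (\<lambda>p k. f (rreg B k (d \<cdot> s)) p) \<nu>"
  proof (rule swA_cong[OF _ \<nu>])
    fix p k assume p: "p \<in> carr A" and k: "k \<in> carr A"
    note [lin] = p k
    have sc: "f v (fscale c p) = f (fscale c v) p" if "v \<in> carr A" for c v
      using f p that by (simp add: bilinear_map_def linear_map_def A_simps(2))
    have l: "linear_map A U (\<lambda>v. f v p)" by (assumption | rule lin)+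
    have "sw2 A (\<lambda>q \<nu>2. f (rreg B \<nu>2 s) (fscale \<langle>q, d\<rangle> p)) k =
      sw2 A (\<lambda>q \<nu>2. f (fscale \<langle>q, d\<rangle> (rreg B \<nu>2 s)) p) k"
      by (rule swA_cong[OF _ k]) (simp add: sc reg_mem s)
    also have "\<dots> = f (sw2 A (\<lambda>q \<nu>2. fscale \<langle>q, d\<rangle> (rreg B \<nu>2 s)) k) p"
      by (rule swA_hom[OF is_vspace_A l k, symmetric]) (simp add: A_mem reg_mem s)
    also have "sw2 A (\<lambda>q \<nu>2. fscale \<langle>q, d\<rangle> (rreg B \<nu>2 s)) k = rreg B (rreg B k d) s"
      unfolding rreg_eq[of k]
      by (subst swA_hom[where g = "\<lambda>v. rreg B v s", OF is_vspace_A _ k])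
        (auto simp: A_mem s linear_mapD(3)[OF bspec[OF conjunct2[OF rreg_bilinear[unfolded bilinear_map_def]]], unfolded A_simps(2)]
          intro!: swA_cong k lin)
    also have "\<dots> = rreg B k (d \<cdot> s)"
      by (rule A_eqI) (simp_all add: reg_mem pairing_rreg B_mem B_assoc s d k)
    finally show "sw2 A (\<lambda>q \<nu>2. f (rreg B \<nu>2 s) (fscale \<langle>q, d\<rangle> p)) k = f (rreg B k (d \<cdot> s)) p" .
  qed
  finally show ?thesis .
qed

lemma coun_antip_inv: "x \<in> carr B \<Longrightarrow> \<epsilon> (T x) = \<epsilon> x"
proof -
  have S: "\<epsilon> (S x) = \<epsilon> x" if x: "x \<in> carr B" for x
  proof -
    have l: "linear_map B scalars (\<lambda>y. \<epsilon> (S y))" by (assumption | rule lin)+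
    have "\<epsilon> (S x) = sw2 B (\<lambda>a b. \<epsilon> a * \<epsilon> (S b)) x"
      using sw2_counit(1)[OF coalgebra_B is_vspace_scalars l x] by simp
    also have "\<dots> = sw2 B (\<lambda>a b. \<epsilon> (a \<cdot> S b)) x"
      by (rule sw_cong[OF _ x]) (simp add: coun_mul B_mem)
    also have "\<dots> = \<epsilon> x"
      using sw_antip(1)[OF is_vspace_scalars coalgB(3) x] by (simp add: coun_unit)
    finally show ?thesis .
  qed
  show "x \<in> carr B \<Longrightarrow> \<epsilon> (T x) = \<epsilon> x"
    using S[of "T x"] by (simp add: antip_antip_inv antip_inv_mem)
qed


section \<open>The Heisenberg double\<close>

abbreviation "W \<equiv> tens A B"
abbreviation "HH \<equiv> heisenberg_double B"
abbreviation "DD \<equiv> drinfeld_double B"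
abbreviation pure (infixl "\<sharp>" 65) where "\<alpha> \<sharp> a \<equiv> ptens A B \<alpha> a"

lemma pure_mem: "\<alpha> \<in> carr A \<Longrightarrow> a \<in> carr B \<Longrightarrow> \<alpha> \<sharp> a \<in> carr W"
  by (rule ptens_in_tens)

lemma pure_scale:
  assumes "\<alpha> \<in> carr A" "a \<in> carr B"
  shows "fscale c \<alpha> \<sharp> a = fscale c (\<alpha> \<sharp> a)" "\<alpha> \<sharp> scl B c a = fscale c (\<alpha> \<sharp> a)"
  using assms ptens_bilinear[of A B] by (auto simp: bilinear_map_def linear_map_def A_simps(2))

lemma HH_simps:
  "carr HH = carr W" "scl HH = fscale" "unit HH = unit A \<sharp> \<e>"
  by (simp_all add: heisenberg_double_def)

lemma DD_simps:
  "carr DD = carr W" "scl DD = fscale" "unit DD = unit A \<sharp> \<e>"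
  by (simp_all add: drinfeld_double_def)

definition hpure :: "('b \<Rightarrow> 'k) \<Rightarrow> 'b \<Rightarrow> ('b \<Rightarrow> 'k) \<Rightarrow> 'b \<Rightarrow> ('k, 'b) dbl" where
  "hpure \<alpha> a \<beta> b = sw2 B (\<lambda>a1 a2. mul A \<alpha> (lreg B a1 \<beta>) \<sharp> a2 \<cdot> b) a"

lemma hpure_linear:
  shows "linear_map X A g \<Longrightarrow> a \<in> carr B \<Longrightarrow> \<beta> \<in> carr A \<Longrightarrow> b \<in> carr B \<Longrightarrow> linear_map X W (\<lambda>x. hpure (g x) a \<beta> b)"
    and "\<alpha> \<in> carr A \<Longrightarrow> linear_map X B g' \<Longrightarrow> \<beta> \<in> carr A \<Longrightarrow> b \<in> carr B \<Longrightarrow> linear_map X W (\<lambda>x. hpure \<alpha> (g' x) \<beta> b)"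
    and "\<alpha> \<in> carr A \<Longrightarrow> a \<in> carr B \<Longrightarrow> linear_map X A g \<Longrightarrow> b \<in> carr B \<Longrightarrow> linear_map X W (\<lambda>x. hpure \<alpha> a (g x) b)"
    and "\<alpha> \<in> carr A \<Longrightarrow> a \<in> carr B \<Longrightarrow> \<beta> \<in> carr A \<Longrightarrow> linear_map X B g' \<Longrightarrow> linear_map X W (\<lambda>x. hpure \<alpha> a \<beta> (g' x))"
  unfolding hpure_def by (assumption | rule lin)+

lemma mul_HH: "mul HH s t = tlift A B (\<lambda>\<alpha> a. tlift A B (\<lambda>\<beta> b. hpure \<alpha> a \<beta> b) t) s"
  by (simp add: heisenberg_double_def hpure_def)

lemma HH_bilinear: "bilinear_map W W W (mul HH)"
  unfolding mul_HH[abs_def] by (assumption | rule lin hpure_linear)+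

lemma HH_pure:
  assumes "\<alpha> \<in> carr A" "a \<in> carr B" "\<beta> \<in> carr A" "b \<in> carr B"
  shows "mul HH (\<alpha> \<sharp> a) (\<beta> \<sharp> b) = hpure \<alpha> a \<beta> b"
proof -
  have "mul HH (\<alpha> \<sharp> a) (\<beta> \<sharp> b) = tlift A B (\<lambda>\<beta> b. hpure \<alpha> a \<beta> b) (\<beta> \<sharp> b)"
    unfolding mul_HH by (rule tlift_ptens[where U = W]) (assumption | rule lin hpure_linear assms)+
  also have "\<dots> = hpure \<alpha> a \<beta> b"
    by (rule tlift_ptens[where U = W]) (assumption | rule lin hpure_linear assms)+
  finally show ?thesis .
qed

text \<open>
  Associativity is read off from the right action \<open>c \<mapsto> \<langle>\<alpha>, c'\<rangle> c'' a\<close> of \<open>\<alpha> # a\<close> on \<open>B\<close>, the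
  transpose of the natural action on \<open>B\<^sup>*\<close>.  It is faithful even when \<open>B\<^sup>*\<close> does not separate \<open>B\<close>.
\<close>

definition ract :: "('k, 'b) dbl \<Rightarrow> 'b \<Rightarrow> 'b" where
  "ract x c = tlift A B (\<lambda>\<alpha> a. sw2 B (\<lambda>c1 c2. scl B \<langle>\<alpha>, c1\<rangle> (c2 \<cdot> a)) c) x"

lemma ract_bilinear: "bilinear_map W B B ract"
  unfolding ract_def[abs_def] by (assumption | rule lin)+

lemmas ract_lin = bilinear_mapD[OF ract_bilinear]

lemma ract_pure:
  assumes "\<alpha> \<in> carr A" "a \<in> carr B" "c \<in> carr B"
  shows "ract (\<alpha> \<sharp> a) c = sw2 B (\<lambda>c1 c2. scl B \<langle>\<alpha>, c1\<rangle> (c2 \<cdot> a)) c"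
  unfolding ract_def by (rule tlift_ptens[where U = B]) (assumption | rule lin assms)+

lemma scl_mul:
  assumes "x \<in> carr B" "y \<in> carr B"
  shows "scl B c x \<cdot> y = scl B c (x \<cdot> y)" "x \<cdot> scl B c y = scl B c (x \<cdot> y)"
  using mul_B assms by (auto simp: bilinear_map_def linear_map_def)

text \<open>Acting successively on \<open>c\<close>, the second pure tensor sees the coproduct of
  \<open>k \<cdot> a\<close>. Its legs carry exactly the \<open>a1\<close> that acts on \<beta> and
  the \<open>a2\<close> that multiplies \<open>b\<close> in the smash product. The order is reversed
  because this is a right action.\<close>

lemma ract_mul_pure:
  assumes \<alpha>: "\<alpha> \<in> carr A" and a: "a \<in> carr B" and \<beta>: "\<beta> \<in> carr A" and b: "b \<in> carr B" and c: "c \<in> carr B"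
  shows "ract (hpure \<alpha> a \<beta> b) c = ract (\<beta> \<sharp> b) (ract (\<alpha> \<sharp> a) c)"
proof -
  note V = coalgB(1)
  note [lin] = assms
  have "ract (hpure \<alpha> a \<beta> b) c = sw2 B (\<lambda>a1 a2. ract (mul A \<alpha> (lreg B a1 \<beta>) \<sharp> a2 \<cdot> b) c) a"
    unfolding hpure_def
    by (rule sw_hom[OF is_vspace_tens, where g = "\<lambda>x. ract x c"]) (assumption | rule lin ract_lin)+
  also have "\<dots> = sw2 B (\<lambda>a1 a2. sw2 B (\<lambda>c1 c2.
      scl B (sw2 B (\<lambda>p q. \<langle>\<alpha>, p\<rangle> * \<langle>\<beta>, q \<cdot> a1\<rangle>) c1) (c2 \<cdot> (a2 \<cdot> b))) c) a"
    by (intro sw_cong a c) (simp add: ract_pure B_mem reg_mem A_mem assms pairing_mul pairing_lreg cong: sw_cong)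
  also have "\<dots> = sw2 B (\<lambda>a1 a2. sw2 B (\<lambda>c1 c2. sw2 B (\<lambda>p q.
      scl B (\<langle>\<alpha>, p\<rangle> * \<langle>\<beta>, q \<cdot> a1\<rangle>) (c2 \<cdot> (a2 \<cdot> b))) c1) c) a"
    by (rule sw_cong, rule sw_cong, rule sw_hom[OF is_vspace_scalars]) (assumption | rule lin)+
  also have "\<dots> = sw2 B (\<lambda>a1 a2. sw2 B (\<lambda>p k. sw2 B (\<lambda>q c2.
      scl B (\<langle>\<alpha>, p\<rangle> * \<langle>\<beta>, q \<cdot> a1\<rangle>) (c2 \<cdot> (a2 \<cdot> b))) k) c) a"
    by (rule sw_cong, rule sw2_coassoc[OF coalgebra_B V]) (assumption | rule lin)+
  also have "\<dots> = sw2 B (\<lambda>p k. sw2 B (\<lambda>a1 a2. sw2 B (\<lambda>q c2.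
      scl B (\<langle>\<alpha>, p\<rangle> * \<langle>\<beta>, q \<cdot> a1\<rangle>) (c2 \<cdot> (a2 \<cdot> b))) k) a) c"
    by (rule sw2_swap)
  also have "\<dots> = sw2 B (\<lambda>p k. sw2 B (\<lambda>q c2. sw2 B (\<lambda>a1 a2.
      scl B (\<langle>\<alpha>, p\<rangle> * \<langle>\<beta>, q \<cdot> a1\<rangle>) (c2 \<cdot> (a2 \<cdot> b))) a) k) c"
    by (rule sw_cong[OF sw2_swap c])
  also have "\<dots> = sw2 B (\<lambda>p k. sw2 B (\<lambda>q c2. sw2 B (\<lambda>a1 a2.
      scl B \<langle>\<alpha>, p\<rangle> (scl B \<langle>\<beta>, q \<cdot> a1\<rangle> ((c2 \<cdot> a2) \<cdot> b))) a) k) c"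
    by (intro sw_cong a c; (assumption | simp add: is_vspaceD'(2)[OF V] B_assoc b))
  also have "\<dots> = sw2 B (\<lambda>p k. sw2 B (\<lambda>q c2. scl B \<langle>\<alpha>, p\<rangle> (sw2 B (\<lambda>a1 a2.
      scl B \<langle>\<beta>, q \<cdot> a1\<rangle> ((c2 \<cdot> a2) \<cdot> b)) a)) k) c"
    by (rule sw_cong, rule sw_cong, rule sw_hom[OF V, symmetric]) (assumption | rule lin)+
  also have "\<dots> = sw2 B (\<lambda>p k. scl B \<langle>\<alpha>, p\<rangle> (sw2 B (\<lambda>q c2. sw2 B (\<lambda>a1 a2.
      scl B \<langle>\<beta>, q \<cdot> a1\<rangle> ((c2 \<cdot> a2) \<cdot> b)) a) k)) c"
    by (rule sw_cong, rule sw_hom[OF V, symmetric]) (assumption | rule lin)+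
  also have "\<dots> = sw2 B (\<lambda>p k. scl B \<langle>\<alpha>, p\<rangle> (sw2 B (\<lambda>u v. scl B \<langle>\<beta>, u\<rangle> (v \<cdot> b)) (k \<cdot> a))) c"
    by (rule sw_cong, rule arg_cong[where f = "scl B _"], rule sw_mul[OF V, symmetric]) (assumption | rule lin)+
  also have "\<dots> = sw2 B (\<lambda>p k. scl B \<langle>\<alpha>, p\<rangle> (ract (\<beta> \<sharp> b) (k \<cdot> a))) c"
    by (rule sw_cong[OF _ c]) (simp add: ract_pure B_mem assms)
  also have "\<dots> = sw2 B (\<lambda>p k. ract (\<beta> \<sharp> b) (scl B \<langle>\<alpha>, p\<rangle> (k \<cdot> a))) c"
    using linear_mapD(3)[OF ract_lin(2)[OF lin_id pure_mem[OF \<beta> b]]]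
    by (intro sw_cong c) (simp add: B_mem a)
  also have "\<dots> = ract (\<beta> \<sharp> b) (ract (\<alpha> \<sharp> a) c)"
    unfolding ract_pure[OF \<alpha> a c]
    by (rule sw_hom[OF V, symmetric]) (assumption | rule lin ract_lin pure_mem)+
  finally show ?thesis .
qed

lemma ract_mul:
  assumes x: "x \<in> carr W" and y: "y \<in> carr W" and c: "c \<in> carr B"
  shows "ract (mul HH x y) c = ract y (ract x c)"
proof (rule bilinear_eqI[where f = "\<lambda>x y. ract (mul HH x y) c" and g = "\<lambda>x y. ract y (ract x c)",
      OF is_vspace_A is_vspace_A coalgB(1)])
  show "bilinear_map W W B (\<lambda>x y. ract (mul HH x y) c)"
    by (assumption | rule lin ract_lin bilinear_mapD[OF HH_bilinear] c)+
  show "bilinear_map W W B (\<lambda>x y. ract y (ract x c))"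
    by (assumption | rule lin ract_lin c)+
qed (simp_all add: HH_pure ract_mul_pure x y c)

text \<open>The tensor can be recovered from its action: multiplying \<open>ract z d1\<close> on the
  left by \<open>T d2\<close> cancels the leg of \<open>c\<close> left over by the pairing, and what
  remains is the evaluation of the first leg of \<open>z\<close> at \<open>c\<close>. Those
  evaluations separate tensors by \<open>tens_A_eqI\<close>.\<close>

lemma ract_faithful:
  assumes x: "x \<in> carr W" and y: "y \<in> carr W" and eq: "\<And>c. c \<in> carr B \<Longrightarrow> ract x c = ract y c"
  shows "x = y"
proof (rule tens_A_eqI[OF coalgB(1) x y])
  note V = coalgB(1)
  fix c assume c: "c \<in> carr B"
  have "tlift A B (\<lambda>\<beta> w. scl B \<langle>\<beta>, c\<rangle> w) z = sw2 B (\<lambda>d1 d2. T d2 \<cdot> ract z d1) c" if z: "z \<in> carr W" for z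
  proof (rule tens_eqI[where f = "tlift A B (\<lambda>\<beta> w. scl B \<langle>\<beta>, c\<rangle> w)"
        and g = "\<lambda>z. sw2 B (\<lambda>d1 d2. T d2 \<cdot> ract z d1) c", OF is_vspace_A V _ _ _ z])
    show "linear_map W B (tlift A B (\<lambda>\<beta> w. scl B \<langle>\<beta>, c\<rangle> w))"
      by (rule tlift_linear) (assumption | rule lin c)+
    show "linear_map W B (\<lambda>z. sw2 B (\<lambda>d1 d2. T d2 \<cdot> ract z d1) c)"
      by (assumption | rule lin ract_lin c)+
    fix \<alpha> a assume \<alpha>: "\<alpha> \<in> carr A" and a: "a \<in> carr B"
    note [lin] = \<alpha> a c
    have "sw2 B (\<lambda>d1 d2. T d2 \<cdot> ract (\<alpha> \<sharp> a) d1) c =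
      sw2 B (\<lambda>d1 d2. T d2 \<cdot> sw2 B (\<lambda>p q. scl B \<langle>\<alpha>, p\<rangle> (q \<cdot> a)) d1) c"
      by (rule sw_cong[OF _ c]) (simp add: ract_pure \<alpha> a)
    also have "\<dots> = sw2 B (\<lambda>d1 d2. sw2 B (\<lambda>p q. T d2 \<cdot> scl B \<langle>\<alpha>, p\<rangle> (q \<cdot> a)) d1) c"
      by (rule sw_cong, rule sw_hom[OF V]) (assumption | rule lin)+
    also have "\<dots> = sw2 B (\<lambda>d1 d2. sw2 B (\<lambda>p q. scl B \<langle>\<alpha>, p\<rangle> ((T d2 \<cdot> q) \<cdot> a)) d1) c"
      by (intro sw_cong c; (assumption | simp add: scl_mul B_assoc B_mem a))
    also have "\<dots> = sw2 B (\<lambda>p k. sw2 B (\<lambda>q d2. scl B \<langle>\<alpha>, p\<rangle> ((T d2 \<cdot> q) \<cdot> a)) k) c"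
      by (rule sw2_coassoc[OF coalgebra_B V]) (assumption | rule lin)+
    also have "\<dots> = sw2 B (\<lambda>p k. scl B (\<epsilon> k) (scl B \<langle>\<alpha>, p\<rangle> (\<e> \<cdot> a))) c"
      by (rule sw_cong, rule sw_antip_inv(2)[OF V]) (assumption | rule lin)+
    also have "\<dots> = scl B \<langle>\<alpha>, c\<rangle> (\<e> \<cdot> a)"
      by (rule sw2_counit(2)[OF coalgebra_B V]) (assumption | rule lin)+
    also have "\<dots> = tlift A B (\<lambda>\<beta> w. scl B \<langle>\<beta>, c\<rangle> w) (\<alpha> \<sharp> a)"
      by (subst tlift_ptens[OF V]) (simp_all add: B_unit \<alpha> a, (assumption | rule lin)+)
    finally show "tlift A B (\<lambda>\<beta> w. scl B \<langle>\<beta>, c\<rangle> w) (\<alpha> \<sharp> a) = sw2 B (\<lambda>d1 d2. T d2 \<cdot> ract (\<alpha> \<sharp> a) d1) c"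
      by simp
  qed
  note rec = this
  show "tlift A B (\<lambda>\<beta> w. scl B \<langle>\<beta>, c\<rangle> w) x = tlift A B (\<lambda>\<beta> w. scl B \<langle>\<beta>, c\<rangle> w) y"
    unfolding rec[OF x] rec[OF y] by (rule sw_cong[OF _ c]) (simp add: eq)
qed

lemma HH_mem: "x \<in> carr W \<Longrightarrow> y \<in> carr W \<Longrightarrow> mul HH x y \<in> carr W"
  by (rule bilinear_mapD(3)[OF HH_bilinear])

lemma HH_assoc:
  "x \<in> carr W \<Longrightarrow> y \<in> carr W \<Longrightarrow> z \<in> carr W \<Longrightarrow> mul HH (mul HH x y) z = mul HH x (mul HH y z)"
  by (rule ract_faithful) (simp_all add: HH_mem ract_mul ract_lin(3))

lemma ract_unit: "c \<in> carr B \<Longrightarrow> ract (unit A \<sharp> \<e>) c = c"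
  using sw2_counit(1)[OF coalgebra_B coalgB(1) lin_id, of c]
  by (simp add: ract_pure A_mem unit_mem pairing_unit B_unit cong: sw_cong)

lemma algebra_HH: "algebra HH"
proof -
  have "is_vspace HH" using is_vspace_tens[of A B] by (simp add: is_vspace_def HH_simps)
  moreover have "bilinear_map HH HH HH (mul HH)"
    using HH_bilinear by (simp add: bilinear_map_def linear_map_def HH_simps)
  moreover have "mul HH (unit A \<sharp> \<e>) x = x \<and> mul HH x (unit A \<sharp> \<e>) = x" if "x \<in> carr W" for x
    using that by (auto intro!: ract_faithful simp: HH_mem ract_mul pure_mem A_mem unit_mem ract_unit ract_lin(3))
  ultimately show ?thesis
    by (simp add: algebra_def HH_simps HH_assoc pure_mem A_mem unit_mem)
qed

section \<open>Products with the subalgebras \<open>B\<^sup>*\<close> and \<open>B\<close> of the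
  Heisenberg double\<close>

lemma HH_pure_B:
  assumes "\<alpha> \<in> carr A" "a \<in> carr B" "b \<in> carr B"
  shows "mul HH (\<alpha> \<sharp> a) (unit A \<sharp> b) = \<alpha> \<sharp> a \<cdot> b"
proof -
  note [lin] = assms
  have "mul HH (\<alpha> \<sharp> a) (unit A \<sharp> b) = sw2 B (\<lambda>a1 a2. mul A \<alpha> (fscale (\<epsilon> a1) (unit A)) \<sharp> a2 \<cdot> b) a"
    by (simp add: HH_pure A_mem assms hpure_def lreg_counit cong: sw_cong)
  also have "\<dots> = sw2 B (\<lambda>a1 a2. fscale (\<epsilon> a1) (\<alpha> \<sharp> a2 \<cdot> b)) a"
    using A_mul_bilinear assms
    by (intro sw_cong) (simp_all add: bilinear_map_def linear_map_def A_simps(2) A_mem A_unit pure_scale B_mem)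
  also have "\<dots> = \<alpha> \<sharp> a \<cdot> b"
    using sw2_counit(1)[OF coalgebra_B is_vspace_tens, of A B "\<lambda>x. \<alpha> \<sharp> x \<cdot> b" a]
      lin_ptens(2)[OF bilinear_mapD(1)[OF mul_B lin_id assms(3)] assms(1)] assms(2) by simp
  finally show ?thesis .
qed

lemma HH_A_pure:
  assumes "\<alpha> \<in> carr A" "\<beta> \<in> carr A" "b \<in> carr B"
  shows "mul HH (\<alpha> \<sharp> \<e>) (\<beta> \<sharp> b) = mul A \<alpha> \<beta> \<sharp> b"
proof -
  have "mul HH (\<alpha> \<sharp> \<e>) (\<beta> \<sharp> b) = mul A \<alpha> (lreg B \<e> \<beta>) \<sharp> \<e> \<cdot> b"
    unfolding HH_pure[OF assms(1) unit_mem assms(2,3)] hpure_def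
    by (rule sw_unit[OF is_vspace_tens]) (assumption | rule lin assms)+
  then show ?thesis by (simp add: lreg_unit B_unit assms)
qed

text \<open>The scalar pairing \<open>\<nu>2\<close> with \<open>b1\<close> is moved from the first
  tensor factor to the second. The left regular action on \<nu> thereby becomes the right regular
  action on \<open>b\<close>, the form that appears in the action of the theorem.\<close>

lemma HH_pure_A:
  assumes "\<beta> \<in> carr A" "b \<in> carr B" "\<nu> \<in> carr A"
  shows "mul HH (\<beta> \<sharp> b) (\<nu> \<sharp> \<e>) = sw2 A (\<lambda>\<nu>1 \<nu>2. mul A \<beta> \<nu>1 \<sharp> rreg_dual B b \<nu>2) \<nu>"
proof -
  note [lin] = assms
  have "mul HH (\<beta> \<sharp> b) (\<nu> \<sharp> \<e>) = sw2 B (\<lambda>b1 b2. mul A \<beta> (lreg B b1 \<nu>) \<sharp> b2) b"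
    by (simp add: HH_pure assms unit_mem hpure_def B_unit cong: sw_cong)
  also have "\<dots> = sw2 B (\<lambda>b1 b2. sw2 A (\<lambda>\<nu>1 \<nu>2. mul A \<beta> (fscale \<langle>\<nu>2, b1\<rangle> \<nu>1) \<sharp> b2) \<nu>) b"
    unfolding lreg_eq
    by (rule sw_cong, rule swA_hom[OF is_vspace_A, where g = "\<lambda>x. mul A \<beta> x \<sharp> _"]) (assumption | rule lin)+
  also have "\<dots> = sw2 A (\<lambda>\<nu>1 \<nu>2. sw2 B (\<lambda>b1 b2. mul A \<beta> (fscale \<langle>\<nu>2, b1\<rangle> \<nu>1) \<sharp> b2) b) \<nu>"
    by (rule sw2_swap)
  also have "\<dots> = sw2 A (\<lambda>\<nu>1 \<nu>2. sw2 B (\<lambda>b1 b2. mul A \<beta> \<nu>1 \<sharp> scl B \<langle>\<nu>2, b1\<rangle> b2) b) \<nu>"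
    using A_mul_bilinear assms
    by (intro swA_cong sw_cong)
      (simp_all add: bilinear_map_def linear_map_def A_simps(2) A_mem pure_scale)
  also have "\<dots> = sw2 A (\<lambda>\<nu>1 \<nu>2. mul A \<beta> \<nu>1 \<sharp> rreg_dual B b \<nu>2) \<nu>"
    unfolding rreg_dual_eq
    by (rule swA_cong, rule sw_hom[OF coalgB(1), where g = "\<lambda>x. _ \<sharp> x", symmetric]) (assumption | rule lin)+
  finally show ?thesis .
qed


section \<open>The Drinfeld double\<close>

lemma tens_DD:
  "ptens DD DD = ptens W W" "tens DD DD = tens W W" "tlift DD DD = tlift W W"
  "ptens DD HH = ptens W W"
  by (rule tens_cong(1) tens_cong(3) tens_cong(4); simp add: DD_simps HH_simps)+

lemma DD_linear: "linear_map DD = linear_map W" "linear_map X DD = linear_map X W"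
  by (simp_all add: linear_map_def fun_eq_iff DD_simps)

lemma DD_bilinear: "bilinear_map DD DD = bilinear_map W W" "bilinear_map X Y DD = bilinear_map X Y W"
  by (simp_all add: bilinear_map_def DD_linear fun_eq_iff DD_simps)

lemma is_vspace_DD: "is_vspace DD"
  using is_vspace_tens[of A B] by (simp add: is_vspace_def DD_simps)

lemma cop_DD: "cop DD = tlift A B (\<lambda>\<mu> m. sw2 A (\<lambda>\<mu>1 \<mu>2. sw2 B (\<lambda>m1 m2. ptens W W (\<mu>2 \<sharp> m1) (\<mu>1 \<sharp> m2)) m) \<mu>)"
  by (simp add: drinfeld_double_def)

lemma cop_DD_linear: "linear_map W (tens W W) (cop DD)"
  unfolding cop_DD by (rule tlift_linear) (assumption | rule lin)+

lemma swD_pure: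
  assumes U: "is_vspace U" and f: "bilinear_map W W U f" and \<mu>: "\<mu> \<in> carr A" and m: "m \<in> carr B"
  shows "sw2 DD f (\<mu> \<sharp> m) = sw2 A (\<lambda>\<mu>1 \<mu>2. sw2 B (\<lambda>m1 m2. f (\<mu>2 \<sharp> m1) (\<mu>1 \<sharp> m2)) m) \<mu>"
proof -
  have "cop DD (\<mu> \<sharp> m) = sw2 A (\<lambda>\<mu>1 \<mu>2. sw2 B (\<lambda>m1 m2. ptens W W (\<mu>2 \<sharp> m1) (\<mu>1 \<sharp> m2)) m) \<mu>"
    unfolding cop_DD by (rule tlift_ptens[where U = "tens W W"]) (assumption | rule lin \<mu> m)+
  then show ?thesis
    unfolding sw2_def[of DD f] tens_DD
    by (simp only:) (rule tlift_sw2_sw2[OF coalgebra_A coalgebra_B U is_vspace_tens f \<mu> m], simp add: pure_mem)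
qed

lemma lin_swD_arg:
  "is_vspace U \<Longrightarrow> bilinear_map W W U f \<Longrightarrow> linear_map X W g \<Longrightarrow> linear_map X U (\<lambda>x. sw2 DD f (g x))"
  unfolding sw2_def tens_DD
  by (rule lin_tlift_arg[OF is_vspace_tens]) (assumption | rule linear_map_compose[OF cop_DD_linear])+

lemma lin_swD_fun:
  "is_vspace U \<Longrightarrow> c \<in> carr W \<Longrightarrow> (\<And>x y. x \<in> carr W \<Longrightarrow> y \<in> carr W \<Longrightarrow> linear_map X U (\<lambda>z. f z x y)) \<Longrightarrow>
   linear_map X U (\<lambda>z. sw2 DD (f z) c)"
  unfolding sw2_def tens_DD
  by (rule lin_tlift_fun[OF is_vspace_tens _ linear_mapD(1)[OF cop_DD_linear]])

lemma coun_DD: "coun DD = tlift A B (\<lambda>\<mu> m. \<langle>\<mu>, \<e>\<rangle> * \<epsilon> m)"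
  by (simp add: drinfeld_double_def A_simps(3))

lemma coun_DD_linear: "linear_map W scalars (coun DD)"
  unfolding coun_DD by (rule tlift_linear) (assumption | rule lin)+

lemma coun_DD_pure: "\<mu> \<in> carr A \<Longrightarrow> m \<in> carr B \<Longrightarrow> coun DD (\<mu> \<sharp> m) = \<langle>\<mu>, \<e>\<rangle> * \<epsilon> m"
  unfolding coun_DD by (rule tlift_ptens[where U = scalars]) (assumption | rule lin)+

text \<open>The coproduct is that of a tensor product of coalgebras, so the laws of the two factors
  are applied separately. The factor \<open>A\<close> carries reversed legs, which is why its
  coassociativity is used in the opposite direction to that of \<open>B\<close>.\<close>

lemma coalgebra_DD: "coalgebra DD"
proof (rule coalgebraI[OF is_vspace_DD])
  note [lin] = lin_swD_arg lin_swD_fun linear_map_compose[OF coun_DD_linear]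
  show "linear_map DD (tens DD DD) (cop DD)" "linear_map DD scalars (coun DD)"
    using cop_DD_linear coun_DD_linear by (simp_all add: DD_linear tens_DD)
  have tt: "tens DD (tens DD DD) = tens W (tens W W)" "ptens DD (tens DD DD) = ptens W (tens W W)"
    unfolding tens_DD by (rule tens_cong(1) tens_cong(3); simp add: DD_simps)+
  let ?U = "tens W (tens W W)"
  let ?G = "\<lambda>u v y. ptens W (tens W W) u (ptens W W v y)"
  fix c assume "c \<in> carr DD"
  then have c: "c \<in> carr W" by (simp add: DD_simps)
  show "sw2 DD (\<lambda>x y. sw2 DD (\<lambda>u v. ptens DD (tens DD DD) u (ptens DD DD v y)) x) c =
     sw2 DD (\<lambda>x y. sw2 DD (\<lambda>u v. ptens DD (tens DD DD) x (ptens DD DD u v)) y) c"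
    unfolding tt unfolding tens_DD
  proof (rule tens_eqI[where f = "sw2 DD (\<lambda>x y. sw2 DD (\<lambda>u v. ?G u v y) x)"
        and g = "sw2 DD (\<lambda>x y. sw2 DD (\<lambda>u v. ?G x u v) y)", OF is_vspace_A is_vspace_tens _ _ _ c])
    show "linear_map W ?U (sw2 DD (\<lambda>x y. sw2 DD (\<lambda>u v. ?G u v y) x))"
      by (rule lin_swD_arg[OF is_vspace_tens _ lin_id]) (assumption | rule lin)+
    show "linear_map W ?U (sw2 DD (\<lambda>x y. sw2 DD (\<lambda>u v. ?G x u v) y))"
      by (rule lin_swD_arg[OF is_vspace_tens _ lin_id]) (assumption | rule lin)+
    fix \<mu> m assume \<mu>: "\<mu> \<in> carr A" and m: "m \<in> carr B"
    note [lin] = \<mu> m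
    have "sw2 DD (\<lambda>x y. sw2 DD (\<lambda>u v. ?G u v y) x) (\<mu> \<sharp> m) =
      sw2 A (\<lambda>\<mu>1 \<mu>2. sw2 B (\<lambda>m1 m2. sw2 DD (\<lambda>u v. ?G u v (\<mu>1 \<sharp> m2)) (\<mu>2 \<sharp> m1)) m) \<mu>"
      by (rule swD_pure[OF is_vspace_tens]) (assumption | rule lin)+
    also have "\<dots> = sw2 A (\<lambda>\<mu>1 \<mu>2. sw2 B (\<lambda>m1 m2. sw2 A (\<lambda>\<nu>1 \<nu>2. sw2 B (\<lambda>n1 n2.
        ?G (\<nu>2 \<sharp> n1) (\<nu>1 \<sharp> n2) (\<mu>1 \<sharp> m2)) m1) \<mu>2) m) \<mu>"
      by (rule swA_cong, rule sw_cong, rule swD_pure[OF is_vspace_tens]) (assumption | rule lin)+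
    also have "\<dots> = sw2 A (\<lambda>\<mu>1 \<mu>2. sw2 A (\<lambda>\<nu>1 \<nu>2. sw2 B (\<lambda>m1 m2. sw2 B (\<lambda>n1 n2.
        ?G (\<nu>2 \<sharp> n1) (\<nu>1 \<sharp> n2) (\<mu>1 \<sharp> m2)) m1) m) \<mu>2) \<mu>"
      by (rule swA_cong[OF sw2_swap \<mu>])
    also have "\<dots> = sw2 A (\<lambda>\<mu>1 \<mu>2. sw2 A (\<lambda>\<nu>1 \<nu>2. sw2 B (\<lambda>m1 m2. sw2 B (\<lambda>n1 n2.
        ?G (\<nu>2 \<sharp> m1) (\<nu>1 \<sharp> n1) (\<mu>1 \<sharp> n2)) m2) m) \<mu>2) \<mu>"
      by (rule swA_cong, rule swA_cong, rule sw2_coassoc[OF coalgebra_B is_vspace_tens]) (assumption | rule lin)+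
    also have "\<dots> = sw2 A (\<lambda>\<mu>1 \<mu>2. sw2 A (\<lambda>\<nu>1 \<nu>2. sw2 B (\<lambda>m1 m2. sw2 B (\<lambda>n1 n2.
        ?G (\<mu>2 \<sharp> m1) (\<nu>2 \<sharp> n1) (\<nu>1 \<sharp> n2)) m2) m) \<mu>1) \<mu>"
      by (rule sw2_coassoc[OF coalgebra_A is_vspace_tens, symmetric]) (assumption | rule lin)+
    also have "\<dots> = sw2 A (\<lambda>\<mu>1 \<mu>2. sw2 B (\<lambda>m1 m2. sw2 A (\<lambda>\<nu>1 \<nu>2. sw2 B (\<lambda>n1 n2.
        ?G (\<mu>2 \<sharp> m1) (\<nu>2 \<sharp> n1) (\<nu>1 \<sharp> n2)) m2) \<mu>1) m) \<mu>"
      by (rule swA_cong[OF sw2_swap \<mu>])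
    also have "\<dots> = sw2 A (\<lambda>\<mu>1 \<mu>2. sw2 B (\<lambda>m1 m2. sw2 DD (\<lambda>u v. ?G (\<mu>2 \<sharp> m1) u v) (\<mu>1 \<sharp> m2)) m) \<mu>"
      by (rule swA_cong, rule sw_cong, rule swD_pure[OF is_vspace_tens, symmetric]) (assumption | rule lin)+
    also have "\<dots> = sw2 DD (\<lambda>x y. sw2 DD (\<lambda>u v. ?G x u v) y) (\<mu> \<sharp> m)"
      by (rule swD_pure[where f = "\<lambda>x y. sw2 DD (\<lambda>u v. ?G x u v) y", OF is_vspace_tens, symmetric]) (assumption | rule lin)+
    finally show "sw2 DD (\<lambda>x y. sw2 DD (\<lambda>u v. ?G u v y) x) (\<mu> \<sharp> m) =
      sw2 DD (\<lambda>x y. sw2 DD (\<lambda>u v. ?G x u v) y) (\<mu> \<sharp> m)" .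
  qed
  have l: "linear_map A W (\<lambda>\<mu>. \<mu> \<sharp> m)" if "m \<in> carr B" for m by (assumption | rule lin that)+
  have l': "linear_map B W (\<lambda>m. \<mu> \<sharp> m)" if "\<mu> \<in> carr A" for \<mu> by (assumption | rule lin that)+
  note cA = swA_counit[OF is_vspace_tens l, unfolded tens_simps]
  note cB = sw2_counit[OF coalgebra_B is_vspace_tens l', unfolded tens_simps]
  have bl: "bilinear_map W W W (\<lambda>x y. fscale (coun DD x) y)" "bilinear_map W W W (\<lambda>x y. fscale (coun DD y) x)"
    by (assumption | rule lin)+
  show "sw2 DD (\<lambda>x y. scl DD (coun DD x) y) c = c" unfolding DD_simps
  proof (rule tens_eqI[where f = "sw2 DD (\<lambda>x y. fscale (coun DD x) y)" and g = "\<lambda>x. x", OF is_vspace_A is_vspace_tens _ lin_id _ c])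
    show "linear_map W W (sw2 DD (\<lambda>x y. fscale (coun DD x) y))"
      by (rule lin_swD_arg[OF is_vspace_tens bl(1) lin_id])
    fix \<mu> m assume \<mu>: "\<mu> \<in> carr A" and m: "m \<in> carr B"
    note [lin] = \<mu> m
    have "sw2 DD (\<lambda>x y. fscale (coun DD x) y) (\<mu> \<sharp> m) =
      sw2 A (\<lambda>\<mu>1 \<mu>2. sw2 B (\<lambda>m1 m2. fscale (coun DD (\<mu>2 \<sharp> m1)) (\<mu>1 \<sharp> m2)) m) \<mu>"
      by (rule swD_pure[OF is_vspace_tens bl(1) \<mu> m])
    also have "\<dots> = sw2 A (\<lambda>\<mu>1 \<mu>2. sw2 B (\<lambda>m1 m2. fscale (\<epsilon> m1) (fscale \<langle>\<mu>2, \<e>\<rangle> \<mu>1 \<sharp> m2)) m) \<mu>"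
      by (intro swA_cong sw_cong \<mu> m) (simp add: coun_DD_pure fscale_fscale pure_scale mult.commute[of "\<langle>_, _\<rangle>"])
    also have "\<dots> = sw2 A (\<lambda>\<mu>1 \<mu>2. fscale \<langle>\<mu>2, \<e>\<rangle> \<mu>1 \<sharp> m) \<mu>"
      by (intro swA_cong \<mu>) (simp add: cB A_mem m)
    also have "\<dots> = \<mu> \<sharp> m"
      using cA(2)[OF m \<mu>] by (simp add: pure_scale m cong: swA_cong[OF _ \<mu>])
    finally show "sw2 DD (\<lambda>x y. fscale (coun DD x) y) (\<mu> \<sharp> m) = \<mu> \<sharp> m" .
  qed
  show "sw2 DD (\<lambda>x y. scl DD (coun DD y) x) c = c" unfolding DD_simps
  proof (rule tens_eqI[where f = "sw2 DD (\<lambda>x y. fscale (coun DD y) x)" and g = "\<lambda>x. x", OF is_vspace_A is_vspace_tens _ lin_id _ c])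
    show "linear_map W W (sw2 DD (\<lambda>x y. fscale (coun DD y) x))"
      by (rule lin_swD_arg[OF is_vspace_tens bl(2) lin_id])
    fix \<mu> m assume \<mu>: "\<mu> \<in> carr A" and m: "m \<in> carr B"
    note [lin] = \<mu> m
    have "sw2 DD (\<lambda>x y. fscale (coun DD y) x) (\<mu> \<sharp> m) =
      sw2 A (\<lambda>\<mu>1 \<mu>2. sw2 B (\<lambda>m1 m2. fscale (coun DD (\<mu>1 \<sharp> m2)) (\<mu>2 \<sharp> m1)) m) \<mu>"
      by (rule swD_pure[OF is_vspace_tens bl(2) \<mu> m])
    also have "\<dots> = sw2 A (\<lambda>\<mu>1 \<mu>2. sw2 B (\<lambda>m1 m2. fscale (\<epsilon> m2) (fscale \<langle>\<mu>1, \<e>\<rangle> \<mu>2 \<sharp> m1)) m) \<mu>"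
      by (intro swA_cong sw_cong \<mu> m) (simp add: coun_DD_pure fscale_fscale pure_scale mult.commute[of "\<langle>_, _\<rangle>"])
    also have "\<dots> = sw2 A (\<lambda>\<mu>1 \<mu>2. fscale \<langle>\<mu>1, \<e>\<rangle> \<mu>2 \<sharp> m) \<mu>"
      by (intro swA_cong \<mu>) (simp add: cB A_mem m)
    also have "\<dots> = \<mu> \<sharp> m"
      using cA(1)[OF m \<mu>] by (simp add: pure_scale m cong: swA_cong[OF _ \<mu>])
    finally show "sw2 DD (\<lambda>x y. fscale (coun DD y) x) (\<mu> \<sharp> m) = \<mu> \<sharp> m" .
  qed
qed

section \<open>The product of the Drinfeld double and the mixed coproduct identity\<close>

definition dpure :: "('b \<Rightarrow> 'k) \<Rightarrow> 'b \<Rightarrow> ('b \<Rightarrow> 'k) \<Rightarrow> 'b \<Rightarrow> ('k, 'b) dbl" where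
  "dpure \<mu> m \<nu> n = sw2 B (\<lambda>y m3. sw2 B (\<lambda>m1 m2.
     mul A \<mu> (rreg B (lreg B m1 \<nu>) (T m3)) \<sharp> m2 \<cdot> n) y) m"

lemma dpure_linear:
  shows "linear_map X A g \<Longrightarrow> a \<in> carr B \<Longrightarrow> \<beta> \<in> carr A \<Longrightarrow> b \<in> carr B \<Longrightarrow> linear_map X W (\<lambda>x. dpure (g x) a \<beta> b)"
    and "\<alpha> \<in> carr A \<Longrightarrow> linear_map X B g' \<Longrightarrow> \<beta> \<in> carr A \<Longrightarrow> b \<in> carr B \<Longrightarrow> linear_map X W (\<lambda>x. dpure \<alpha> (g' x) \<beta> b)"
    and "\<alpha> \<in> carr A \<Longrightarrow> a \<in> carr B \<Longrightarrow> linear_map X A g \<Longrightarrow> b \<in> carr B \<Longrightarrow> linear_map X W (\<lambda>x. dpure \<alpha> a (g x) b)"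
    and "\<alpha> \<in> carr A \<Longrightarrow> a \<in> carr B \<Longrightarrow> \<beta> \<in> carr A \<Longrightarrow> linear_map X B g' \<Longrightarrow> linear_map X W (\<lambda>x. dpure \<alpha> a \<beta> (g' x))"
  unfolding dpure_def by (assumption | rule lin)+

lemma mul_DD: "mul DD s t = tlift A B (\<lambda>\<alpha> a. tlift A B (\<lambda>\<beta> b. dpure \<alpha> a \<beta> b) t) s"
  by (simp add: drinfeld_double_def drinfeld_mul_def dpure_def sw3_def)

lemma mul_DD_bilinear: "bilinear_map W W W (mul DD)"
  unfolding mul_DD[abs_def] by (assumption | rule lin dpure_linear)+

lemma DD_pure:
  assumes "\<alpha> \<in> carr A" "a \<in> carr B" "\<beta> \<in> carr A" "b \<in> carr B"
  shows "mul DD (\<alpha> \<sharp> a) (\<beta> \<sharp> b) = dpure \<alpha> a \<beta> b"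
proof -
  have "mul DD (\<alpha> \<sharp> a) (\<beta> \<sharp> b) = tlift A B (\<lambda>\<beta> b. dpure \<alpha> a \<beta> b) (\<beta> \<sharp> b)"
    unfolding mul_DD by (rule tlift_ptens[where U = W]) (assumption | rule lin dpure_linear assms)+
  also have "\<dots> = dpure \<alpha> a \<beta> b"
    by (rule tlift_ptens[where U = W]) (assumption | rule lin dpure_linear assms)+
  finally show ?thesis .
qed

text \<open>On the unit of the dual both regular actions collapse to counits, and \<open>T\<close>
  preserves the counit, so the outer legs of \<open>a\<close> disappear.\<close>

lemma DD_B_B:
  assumes a: "a \<in> carr B" and b: "b \<in> carr B"
  shows "mul DD (unit A \<sharp> a) (unit A \<sharp> b) = unit A \<sharp> a \<cdot> b"
proof -
  note [lin] = a b
  have r: "rreg B (fscale c (unit A)) x = fscale c (fscale (\<epsilon> x) (unit A))" if "x \<in> carr B" for c x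
    using linear_mapD(3)[OF bilinear_mapD(1)[OF rreg_bilinear lin_id that] A_unit_mem, of c]
    by (simp add: A_simps(2) rreg_counit that)
  have l: "linear_map B W (\<lambda>x. unit A \<sharp> x \<cdot> b)" by (assumption | rule lin)+
  have "mul DD (unit A \<sharp> a) (unit A \<sharp> b) = sw2 B (\<lambda>y m3. sw2 B (\<lambda>m1 m2.
     fscale (\<epsilon> m1) (fscale (\<epsilon> m3) (unit A)) \<sharp> m2 \<cdot> b) y) a"
    unfolding DD_pure[OF A_unit_mem a A_unit_mem b] dpure_def
    by (intro sw_cong a) (simp add: lreg_counit r antip_inv_mem coun_antip_inv A_unit A_mem)
  also have "\<dots> = sw2 B (\<lambda>y m3. sw2 B (\<lambda>m1 m2. fscale (\<epsilon> m1) (fscale (\<epsilon> m3) (unit A \<sharp> m2 \<cdot> b))) y) a"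
    by (intro sw_cong a) (simp add: pure_scale A_mem B_mem b)
  also have "\<dots> = sw2 B (\<lambda>y m3. fscale (\<epsilon> m3) (unit A \<sharp> y \<cdot> b)) a"
    by (rule sw_cong, rule sw2_counit(1)[OF coalgebra_B is_vspace_tens, unfolded tens_simps]) (assumption | rule lin)+
  also have "\<dots> = unit A \<sharp> a \<cdot> b"
    by (rule sw2_counit(2)[OF coalgebra_B is_vspace_tens l, unfolded tens_simps]) (rule a)
  finally show ?thesis .
qed

lemma DD_A_pure:
  assumes \<mu>: "\<mu> \<in> carr A" and \<nu>: "\<nu> \<in> carr A" and n: "n \<in> carr B"
  shows "mul DD (\<mu> \<sharp> \<e>) (\<nu> \<sharp> n) = mul A \<mu> \<nu> \<sharp> n"
proof -
  note [lin] = assms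
  have "mul DD (\<mu> \<sharp> \<e>) (\<nu> \<sharp> n) = sw2 B (\<lambda>m1 m2. mul A \<mu> (rreg B (lreg B m1 \<nu>) (T \<e>)) \<sharp> m2 \<cdot> n) \<e>"
    unfolding DD_pure[OF \<mu> unit_mem \<nu> n] dpure_def
    by (rule sw_unit[OF is_vspace_tens]) (assumption | rule lin)+
  also have "\<dots> = mul A \<mu> (rreg B (lreg B \<e> \<nu>) (T \<e>)) \<sharp> \<e> \<cdot> n"
    by (rule sw_unit[OF is_vspace_tens]) (assumption | rule lin)+
  finally show ?thesis by (simp add: antip_inv_unit lreg_unit rreg_unit B_unit assms)
qed

text \<open>After regrouping, \<open>m\<close> is split into four legs whose middle two meet as
  \<open>d1 \<cdot> T c\<close>, the order in which the inverse antipode cancels.\<close>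

lemma sw_antip_inv_cancel:
  assumes U: "is_vspace U" and Q: "trilinear_map B B B U Q" and m: "m \<in> carr B"
  shows "sw2 B (\<lambda>m1 m2. sw2 B (\<lambda>y c. sw2 B (\<lambda>d1 d2. Q y (d1 \<cdot> T c) d2) m2) m1) m =
    sw2 B (\<lambda>y d. Q y \<e> d) m"
proof -
  note [lin] = U trilinear_mapD[OF Q] m
  have "sw2 B (\<lambda>m1 m2. sw2 B (\<lambda>y c. sw2 B (\<lambda>d1 d2. Q y (d1 \<cdot> T c) d2) m2) m1) m =
    sw2 B (\<lambda>y k. sw2 B (\<lambda>c l. sw2 B (\<lambda>d1 d2. Q y (d1 \<cdot> T c) d2) l) k) m"
    by (rule sw2_coassoc[OF coalgebra_B U]) (assumption | rule lin)+
  also have "\<dots> = sw2 B (\<lambda>y k. sw2 B (\<lambda>z d2. sw2 B (\<lambda>c d1. Q y (d1 \<cdot> T c) d2) z) k) m"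
    by (rule sw_cong, rule sw2_coassoc[OF coalgebra_B U, symmetric]) (assumption | rule lin)+
  also have "\<dots> = sw2 B (\<lambda>y k. sw2 B (\<lambda>z d2. scl U (\<epsilon> z) (Q y \<e> d2)) k) m"
    by (rule sw_cong, rule sw_cong, rule sw_antip_inv(1)[OF U]) (assumption | rule lin)+
  also have "\<dots> = sw2 B (\<lambda>y k. Q y \<e> k) m"
    by (rule sw_cong, rule sw2_counit(1)[OF coalgebra_B U]) (assumption | rule lin)+
  finally show ?thesis .
qed

lemma cop_DD_eq: "z \<in> carr W \<Longrightarrow> cop DD z = sw2 DD (ptens W W) z"
  using sw2_ptens[OF coalgebra_DD, of z] by (simp add: DD_simps tens_DD)

text \<open>Both sides are brought to sums of the same integrand \<open>Y\<close>. On the right the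
  leg \<open>d1\<close> from the Heisenberg factor and \<open>T c3\<close> from the Drinfeld factor
  are collected on one leg of \<nu> and cancel.\<close>

lemma cop_HH_pure:
  assumes \<mu>: "\<mu> \<in> carr A" and m: "m \<in> carr B" and \<nu>: "\<nu> \<in> carr A" and n: "n \<in> carr B"
  shows "cop DD (hpure \<mu> m \<nu> n) = sw2 DD (\<lambda>x1 x2. sw2 DD (\<lambda>y1 y2.
    ptens W W (mul DD x1 y1) (mul HH x2 y2)) (\<nu> \<sharp> n)) (\<mu> \<sharp> m)"
proof -
  note V = is_vspace_tens[of W W]
  note [lin] = assms lin_swD_arg lin_swD_fun bilinear_mapD[OF HH_bilinear] bilinear_mapD[OF mul_DD_bilinear]
  note push = sw2_swap[where C = A and D = B]
  let ?P = "ptens W W"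
  \<comment> \<open>The argument \<open>z\<close> acts from the right on the last leg of \<nu>. It
    is the unit on the left side, and \<open>d1 \<cdot> T c3\<close> on the right side before the
    cancellation.\<close>
  define Y where "Y c1 c2 z d2 n1 n2 = sw2 A (\<lambda>\<mu>1 \<mu>2. sw2 A (\<lambda>\<nu>1 \<nu>2.
    ?P (mul A \<mu>2 (lreg B c1 (rreg B \<nu>2 z)) \<sharp> c2 \<cdot> n1) (mul A \<mu>1 \<nu>1 \<sharp> d2 \<cdot> n2)) \<nu>) \<mu>" for c1 c2 z d2 n1 n2
  have "cop DD (hpure \<mu> m \<nu> n) = sw2 B (\<lambda>m1 m2. cop DD (mul A \<mu> (lreg B m1 \<nu>) \<sharp> m2 \<cdot> n)) m"
    unfolding hpure_def by (rule sw_hom[OF is_vspace_tens cop_DD_linear]) (assumption | rule lin)+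
  also have "\<dots> = sw2 B (\<lambda>m1 m2. sw2 DD ?P (mul A \<mu> (lreg B m1 \<nu>) \<sharp> m2 \<cdot> n)) m"
    by (rule sw_cong, rule cop_DD_eq) (assumption | rule lin)+
  also have "\<dots> = sw2 B (\<lambda>m1 m2. sw2 A (\<lambda>p q. sw2 B (\<lambda>r s. ?P (q \<sharp> r) (p \<sharp> s)) (m2 \<cdot> n))
      (mul A \<mu> (lreg B m1 \<nu>))) m"
    by (rule sw_cong, rule swD_pure[OF V]) (assumption | rule lin)+
  also have "\<dots> = sw2 B (\<lambda>m1 m2. sw2 A (\<lambda>\<mu>1 \<mu>2. sw2 A (\<lambda>\<nu>1 \<nu>2.
      sw2 B (\<lambda>r s. ?P (mul A \<mu>2 \<nu>2 \<sharp> r) (mul A \<mu>1 \<nu>1 \<sharp> s)) (m2 \<cdot> n)) (lreg B m1 \<nu>)) \<mu>) m"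
    by (rule sw_cong, rule swA_mul[OF V]) (assumption | rule lin)+
  also have "\<dots> = sw2 B (\<lambda>m1 m2. sw2 A (\<lambda>\<mu>1 \<mu>2. sw2 A (\<lambda>\<nu>1 \<nu>2.
      sw2 B (\<lambda>r s. ?P (mul A \<mu>2 (lreg B m1 \<nu>2) \<sharp> r) (mul A \<mu>1 \<nu>1 \<sharp> s)) (m2 \<cdot> n)) \<nu>) \<mu>) m"
    by (rule sw_cong, rule swA_cong, rule swA_lreg[OF V]) (assumption | rule lin)+
  also have "\<dots> = sw2 B (\<lambda>m1 m2. sw2 A (\<lambda>\<mu>1 \<mu>2. sw2 A (\<lambda>\<nu>1 \<nu>2. sw2 B (\<lambda>c d. sw2 B (\<lambda>n1 n2.
      ?P (mul A \<mu>2 (lreg B m1 \<nu>2) \<sharp> c \<cdot> n1) (mul A \<mu>1 \<nu>1 \<sharp> d \<cdot> n2)) n) m2) \<nu>) \<mu>) m"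
    by (rule sw_cong, rule swA_cong, rule swA_cong, rule sw_mul[OF V]) (assumption | rule lin)+
  also have "\<dots> = sw2 B (\<lambda>m1 m2. sw2 B (\<lambda>c d. sw2 B (\<lambda>n1 n2. sw2 A (\<lambda>\<mu>1 \<mu>2. sw2 A (\<lambda>\<nu>1 \<nu>2.
      ?P (mul A \<mu>2 (lreg B m1 \<nu>2) \<sharp> c \<cdot> n1) (mul A \<mu>1 \<nu>1 \<sharp> d \<cdot> n2)) \<nu>) \<mu>) n) m2) m"
    by (simp only: push)
  also have "\<dots> = sw2 B (\<lambda>m1 m2. sw2 B (\<lambda>c d. sw2 B (\<lambda>n1 n2. Y m1 c \<e> d n1 n2) n) m2) m"
    unfolding Y_def by (intro sw_cong swA_cong assms; (assumption | simp only: rreg_unit))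
  also have "\<dots> = sw2 B (\<lambda>m1 m2. sw2 B (\<lambda>n1 n2. sw2 B (\<lambda>c d. Y m1 c \<e> d n1 n2) m2) n) m"
    by (rule sw_cong[OF sw2_swap m])
  also have "\<dots> = sw2 B (\<lambda>n1 n2. sw2 B (\<lambda>m1 m2. sw2 B (\<lambda>c d. Y m1 c \<e> d n1 n2) m2) m) n"
    by (rule sw2_swap)
  finally have lhs: "cop DD (hpure \<mu> m \<nu> n) =
    sw2 B (\<lambda>n1 n2. sw2 B (\<lambda>m1 m2. sw2 B (\<lambda>c d. Y m1 c \<e> d n1 n2) m2) m) n" .

  have expand: "?P (dpure \<mu>2 m1 \<nu>2 n1) (hpure \<mu>1 m2 \<nu>1 n2) =
      sw2 B (\<lambda>y c3. sw2 B (\<lambda>c1 c2. sw2 B (\<lambda>d1 d2.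
        ?P (mul A \<mu>2 (rreg B (lreg B c1 \<nu>2) (T c3)) \<sharp> c2 \<cdot> n1) (mul A \<mu>1 (lreg B d1 \<nu>1) \<sharp> d2 \<cdot> n2)) m2) y) m1"
    if "\<mu>1 \<in> carr A" "\<mu>2 \<in> carr A" "\<nu>1 \<in> carr A" "\<nu>2 \<in> carr A" "m1 \<in> carr B" "m2 \<in> carr B"
      "n1 \<in> carr B" "n2 \<in> carr B" for \<mu>1 \<mu>2 \<nu>1 \<nu>2 m1 m2 n1 n2
  proof -
    note [lin] = that hpure_linear dpure_linear
    have hm: "hpure \<mu>1 m2 \<nu>1 n2 \<in> carr W" unfolding hpure_def by (assumption | rule lin)+
    have "?P (dpure \<mu>2 m1 \<nu>2 n1) (hpure \<mu>1 m2 \<nu>1 n2) = sw2 B (\<lambda>y c3. ?P (sw2 B (\<lambda>c1 c2.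
        mul A \<mu>2 (rreg B (lreg B c1 \<nu>2) (T c3)) \<sharp> c2 \<cdot> n1) y) (hpure \<mu>1 m2 \<nu>1 n2)) m1"
      unfolding dpure_def
      by (rule sw_hom[OF is_vspace_tens, where g = "\<lambda>x. ?P x _"]) (assumption | rule lin hm)+
    also have "\<dots> = sw2 B (\<lambda>y c3. sw2 B (\<lambda>c1 c2.
        ?P (mul A \<mu>2 (rreg B (lreg B c1 \<nu>2) (T c3)) \<sharp> c2 \<cdot> n1) (hpure \<mu>1 m2 \<nu>1 n2)) y) m1"
      by (rule sw_cong, rule sw_hom[OF is_vspace_tens, where g = "\<lambda>x. ?P x _"]) (assumption | rule lin hm)+
    also have "\<dots> = sw2 B (\<lambda>y c3. sw2 B (\<lambda>c1 c2. sw2 B (\<lambda>d1 d2.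
        ?P (mul A \<mu>2 (rreg B (lreg B c1 \<nu>2) (T c3)) \<sharp> c2 \<cdot> n1) (mul A \<mu>1 (lreg B d1 \<nu>1) \<sharp> d2 \<cdot> n2)) m2) y) m1"
      unfolding hpure_def
      by (rule sw_cong, rule sw_cong, rule sw_hom[OF is_vspace_tens, where g = "\<lambda>x. ?P _ x"]) (assumption | rule lin)+
    finally show ?thesis .
  qed
  have "sw2 DD (\<lambda>x1 x2. sw2 DD (\<lambda>y1 y2. ?P (mul DD x1 y1) (mul HH x2 y2)) (\<nu> \<sharp> n)) (\<mu> \<sharp> m) =
    sw2 A (\<lambda>\<mu>1 \<mu>2. sw2 B (\<lambda>m1 m2. sw2 DD (\<lambda>y1 y2.
      ?P (mul DD (\<mu>2 \<sharp> m1) y1) (mul HH (\<mu>1 \<sharp> m2) y2)) (\<nu> \<sharp> n)) m) \<mu>"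
    by (rule swD_pure[OF V]) (assumption | rule lin)+
  also have "\<dots> = sw2 A (\<lambda>\<mu>1 \<mu>2. sw2 B (\<lambda>m1 m2. sw2 A (\<lambda>\<nu>1 \<nu>2. sw2 B (\<lambda>n1 n2.
      ?P (mul DD (\<mu>2 \<sharp> m1) (\<nu>2 \<sharp> n1)) (mul HH (\<mu>1 \<sharp> m2) (\<nu>1 \<sharp> n2))) n) \<nu>) m) \<mu>"
    by (rule swA_cong, rule sw_cong, rule swD_pure[OF V]) (assumption | rule lin)+
  also have "\<dots> = sw2 A (\<lambda>\<mu>1 \<mu>2. sw2 B (\<lambda>m1 m2. sw2 A (\<lambda>\<nu>1 \<nu>2. sw2 B (\<lambda>n1 n2.
      sw2 B (\<lambda>y c3. sw2 B (\<lambda>c1 c2. sw2 B (\<lambda>d1 d2.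
        ?P (mul A \<mu>2 (rreg B (lreg B c1 \<nu>2) (T c3)) \<sharp> c2 \<cdot> n1) (mul A \<mu>1 (lreg B d1 \<nu>1) \<sharp> d2 \<cdot> n2)) m2) y) m1) n) \<nu>) m) \<mu>"
    by (rule swA_cong, rule sw_cong, rule swA_cong, rule sw_cong)
      (simp_all only: DD_pure HH_pure expand assms)
  \<comment> \<open>All sums over legs in \<open>B\<close> are pulled outside the sums over legs in
    the dual, so that \<open>m\<close> and \<open>n\<close> can be regrouped freely around
    \<open>Y\<close>.\<close>
  also have "\<dots> = sw2 B (\<lambda>m1 m2. sw2 B (\<lambda>n1 n2. sw2 B (\<lambda>y c3. sw2 B (\<lambda>c1 c2. sw2 B (\<lambda>d1 d2.
      sw2 A (\<lambda>\<mu>1 \<mu>2. sw2 A (\<lambda>\<nu>1 \<nu>2.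
        ?P (mul A \<mu>2 (rreg B (lreg B c1 \<nu>2) (T c3)) \<sharp> c2 \<cdot> n1) (mul A \<mu>1 (lreg B d1 \<nu>1) \<sharp> d2 \<cdot> n2)) \<nu>) \<mu>) m2) y) m1) n) m"
    by (simp only: push)
  also have "\<dots> = sw2 B (\<lambda>m1 m2. sw2 B (\<lambda>n1 n2. sw2 B (\<lambda>y c3. sw2 B (\<lambda>c1 c2. sw2 B (\<lambda>d1 d2.
      sw2 A (\<lambda>\<mu>1 \<mu>2. sw2 A (\<lambda>\<nu>1 \<nu>2.
        ?P (mul A \<mu>2 (lreg B c1 (rreg B \<nu>2 (T c3))) \<sharp> c2 \<cdot> n1) (mul A \<mu>1 (lreg B d1 \<nu>1) \<sharp> d2 \<cdot> n2)) \<nu>) \<mu>) m2) y) m1) n) m"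
    by (intro sw_cong swA_cong assms; (assumption | simp only: lreg_rreg antip_inv_mem))
  \<comment> \<open>\<open>swA_lreg_rreg\<close> transfers \<open>d1\<close> from
    \<open>\<nu>1\<close> to \<open>\<nu>2\<close>, where it joins \<open>T c3\<close>.\<close>
  also have "\<dots> = sw2 B (\<lambda>m1 m2. sw2 B (\<lambda>n1 n2. sw2 B (\<lambda>y c3. sw2 B (\<lambda>c1 c2. sw2 B (\<lambda>d1 d2.
      Y c1 c2 (d1 \<cdot> T c3) d2 n1 n2) m2) y) m1) n) m"
    unfolding Y_def
    by (rule sw_cong, rule sw_cong, rule sw_cong, rule sw_cong, rule sw_cong, rule swA_cong,
      rule swA_lreg_rreg[OF V, where f = "\<lambda>u v. ?P (mul A _ (lreg B _ u) \<sharp> _) (mul A _ v \<sharp> _)"])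
      (assumption | rule lin)+
  also have "\<dots> = sw2 B (\<lambda>n1 n2. sw2 B (\<lambda>m1 m2. sw2 B (\<lambda>y c3. sw2 B (\<lambda>c1 c2. sw2 B (\<lambda>d1 d2.
      Y c1 c2 (d1 \<cdot> T c3) d2 n1 n2) m2) y) m1) m) n"
    by (rule sw2_swap)
  also have "\<dots> = sw2 B (\<lambda>n1 n2. sw2 B (\<lambda>m1 m2. sw2 B (\<lambda>y c3. sw2 B (\<lambda>d1 d2. sw2 B (\<lambda>c1 c2.
      Y c1 c2 (d1 \<cdot> T c3) d2 n1 n2) y) m2) m1) m) n"
    by (rule sw_cong[OF _ n], rule sw_cong[OF _ m], rule sw_cong[OF sw2_swap])
  also have "\<dots> = sw2 B (\<lambda>n1 n2. sw2 B (\<lambda>y d. sw2 B (\<lambda>c1 c2. Y c1 c2 \<e> d n1 n2) y) m) n"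
    by (rule sw_cong, rule sw_antip_inv_cancel[OF V, where Q = "\<lambda>y z d. sw2 B (\<lambda>c1 c2. Y c1 c2 z d _ _) y"],
      unfold Y_def) (assumption | rule lin)+
  also have "\<dots> = sw2 B (\<lambda>n1 n2. sw2 B (\<lambda>m1 m2. sw2 B (\<lambda>c d. Y m1 c \<e> d n1 n2) m2) m) n"
    by (rule sw_cong, rule sw2_coassoc[OF coalgebra_B V], unfold Y_def) (assumption | rule lin)+
  finally show ?thesis unfolding lhs by simp
qed

lemma cop_mul_HH:
  assumes x: "x \<in> carr W" and y: "y \<in> carr W"
  shows "cop DD (mul HH x y) = sw2 DD (\<lambda>x1 x2. sw2 DD (\<lambda>y1 y2.
    ptens W W (mul DD x1 y1) (mul HH x2 y2)) y) x"
proof (rule bilinear_eqI[where f = "\<lambda>x y. cop DD (mul HH x y)" and g = "\<lambda>x y. sw2 DD (\<lambda>x1 x2. sw2 DD (\<lambda>y1 y2.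
    ptens W W (mul DD x1 y1) (mul HH x2 y2)) y) x", OF is_vspace_A is_vspace_A is_vspace_tens[of W W] _ _ _ x y])
  note [lin] = lin_swD_arg lin_swD_fun bilinear_mapD[OF HH_bilinear] bilinear_mapD[OF mul_DD_bilinear]
    linear_map_compose[OF cop_DD_linear]
  show "bilinear_map W W (tens W W) (\<lambda>x y. cop DD (mul HH x y))"
    by (assumption | rule lin)+
  show "bilinear_map W W (tens W W) (\<lambda>x y. sw2 DD (\<lambda>x1 x2. sw2 DD (\<lambda>y1 y2.
    ptens W W (mul DD x1 y1) (mul HH x2 y2)) y) x)"
    by (assumption | rule lin)+
qed (simp add: HH_pure cop_HH_pure)

text \<open>Stated for an abstract product \<open>M\<close>, because the smash product and the
  product of the Drinfeld double agree on \<open>B\<close> and for left multiplication by the dual.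
  The Heisenberg instance gives \<open>psi\<close>, and the Drinfeld instance gives the
  antipode.\<close>

lemma convolution_inverse:
  assumes M: "bilinear_map W W W M"
    and assoc: "\<And>x y z. x \<in> carr W \<Longrightarrow> y \<in> carr W \<Longrightarrow> z \<in> carr W \<Longrightarrow> M (M x y) z = M x (M y z)"
    and MB: "\<And>a b. a \<in> carr B \<Longrightarrow> b \<in> carr B \<Longrightarrow> M (unit A \<sharp> a) (unit A \<sharp> b) = unit A \<sharp> a \<cdot> b"
    and MA: "\<And>\<mu> \<nu> n. \<mu> \<in> carr A \<Longrightarrow> \<nu> \<in> carr A \<Longrightarrow> n \<in> carr B \<Longrightarrow> M (\<mu> \<sharp> \<e>) (\<nu> \<sharp> n) = mul A \<mu> \<nu> \<sharp> n"
    and P: "P = tlift A B (\<lambda>\<mu> m. M (unit A \<sharp> S m) (T' \<mu> \<sharp> \<e>))"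
  shows "linear_map W W P"
    and "x \<in> carr W \<Longrightarrow> sw2 DD (\<lambda>a b. M a (P b)) x = fscale (coun DD x) (unit A \<sharp> \<e>)"
    and "x \<in> carr W \<Longrightarrow> sw2 DD (\<lambda>a b. M (P a) b) x = fscale (coun DD x) (unit A \<sharp> \<e>)"
proof -
  note V = is_vspace_tens[of A B]
  note [lin] = bilinear_mapD[OF M]
  show Pl: "linear_map W W P"
    unfolding P by (rule tlift_linear) (assumption | rule lin)+
  note [lin] = linear_map_compose[OF Pl] linear_mapD(1)[OF Pl] lin_swD_arg lin_swD_fun
  have Pp: "P (\<mu> \<sharp> m) = M (unit A \<sharp> S m) (T' \<mu> \<sharp> \<e>)" if "\<mu> \<in> carr A" "m \<in> carr B" for \<mu> m
    unfolding P by (rule tlift_ptens[where U = W]) (assumption | rule lin that)+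
  note mem = pure_mem A_mem B_mem bilinear_mapD(3)[OF M]
  have unit: "linear_map W W (\<lambda>x. fscale (coun DD x) (unit A \<sharp> \<e>))"
    by (assumption | rule lin linear_map_compose[OF coun_DD_linear])+
  {
    fix \<mu> m assume \<mu>: "\<mu> \<in> carr A" and m: "m \<in> carr B"
    note [lin] = \<mu> m
    have "sw2 DD (\<lambda>a b. M a (P b)) (\<mu> \<sharp> m) =
      sw2 A (\<lambda>\<mu>1 \<mu>2. sw2 B (\<lambda>m1 m2. M (\<mu>2 \<sharp> m1) (P (\<mu>1 \<sharp> m2))) m) \<mu>"
      by (rule swD_pure[OF V]) (assumption | rule lin)+
    also have "\<dots> = sw2 A (\<lambda>\<mu>1 \<mu>2. sw2 B (\<lambda>m1 m2. M (\<mu>2 \<sharp> m1 \<cdot> S m2) (T' \<mu>1 \<sharp> \<e>)) m) \<mu>"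
    proof (intro swA_cong sw_cong \<mu> m)
      fix \<mu>1 \<mu>2 m1 m2
      assume a: "\<mu>1 \<in> carr A" "\<mu>2 \<in> carr A" "m1 \<in> carr B" "m2 \<in> carr B"
      \<comment> \<open>Both factors are split into a part from the dual and a part from
        \<open>B\<close>; the two parts from \<open>B\<close> become adjacent and cancel through
        \<open>S\<close>, after which those from the dual cancel through \<open>T'\<close>.\<close>
      have "M (\<mu>2 \<sharp> m1) (P (\<mu>1 \<sharp> m2)) =
          M (M (\<mu>2 \<sharp> \<e>) (unit A \<sharp> m1)) (M (unit A \<sharp> S m2) (T' \<mu>1 \<sharp> \<e>))"
        using a by (simp add: Pp MA mem A_unit)
      also have "\<dots> = M (M (\<mu>2 \<sharp> \<e>) (M (unit A \<sharp> m1) (unit A \<sharp> S m2))) (T' \<mu>1 \<sharp> \<e>)"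
        using a by (simp only: assoc mem)
      also have "\<dots> = M (\<mu>2 \<sharp> m1 \<cdot> S m2) (T' \<mu>1 \<sharp> \<e>)"
        using a by (simp add: MA MB mem A_unit)
      finally show "M (\<mu>2 \<sharp> m1) (P (\<mu>1 \<sharp> m2)) = M (\<mu>2 \<sharp> m1 \<cdot> S m2) (T' \<mu>1 \<sharp> \<e>)" .
    qed
    also have "\<dots> = sw2 A (\<lambda>\<mu>1 \<mu>2. fscale (\<epsilon> m) (M (\<mu>2 \<sharp> \<e>) (T' \<mu>1 \<sharp> \<e>))) \<mu>"
      by (rule swA_cong, rule sw_antip(1)[OF V, unfolded tens_simps]) (assumption | rule lin)+
    also have "\<dots> = sw2 A (\<lambda>\<mu>1 \<mu>2. fscale (\<epsilon> m) (mul A \<mu>2 (T' \<mu>1) \<sharp> \<e>)) \<mu>"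
      by (intro swA_cong \<mu>) (simp add: MA mem)
    also have "\<dots> = fscale \<langle>\<mu>, \<e>\<rangle> (fscale (\<epsilon> m) (unit A \<sharp> \<e>))"
      by (rule swA_conv(1)[OF V, unfolded tens_simps]) (assumption | rule lin)+
    also have "\<dots> = fscale (coun DD (\<mu> \<sharp> m)) (unit A \<sharp> \<e>)"
      by (simp add: coun_DD_pure \<mu> m fscale_fscale)
    finally have "sw2 DD (\<lambda>a b. M a (P b)) (\<mu> \<sharp> m) = fscale (coun DD (\<mu> \<sharp> m)) (unit A \<sharp> \<e>)" .
  } note right = this
  {
    fix \<mu> m assume \<mu>: "\<mu> \<in> carr A" and m: "m \<in> carr B"
    note [lin] = \<mu> m
    have "sw2 DD (\<lambda>a b. M (P a) b) (\<mu> \<sharp> m) =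
      sw2 A (\<lambda>\<mu>1 \<mu>2. sw2 B (\<lambda>m1 m2. M (P (\<mu>2 \<sharp> m1)) (\<mu>1 \<sharp> m2)) m) \<mu>"
      by (rule swD_pure[OF V]) (assumption | rule lin)+
    also have "\<dots> = sw2 A (\<lambda>\<mu>1 \<mu>2. sw2 B (\<lambda>m1 m2. M (unit A \<sharp> S m1) (mul A (T' \<mu>2) \<mu>1 \<sharp> m2)) m) \<mu>"
      by (intro swA_cong sw_cong \<mu> m) (simp add: Pp assoc mem MA)
    \<comment> \<open>Here the parts from the dual stand innermost, so the sums are exchanged to
      cancel them first.\<close>
    also have "\<dots> = sw2 B (\<lambda>m1 m2. sw2 A (\<lambda>\<mu>1 \<mu>2. M (unit A \<sharp> S m1) (mul A (T' \<mu>2) \<mu>1 \<sharp> m2)) \<mu>) m"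
      by (rule sw2_swap)
    also have "\<dots> = sw2 B (\<lambda>m1 m2. fscale \<langle>\<mu>, \<e>\<rangle> (M (unit A \<sharp> S m1) (unit A \<sharp> m2))) m"
      by (rule sw_cong, rule swA_conv(2)[OF V, unfolded tens_simps]) (assumption | rule lin)+
    also have "\<dots> = sw2 B (\<lambda>m1 m2. fscale \<langle>\<mu>, \<e>\<rangle> (unit A \<sharp> S m1 \<cdot> m2)) m"
      by (intro sw_cong m) (simp add: MB B_mem)
    also have "\<dots> = fscale (\<epsilon> m) (fscale \<langle>\<mu>, \<e>\<rangle> (unit A \<sharp> \<e>))"
      by (rule sw_antip(2)[OF V, unfolded tens_simps]) (assumption | rule lin)+
    also have "\<dots> = fscale (coun DD (\<mu> \<sharp> m)) (unit A \<sharp> \<e>)"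
      by (simp add: coun_DD_pure \<mu> m fscale_fscale[symmetric] mult.commute)
    finally have "sw2 DD (\<lambda>a b. M (P a) b) (\<mu> \<sharp> m) = fscale (coun DD (\<mu> \<sharp> m)) (unit A \<sharp> \<e>)" .
  } note left = this
  show "sw2 DD (\<lambda>a b. M a (P b)) x = fscale (coun DD x) (unit A \<sharp> \<e>)" if x: "x \<in> carr W"
  proof (rule tens_eqI[where f = "sw2 DD (\<lambda>a b. M a (P b))" and g = "\<lambda>x. fscale (coun DD x) (unit A \<sharp> \<e>)",
        OF is_vspace_A V _ unit right x])
    show "linear_map W W (sw2 DD (\<lambda>a b. M a (P b)))"
      by (rule lin_swD_arg[OF V _ lin_id]) (assumption | rule lin)+
  qed
  show "sw2 DD (\<lambda>a b. M (P a) b) x = fscale (coun DD x) (unit A \<sharp> \<e>)" if x: "x \<in> carr W"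
  proof (rule tens_eqI[where f = "sw2 DD (\<lambda>a b. M (P a) b)" and g = "\<lambda>x. fscale (coun DD x) (unit A \<sharp> \<e>)",
        OF is_vspace_A V _ unit left x])
    show "linear_map W W (sw2 DD (\<lambda>a b. M (P a) b))"
      by (rule lin_swD_arg[OF V _ lin_id]) (assumption | rule lin)+
  qed
qed

section \<open>The doubles as a cleft pair\<close>

definition psi :: "('k, 'b) dbl \<Rightarrow> ('k, 'b) dbl" where
  "psi = tlift A B (\<lambda>\<mu> m. mul HH (unit A \<sharp> S m) (T' \<mu> \<sharp> \<e>))"

lemma psi_convolution:
  shows "linear_map W W psi"
    and "x \<in> carr W \<Longrightarrow> sw2 DD (\<lambda>a b. mul HH a (psi b)) x = fscale (coun DD x) (unit A \<sharp> \<e>)"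
    and "x \<in> carr W \<Longrightarrow> sw2 DD (\<lambda>a b. mul HH (psi a) b) x = fscale (coun DD x) (unit A \<sharp> \<e>)"
  by (rule convolution_inverse[OF HH_bilinear HH_assoc HH_pure_B[OF A_unit_mem] HH_A_pure psi_def]; assumption)+

lemma cleft_pair_doubles: "cleft_pair DD HH psi"
proof
  have bl: "bilinear_map W W (tens W W) (ptens W W)" by (rule ptens_bilinear)
  have "cop DD (unit A \<sharp> \<e>) = sw2 A (\<lambda>\<mu>1 \<mu>2. sw2 B (\<lambda>m1 m2. ptens W W (\<mu>2 \<sharp> m1) (\<mu>1 \<sharp> m2)) \<e>) (unit A)"
    by (simp add: cop_DD_eq pure_mem A_mem unit_mem swD_pure[OF is_vspace_tens bl])
  also have "\<dots> = sw2 B (\<lambda>m1 m2. ptens W W (unit A \<sharp> m1) (unit A \<sharp> m2)) \<e>"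
    by (rule swA_unit[OF is_vspace_tens]) (assumption | rule lin)+
  also have "\<dots> = ptens W W (unit A \<sharp> \<e>) (unit A \<sharp> \<e>)"
    by (rule sw_unit[OF is_vspace_tens]) (assumption | rule lin)+
  finally show "cop DD (unit DD) = ptens DD DD (unit DD) (unit DD)"
    by (simp add: DD_simps tens_DD)
  show "coun DD (unit DD) = 1"
    by (simp add: DD_simps coun_DD_pure A_mem unit_mem pairing_unit coun_unit)
  show "linear_map DD DD psi" using psi_convolution(1) by (simp only: DD_linear)
  show "bilinear_map DD DD DD (mul DD)" using mul_DD_bilinear by (simp only: DD_bilinear)
  fix x assume "x \<in> carr DD"
  then have x: "x \<in> carr W" by (simp only: DD_simps)
  show "sw2 DD (\<lambda>a b. mul HH a (psi b)) x = scl DD (coun DD x) (unit DD)"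
    unfolding DD_simps by (rule psi_convolution(2)[OF x])
  show "sw2 DD (\<lambda>a b. mul HH (psi a) b) x = scl DD (coun DD x) (unit DD)"
    unfolding DD_simps by (rule psi_convolution(3)[OF x])
  fix y assume "y \<in> carr DD"
  then have y: "y \<in> carr W" by (simp only: DD_simps)
  show "cop DD (mul HH x y) =
      sw2 DD (\<lambda>x1 x2. sw2 DD (\<lambda>y1 y2. ptens DD DD (mul DD x1 y1) (mul HH x2 y2)) y) x"
    unfolding tens_DD by (rule cop_mul_HH[OF x y])
qed (simp_all only: DD_simps HH_simps algebra_HH coalgebra_DD)

text \<open>The order matters: associativity of \<open>\<star>\<close> is first taken from the cleft
  pair, and only then can \<open>convolution_inverse\<close> be applied to \<open>\<star>\<close> to
  yield the antipode axioms.\<close>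

lemma hopf_algebra_DD: "hopf_algebra DD"
proof -
  interpret cp: cleft_pair DD HH psi by (rule cleft_pair_doubles)
  have assoc: "mul DD (mul DD x y) z = mul DD x (mul DD y z)" if "x \<in> carr W" "y \<in> carr W" "z \<in> carr W" for x y z
    using cp.D_assoc that by (simp add: DD_simps)
  have anti: "antip DD = tlift A B (\<lambda>\<mu> m. mul DD (unit A \<sharp> S m) (T' \<mu> \<sharp> \<e>))"
    by (simp add: drinfeld_double_def)
  have "linear_map DD DD (antip DD)"
    unfolding DD_linear
    by (rule convolution_inverse(1)[OF mul_DD_bilinear assoc DD_B_B DD_A_pure anti]; assumption)
  moreover have "sw2 DD (\<lambda>x y. mul DD (antip DD x) y) h = scl DD (coun DD h) (unit DD) \<and>
    sw2 DD (\<lambda>x y. mul DD x (antip DD y)) h = scl DD (coun DD h) (unit DD)" if "h \<in> carr DD" for h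
  proof -
    have h: "h \<in> carr W" using that by (simp only: DD_simps)
    show ?thesis
      unfolding DD_simps
      by (intro conjI convolution_inverse(2,3)[OF mul_DD_bilinear assoc DD_B_B DD_A_pure anti]; (assumption | rule h))
  qed
  ultimately show ?thesis
    using cp.bialgebra_D by (simp add: hopf_algebra_def sw2_def)
qed

text \<open>Multiplying by \<open>psi\<close> means multiplying on the right by \<open>S m2\<close>
  and then by \<open>T' \<mu>1\<close>. The latter splits the coproduct of \<open>T' \<mu>1\<close>,
  whose reversal accounts for the second and first legs of \<mu> in the action formula.\<close>

lemma dd_action_eq:
  assumes h: "h \<in> carr W" and x: "x \<in> carr W"
  shows "dd_action B h x = sw2 DD (\<lambda>p q. mul HH (mul HH p x) (psi q)) h"
proof -
  note [lin] = lin_swD_arg lin_swD_fun bilinear_mapD[OF HH_bilinear]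
    linear_map_compose[OF psi_convolution(1)] linear_mapD(1)[OF psi_convolution(1)]
  note V = is_vspace_tens[of A B]
  note push = sw2_swap[where C = A and D = B]
  \<comment> \<open>The action on pure tensors with the threefold coproducts written as nested ones.
    As \<open>sw3\<close> splits the first leg again, the sums match those from \<open>psi\<close>
    up to their order.\<close>
  define ap where "ap \<mu> m \<alpha> a = sw2 A (\<lambda>y \<mu>3. sw2 A (\<lambda>\<mu>1 \<mu>2. sw2 B (\<lambda>z m3. sw2 B (\<lambda>m1 m2.
    mul A (mul A \<mu>3 (lreg B m1 \<alpha>)) (T' \<mu>2) \<sharp> rreg_dual B ((m2 \<cdot> a) \<cdot> S m3) (T' \<mu>1)) z) m) y) \<mu>" for \<mu> m \<alpha> a
  have act: "dd_action B h x = tlift A B (\<lambda>\<mu> m. tlift A B (\<lambda>\<alpha> a. ap \<mu> m \<alpha> a) x) h" for h x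
    by (simp add: dd_action_def ap_def sw3_def)
  show ?thesis
  proof (rule bilinear_eqI[where f = "dd_action B" and g = "\<lambda>h x. sw2 DD (\<lambda>p q. mul HH (mul HH p x) (psi q)) h",
        OF is_vspace_A is_vspace_A V _ _ _ h x])
    show "bilinear_map W W W (dd_action B)"
      unfolding act[abs_def] ap_def by (assumption | rule lin)+
    show "bilinear_map W W W (\<lambda>h x. sw2 DD (\<lambda>p q. mul HH (mul HH p x) (psi q)) h)"
      by (assumption | rule lin)+
    fix \<mu> m \<alpha> a
    assume \<mu>: "\<mu> \<in> carr A" and m: "m \<in> carr B" and \<alpha>: "\<alpha> \<in> carr A" and a: "a \<in> carr B"
    note [lin] = \<mu> m \<alpha> a
    have "dd_action B (\<mu> \<sharp> m) (\<alpha> \<sharp> a) = tlift A B (\<lambda>\<alpha> a. ap \<mu> m \<alpha> a) (\<alpha> \<sharp> a)"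
      unfolding act by (rule tlift_ptens[where U = W], unfold ap_def) (assumption | rule lin)+
    also have "\<dots> = ap \<mu> m \<alpha> a"
      by (rule tlift_ptens[where U = W], unfold ap_def) (assumption | rule lin)+
    also have "\<dots> = sw2 B (\<lambda>m1 m2. sw2 B (\<lambda>c d. sw2 A (\<lambda>\<mu>1 \<mu>2. sw2 A (\<lambda>\<kappa>1 \<kappa>2.
        mul A (mul A \<mu>2 (lreg B c \<alpha>)) (T' \<kappa>2) \<sharp> rreg_dual B ((d \<cdot> a) \<cdot> S m2) (T' \<kappa>1)) \<mu>1) \<mu>) m1) m"
      unfolding ap_def by (simp only: push)
    finally have lhs: "dd_action B (\<mu> \<sharp> m) (\<alpha> \<sharp> a) = \<dots>" .
    have step: "mul HH (mul HH (\<mu>2 \<sharp> m1) (\<alpha> \<sharp> a)) (psi (\<mu>1 \<sharp> m2)) =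
        sw2 B (\<lambda>c d. sw2 A (\<lambda>\<kappa>1 \<kappa>2. mul A (mul A \<mu>2 (lreg B c \<alpha>)) (T' \<kappa>2) \<sharp>
          rreg_dual B ((d \<cdot> a) \<cdot> S m2) (T' \<kappa>1)) \<mu>1) m1"
      if b: "\<mu>1 \<in> carr A" "\<mu>2 \<in> carr A" "m1 \<in> carr B" "m2 \<in> carr B" for \<mu>1 \<mu>2 m1 m2
    proof -
      note [lin] = b
      note mem = pure_mem A_mem B_mem reg_mem HH_mem
      have psi: "psi (\<mu>1 \<sharp> m2) = mul HH (unit A \<sharp> S m2) (T' \<mu>1 \<sharp> \<e>)"
        unfolding psi_def by (rule tlift_ptens[where U = W]) (assumption | rule lin)+
      have "mul HH (mul HH (\<mu>2 \<sharp> m1) (\<alpha> \<sharp> a)) (psi (\<mu>1 \<sharp> m2)) =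
        mul HH (mul HH (hpure \<mu>2 m1 \<alpha> a) (unit A \<sharp> S m2)) (T' \<mu>1 \<sharp> \<e>)"
        unfolding psi using b \<alpha> a by (simp add: HH_assoc mem HH_pure[symmetric])
      also have "\<dots> = sw2 B (\<lambda>c d. mul HH (mul HH (mul A \<mu>2 (lreg B c \<alpha>) \<sharp> d \<cdot> a) (unit A \<sharp> S m2)) (T' \<mu>1 \<sharp> \<e>)) m1"
        unfolding hpure_def
        by (rule sw_hom[OF V, where g = "\<lambda>x. mul HH (mul HH x _) _"]) (assumption | rule lin)+
      also have "\<dots> = sw2 B (\<lambda>c d. sw2 A (\<lambda>\<nu>1 \<nu>2. mul A (mul A \<mu>2 (lreg B c \<alpha>)) \<nu>1 \<sharp>
          rreg_dual B ((d \<cdot> a) \<cdot> S m2) \<nu>2) (T' \<mu>1)) m1"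
        by (rule sw_cong) (simp_all add: HH_pure_B HH_pure_A mem b \<alpha> a)
      also have "\<dots> = sw2 B (\<lambda>c d. sw2 A (\<lambda>\<kappa>1 \<kappa>2. mul A (mul A \<mu>2 (lreg B c \<alpha>)) (T' \<kappa>2) \<sharp>
          rreg_dual B ((d \<cdot> a) \<cdot> S m2) (T' \<kappa>1)) \<mu>1) m1"
        by (rule sw_cong, rule swA_antip_inv[OF V]) (assumption | rule lin)+
      finally show ?thesis .
    qed
    have "sw2 DD (\<lambda>p q. mul HH (mul HH p (\<alpha> \<sharp> a)) (psi q)) (\<mu> \<sharp> m) =
      sw2 A (\<lambda>\<mu>1 \<mu>2. sw2 B (\<lambda>m1 m2. mul HH (mul HH (\<mu>2 \<sharp> m1) (\<alpha> \<sharp> a)) (psi (\<mu>1 \<sharp> m2))) m) \<mu>"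
      by (rule swD_pure[OF V]) (assumption | rule lin)+
    also have "\<dots> = sw2 A (\<lambda>\<mu>1 \<mu>2. sw2 B (\<lambda>m1 m2. sw2 B (\<lambda>c d. sw2 A (\<lambda>\<kappa>1 \<kappa>2.
        mul A (mul A \<mu>2 (lreg B c \<alpha>)) (T' \<kappa>2) \<sharp> rreg_dual B ((d \<cdot> a) \<cdot> S m2) (T' \<kappa>1)) \<mu>1) m1) m) \<mu>"
      by (intro swA_cong sw_cong \<mu> m step)
    also have "\<dots> = dd_action B (\<mu> \<sharp> m) (\<alpha> \<sharp> a)"
      unfolding lhs by (simp only: push)
    finally show "dd_action B (\<mu> \<sharp> m) (\<alpha> \<sharp> a) =
      sw2 DD (\<lambda>p q. mul HH (mul HH p (\<alpha> \<sharp> a)) (psi q)) (\<mu> \<sharp> m)" by simp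
  qed
qed

lemma dd_coaction_eq: "dd_coaction B = cop DD"
  unfolding dd_coaction_def cop_DD tens_DD ..

end

theorem theorem2p2:
  fixes B :: "('k::field, 'b::ab_group_add) hopf"
  assumes "hopf_algebra B"
    and "bij_betw (antip B) (carr B) (carr B)"
  shows "yd_module_algebra (drinfeld_double B) (heisenberg_double B) (dd_action B) (dd_coaction B)"
proof -
  interpret hopf_bij B using assms by unfold_locales
  interpret cp: cleft_pair DD HH psi by (rule cleft_pair_doubles)
  have "yd_module_algebra DD HH (dd_action B) (cop DD)"
    by (rule yd_module_algebra_cong[OF cp.yd_module_algebra_act[OF hopf_algebra_DD]])
      (simp add: DD_simps HH_simps dd_action_eq cp.act_def)
  then show ?thesis by (simp add: dd_coaction_eq)
qed

end
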